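(* For every positive integer $k\neq 6$, we have $f(\mathbb{N}_6) < f(\mathbb{N}_k)$.
   Context: For a positive integer $n$, $\Omega(n)$ denotes the number of prime factors of $n$ counted with multiplicity. For each integer $k\ge 1$, $\mathbb{N}_k=\{n\ge 1:\Omega(n)=k\}$ is the set of $k$-almost primes. For a set $A$ of integers $>1$, $f(A):=\sum_{n\in A}\frac{1}{n\log n}$; thus $f(\mathbb{N}_k)=\sum_{\Omega(n)=k}\frac{1}{n\log n}$, a convergent series for each $k\ge1$. *)

theory Defs
  imports "HOL-Analysis.Analysis" "HOL-Computational_Algebra.Primes"
begin

definition bigomega :: "nat \<Rightarrow> nat" where
  "bigomega n = size (prime_factorization n)"

definition almost_primes :: "nat \<Rightarrow> nat set" where
  "almost_primes k = {n. n \<ge> 1 \<and> bigomega n = k}"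

text \<open>
  Intended for sets of integers greater than 1. All terms are then positive, so unordered
  summation agrees with the usual sum of the series; for a divergent series the value is 0
  by the convention of \<^const>\<open>infsum\<close>.
\<close>

definition erdos_sum :: "nat set \<Rightarrow> real" where
  "erdos_sum A = (\<Sum>\<^sub>\<infinity>n\<in>A. 1 / (real n * ln (real n)))"

end

theory Submission
  imports Defs
begin

text \<open>
  For \<open>\<lambda> = ln n\<close> the sum over all integers \<open>i\<close> of \<open>\<lambda> 2\<^sup>-\<^sup>i exp (- \<lambda> 2\<^sup>-\<^sup>i)\<close> is, up to a relative
  error of about \<open>10\<^sup>-\<^sup>5\<close>, independent of \<open>\<lambda>\<close>. Hence \<open>f(N\<^sub>k)\<close> is, up to such an error and a common
  constant, the sum over \<open>i\<close> of \<open>t\<^sub>i P\<^sub>k(1 + t\<^sub>i)\<close>, where \<open>t\<^sub>i = 2 / 2\<^sup>i\<close> and \<open>P\<^sub>k(s)\<close> is the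
  sum of \<open>n\<^sup>-\<^sup>s\<close> over the \<open>k\<close>-almost primes. Newton's identities express \<open>P\<^sub>k(s)\<close> through the values
  \<open>P(j s)\<close> of the prime zeta function, which are computed with integer arithmetic from
  \<open>ln \<zeta>(s) = \<Sum>\<^sub>j P(j s) / j\<close> and the Euler-Maclaurin formula. The smallest gap,
  \<open>f(N\<^sub>5) - f(N\<^sub>6)\<close>, is about \<open>1.3 * 10\<^sup>-\<^sup>4\<close>, so that the error of the octave sum is harmless.

  Near \<open>t = 0\<close> the function \<open>P(1 + t)\<close> grows by almost exactly \<open>ln 2\<close> when \<open>t\<close> is halved, and
  \<open>P(j (1 + t))\<close> with \<open>j \<ge> 2\<close> hardly changes. This gives recursions for the tail sums over large \<open>i\<close>. For
  all large \<open>k\<close> it also gives a renewal inequality, by which the sum for \<open>k\<close> is at least the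
  average of those for \<open>k - j\<close> with the weights \<open>(ln 2)\<^sup>j / j!\<close>, up to an exponentially small
  error, and so the sums stay well above that for \<open>6\<close>.
\<close>

section \<open>Complete homogeneous sums of power sums\<close>

text \<open>The series of \<open>1 / (n ln n)\<close> converge too slowly to be compared directly;
  the classical remedy integrates \<open>n powr - s\<close> over \<open>s > 1\<close>. The octave
  sum is the trapezoidal rule for this integral in the variable \<open>ln (s - 1)\<close>. Its
  relative error is a function of \<open>ln n\<close> alone, so no quadrature error depending on
  \<open>k\<close> has to be controlled. The largest node is \<open>t = 2\<close> because a 6-almost
  prime is at least \<open>64\<close>, whence \<open>2 ln n \<ge> 8\<close>, and from
  \<open>8\<close> on the one-sided sum is close enough to its two-sided limit. For the other
  indices only an upper bound on the octave sum enters, and that bound holds for every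
  \<open>n\<close>, however small. The two constants \<open>1.44264\<close> and
  \<open>1.442756\<close> around \<open>1 / ln 2\<close> differ by a relative
  \<open>8.0 * 10^-5\<close>, while the computed lower bound for \<open>k = 5\<close> exceeds the
  upper bound for \<open>k = 6\<close> by a relative \<open>1.1 * 10^-4\<close>. The halving
  estimates are available for \<open>t \<le> 1 / 8\<close>, which is why the tails start at
  \<open>i = 4\<close>.\<close>

fun hom :: "(nat \<Rightarrow> real) \<Rightarrow> nat \<Rightarrow> real" where
  "hom p k = (if k = 0 then 1 else (\<Sum>j=1..k. hom p (k - j) * p j) / real k)"

declare hom.simps [simp del]

lemma hom_0 [simp]: "hom p 0 = 1"
  by (simp add: hom.simps)

lemma hom_rec: "real k * hom p k = (\<Sum>j=1..k. hom p (k - j) * p j)"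
  by (cases "k = 0") (simp_all add: hom.simps [of p k])

lemma hom_unique:
  assumes "q 0 = 1"
    and rec: "\<And>k. real k * q k = (\<Sum>j=1..k. q (k - j) * p j)"
  shows "q k = hom p k"
proof (induction k rule: less_induct)
  case (less k)
  show ?case
  proof (cases "k = 0")
    case False
    have "real k * q k = (\<Sum>j=1..k. q (k - j) * p j)"
      by (rule rec)
    also have "\<dots> = (\<Sum>j=1..k. hom p (k - j) * p j)"
      using False less by (intro sum.cong) auto
    also have "\<dots> = real k * hom p k"
      by (simp add: hom_rec)
    finally show ?thesis
      using False by simp
  qed (use assms in simp)
qed

lemma hom_mono:
  assumes "\<And>j. 1 \<le> j \<Longrightarrow> j \<le> k \<Longrightarrow> 0 \<le> p j" "\<And>j. 1 \<le> j \<Longrightarrow> j \<le> k \<Longrightarrow> p j \<le> p' j"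
  shows "0 \<le> hom p k \<and> hom p k \<le> hom p' k"
  using assms
proof (induction k rule: less_induct)
  case (less k)
  show ?case
  proof (cases "k = 0")
    case False
    have IH: "0 \<le> hom p (k - j) \<and> hom p (k - j) \<le> hom p' (k - j)" if "j \<in> {1..k}" for j
      using that less.prems by (intro less.IH) auto
    have "0 \<le> (\<Sum>j=1..k. hom p (k - j) * p j)"
      using IH less.prems by (intro sum_nonneg mult_nonneg_nonneg) auto
    moreover have "(\<Sum>j=1..k. hom p (k - j) * p j) \<le> (\<Sum>j=1..k. hom p' (k - j) * p' j)"
    proof (intro sum_mono mult_mono)
      fix j assume "j \<in> {1..k}"
      then show "0 \<le> hom p' (k - j)" using IH [of j] by linarith
    qed (use IH less.prems in auto)
    ultimately show ?thesis
      using False by (simp add: hom.simps [of p k] hom.simps [of p' k] divide_right_mono)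
  qed simp
qed

text \<open>The generating function of \<open>hom p\<close> is
  \<open>exp (\<Sum>j. p j z^j / j)\<close>, so adding \<open>a\<close> to \<open>p 1\<close>
  multiplies it by \<open>exp (a z)\<close>. Instead of manipulating power series, the proof checks
  that the convolution satisfies the defining recursion.\<close>

lemma hom_shift:
  "hom (p(1 := p 1 + a)) k = (\<Sum>j\<le>k. a ^ j / fact j * hom p (k - j))"
proof -
  define r where "r k = (\<Sum>j\<le>k. a ^ j / fact j * hom p (k - j))" for k
  have "r k = hom (p(1 := p 1 + a)) k"
  proof (rule hom_unique)
    show "r 0 = 1" by (simp add: r_def)
    fix k
    \<comment> \<open>The weight \<open>k\<close> is split as \<open>j + (k - j)\<close>, which
      mirrors the product rule: the part \<open>j\<close> differentiates \<open>exp (a z)\<close>,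
      the part \<open>k - j\<close> is the recursion for \<open>p\<close>.\<close>
    have 1: "(\<Sum>j\<le>k. real j * (a ^ j / fact j * hom p (k - j))) = (if k = 0 then 0 else a * r (k - 1))"
    proof (cases k)
      case (Suc m)
      have "(\<Sum>j\<le>Suc m. real j * (a ^ j / fact j * hom p (Suc m - j)))
          = (\<Sum>j\<le>m. real (Suc j) * (a ^ Suc j / fact (Suc j) * hom p (m - j)))"
        by (subst sum.atMost_Suc_shift) simp
      also have "\<dots> = (\<Sum>j\<le>m. a * (a ^ j / fact j * hom p (m - j)))"
        by (intro sum.cong) (auto simp: field_simps simp del: of_nat_Suc)
      finally show ?thesis
        using Suc by (simp add: r_def sum_distrib_left)
    qed simp
    have "(\<Sum>j\<le>k. real (k - j) * (a ^ j / fact j * hom p (k - j)))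
        = (\<Sum>j\<le>k. \<Sum>i=1..k-j. a ^ j / fact j * (hom p (k - j - i) * p i))"
    proof (intro sum.cong refl)
      fix j
      have "real (k - j) * (a ^ j / fact j * hom p (k - j)) = a ^ j / fact j * (real (k - j) * hom p (k - j))"
        by simp
      then show "real (k - j) * (a ^ j / fact j * hom p (k - j))
          = (\<Sum>i=1..k-j. a ^ j / fact j * (hom p (k - j - i) * p i))"
        by (simp only: hom_rec sum_distrib_left)
    qed
    also have "\<dots> = (\<Sum>i=1..k. \<Sum>j\<le>k-i. a ^ j / fact j * (hom p (k - j - i) * p i))"
      by (subst sum.Sigma; simp?; subst sum.Sigma; simp?)
         (rule sum.reindex_bij_witness [of _ "\<lambda>(i,j). (j,i)" "\<lambda>(i,j). (j,i)"]; auto)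
    also have "\<dots> = (\<Sum>i=1..k. r (k - i) * p i)"
      by (intro sum.cong refl) (simp add: r_def sum_distrib_left mult_ac diff_diff_left add.commute)
    finally have 2: "(\<Sum>j\<le>k. real (k - j) * (a ^ j / fact j * hom p (k - j))) = (\<Sum>i=1..k. r (k - i) * p i)" .
    have "real k * r k = (\<Sum>j\<le>k. (real j + real (k - j)) * (a ^ j / fact j * hom p (k - j)))"
      unfolding r_def sum_distrib_left by (intro sum.cong) auto
    also have "\<dots> = (if k = 0 then 0 else a * r (k - 1)) + (\<Sum>i=1..k. r (k - i) * p i)"
      by (simp only: distrib_right sum.distrib 1 2)
    also have "\<dots> = (\<Sum>i=1..k. r (k - i) * (p(1 := p 1 + a)) i)"
    proof (cases "k = 0")
      case False
      then have "{1..k} = insert 1 {2..k}" by auto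
      then show ?thesis using False by (simp add: algebra_simps cong: sum.cong_simp)
    qed simp
    finally show "real k * r k = (\<Sum>i=1..k. r (k - i) * (p(1 := p 1 + a)) i)" .
  qed
  then show ?thesis by (simp add: r_def)
qed

lemma hom_shift_le:
  assumes "0 \<le> a" "\<And>j. 1 \<le> j \<Longrightarrow> 0 \<le> p j" "p 1 + a \<le> p' 1" "\<And>j. 2 \<le> j \<Longrightarrow> p j \<le> p' j"
  shows "(\<Sum>j\<le>k. a ^ j / fact j * hom p (k - j)) \<le> hom p' k"
proof -
  have "p j \<le> p' j" if "j \<ge> 1" "j \<noteq> 1" for j
    using assms(4) [of j] that by simp
  then have "hom (p(1 := p 1 + a)) k \<le> hom p' k"
    using assms by (intro hom_mono [THEN conjunct2]) auto
  then show ?thesis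
    by (simp only: hom_shift)
qed

text \<open>With \<open>A(z) = \<Sum>k\<le>K. q_k z^k\<close> and \<open>L(z) = \<Sum>j\<le>K. p_j z^j / j\<close>, the
  recursion gives \<open>A' \<le> A L'\<close>, so that \<open>A exp (-L)\<close> is decreasing.\<close>

lemma hom_partial_sum_le_exp:
  assumes p: "\<And>j. 1 \<le> j \<Longrightarrow> 0 \<le> p j" and "0 \<le> z"
  shows "(\<Sum>k\<le>K. hom p k * z ^ k) \<le> exp (\<Sum>j=1..K. p j * z ^ j / real j)"
proof -
  have hom0: "0 \<le> hom p k" for k
    using p hom_mono [of k p p] by auto
  define A where "A z = (\<Sum>k\<le>K. hom p k * z ^ k)" for z
  define L where "L z = (\<Sum>j=1..K. p j * z ^ j / real j)" for z
  define A' where "A' z = (\<Sum>k=1..K. real k * hom p k * z ^ (k - 1))" for z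
  define L' where "L' z = (\<Sum>j=1..K. p j * z ^ (j - 1))" for z
  have dA: "(A has_real_derivative A' z) (at z)" for z
  proof -
    have "(A has_real_derivative (\<Sum>k\<le>K. hom p k * (real k * z ^ (k - 1)))) (at z)"
      unfolding A_def by (auto intro!: derivative_eq_intros sum.cong)
    also have "(\<Sum>k\<le>K. hom p k * (real k * z ^ (k - 1))) = A' z"
      unfolding A'_def by (intro sum.mono_neutral_cong_right) (auto simp: not_le Suc_le_eq)
    finally show ?thesis .
  qed
  have dL: "(L has_real_derivative L' z) (at z)" for z
    unfolding L_def L'_def by (auto intro!: derivative_eq_intros sum.cong)
  have A'_le: "A' z \<le> A z * L' z" if "z \<ge> 0" for z
  proof -
    have "A' z = (\<Sum>k=1..K. \<Sum>j=1..k. (hom p (k - j) * z ^ (k - j)) * (p j * z ^ (j - 1)))"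
      unfolding A'_def
    proof (intro sum.cong refl)
      fix k assume k: "k \<in> {1..K}"
      have "real k * hom p k * z ^ (k - 1) = (\<Sum>j=1..k. hom p (k - j) * p j * z ^ (k - 1))"
        by (simp add: hom_rec sum_distrib_right)
      also have "\<dots> = (\<Sum>j=1..k. (hom p (k - j) * z ^ (k - j)) * (p j * z ^ (j - 1)))"
      proof (intro sum.cong refl)
        fix j assume "j \<in> {1..k}"
        then have "k - 1 = (k - j) + (j - 1)" by auto
        then show "hom p (k - j) * p j * z ^ (k - 1) = (hom p (k - j) * z ^ (k - j)) * (p j * z ^ (j - 1))"
          by (simp add: power_add)
      qed
      finally show "real k * hom p k * z ^ (k - 1) = \<dots>" .
    qed
    also have "\<dots> = (\<Sum>(k,j)\<in>(SIGMA k:{1..K}. {1..k}). (hom p (k - j) * z ^ (k - j)) * (p j * z ^ (j - 1)))"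
      by (subst sum.Sigma) auto
    also have "\<dots> = (\<Sum>(i,j)\<in>(\<lambda>(k,j). (k - j, j)) ` (SIGMA k:{1..K}. {1..k}). (hom p i * z ^ i) * (p j * z ^ (j - 1)))"
      by (subst sum.reindex) (auto simp: inj_on_def intro!: sum.cong)
    also have "\<dots> \<le> (\<Sum>(i,j)\<in>{..K} \<times> {1..K}. (hom p i * z ^ i) * (p j * z ^ (j - 1)))"
      using hom0 p that by (intro sum_mono2) auto
    also have "\<dots> = A z * L' z"
      unfolding A_def L'_def by (simp add: sum_product sum.cartesian_product)
    finally show ?thesis .
  qed
  define f where "f z = A z * exp (- L z)" for z
  have "f z \<le> f 0"
  proof (rule DERIV_nonpos_imp_nonincreasing [OF \<open>0 \<le> z\<close>])
    fix x :: real assume "0 \<le> x"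
    have "(f has_real_derivative (A' x - A x * L' x) * exp (- L x)) (at x)"
      unfolding f_def by (auto intro!: derivative_eq_intros dA dL simp: algebra_simps)
    moreover have "(A' x - A x * L' x) * exp (- L x) \<le> 0"
      using A'_le [OF \<open>0 \<le> x\<close>] by (intro mult_nonpos_nonneg) auto
    ultimately show "\<exists>y. (f has_real_derivative y) (at x) \<and> y \<le> 0" by blast
  qed
  also have "f 0 = 1"
  proof -
    have "A 0 = 1" unfolding A_def by (subst sum.remove [of _ 0]) (auto intro!: sum.neutral)
    moreover have "L 0 = 0" unfolding L_def by (auto intro!: sum.neutral)
    ultimately show ?thesis by (simp add: f_def)
  qed
  finally have "A z * exp (- L z) \<le> 1" by (simp add: f_def)
  then have "A z \<le> exp (L z)" by (simp add: exp_minus field_simps)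
  then show ?thesis by (simp add: A_def L_def)
qed

text \<open>A nonnegative coefficient is at most the generating function at \<open>z\<close> divided
  by \<open>z ^ k\<close>. Only the \<open>p j\<close> with \<open>j \<le> k\<close> enter, so no
  convergence is involved and \<open>z\<close> may exceed \<open>1\<close>.\<close>

lemma hom_le_exp:
  assumes "\<And>j. 1 \<le> j \<Longrightarrow> 0 \<le> p j" and "0 < z"
  shows "hom p k \<le> exp (\<Sum>j=1..k. p j * z ^ j / real j) / z ^ k"
proof -
  have "hom p k * z ^ k \<le> (\<Sum>i\<le>k. hom p i * z ^ i)"
    using assms hom_mono [of _ p p] by (intro member_le_sum) auto
  also have "\<dots> \<le> exp (\<Sum>j=1..k. p j * z ^ j / real j)"
    using assms by (intro hom_partial_sum_le_exp) auto
  finally show ?thesis using \<open>0 < z\<close> by (simp add: field_simps)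
qed

section \<open>Zeta functions of primes and almost primes\<close>

definition zeta :: "real \<Rightarrow> real" where
  "zeta s = (\<Sum>n. real (Suc n) powr - s)"

definition pzeta :: "real \<Rightarrow> real" where
  "pzeta s = (\<Sum>\<^sub>\<infinity>p\<in>{p::nat. prime p}. real p powr - s)"

definition apz :: "real \<Rightarrow> nat \<Rightarrow> real" where
  "apz s k = (\<Sum>\<^sub>\<infinity>n\<in>almost_primes k. real n powr - s)"

lemma powr_summable_on:
  assumes "s > 1"
  shows "(\<lambda>n::nat. real n powr - s) summable_on A"
proof -
  have "(\<lambda>n::nat. real n powr - s) summable_on UNIV"
    using assms by (subst summable_on_UNIV_nonneg_real_iff) (simp_all add: summable_real_powr_iff)
  then show ?thesis
    by (rule summable_on_subset_banach) simp
qed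

lemma summable_zeta: "s > 1 \<Longrightarrow> summable (\<lambda>n. real (Suc n) powr - s)"
  by (subst summable_Suc_iff [where f = "\<lambda>n. real n powr - s"]) (simp add: summable_real_powr_iff)

lemma zeta_has_sum:
  assumes "s > 1"
  shows "((\<lambda>n::nat. real n powr - s) has_sum zeta s) {1..}"
proof -
  have "((\<lambda>n::nat. real (Suc n) powr - s) has_sum zeta s) UNIV"
    unfolding zeta_def using summable_zeta [OF assms]
    by (intro norm_summable_imp_has_sum) (auto intro: summable_sums)
  moreover have "bij_betw Suc UNIV {1..}"
    by (rule bij_betwI [where g = "\<lambda>n. n - 1"]) auto
  ultimately show ?thesis
    using has_sum_reindex_bij_betw [of Suc UNIV "{1..}" "\<lambda>n. real n powr - s" "zeta s"] by simp
qed

lemma zeta_ge_1: "s > 1 \<Longrightarrow> 1 \<le> zeta s"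
  using sum_le_suminf [OF summable_zeta, of s "{0}"] by (simp add: zeta_def)

lemma pzeta_has_sum: "s > 1 \<Longrightarrow> ((\<lambda>p. real p powr - s) has_sum pzeta s) {p. prime p}"
  unfolding pzeta_def by (intro has_sum_infsum powr_summable_on)

lemma apz_has_sum: "s > 1 \<Longrightarrow> ((\<lambda>n. real n powr - s) has_sum apz s k) (almost_primes k)"
  unfolding apz_def by (intro has_sum_infsum powr_summable_on)

lemma pzeta_nonneg: "0 \<le> pzeta s"
  unfolding pzeta_def by (rule infsum_nonneg) simp

lemma apz_nonneg: "0 \<le> apz s k"
  unfolding apz_def by (rule infsum_nonneg) simp

lemma pzeta_antimono:
  assumes "1 < s" "s \<le> s'"
  shows "pzeta s' \<le> pzeta s"
proof (rule has_sum_mono [OF pzeta_has_sum pzeta_has_sum])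
  fix p :: nat assume "p \<in> {p. prime p}"
  then have "real p > 1" using prime_gt_1_nat by auto
  then show "real p powr - s' \<le> real p powr - s" using assms by simp
qed (use assms in auto)

section \<open>Newton's identities for almost primes\<close>

lemma bigomega_prime_power_mult:
  assumes "prime p" "m \<ge> 1"
  shows "bigomega (p ^ j * m) = j + bigomega m"
  using assms by (simp add: bigomega_def prime_factorization_mult prime_factorization_prime_power)

lemma almost_primes_0: "almost_primes 0 = {1}"
  by (auto simp: almost_primes_def bigomega_def prime_factorization_empty_iff)

lemma apz_0 [simp]: "apz s 0 = 1"
  by (simp add: apz_def almost_primes_0)

text \<open>A prime of exact order \<open>m\<close> in \<open>n\<close> accounts for the exponents
  \<open>1, ..., m\<close>. This count produces the factor \<open>k\<close> in Newton's
  identity.\<close>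

lemma bigomega_eq_card:
  assumes "n \<ge> 1"
  shows "finite {(p, j). prime p \<and> 1 \<le> j \<and> p ^ j dvd n}" (is ?fin)
    and "card {(p, j). prime p \<and> 1 \<le> j \<and> p ^ j dvd n} = bigomega n" (is ?card)
proof -
  have eq: "{(p, j). prime p \<and> 1 \<le> j \<and> p ^ j dvd n} = (SIGMA p:prime_factors n. {1..multiplicity p n})"
  proof (intro set_eqI, clarify)
    fix p j
    have "p ^ j dvd n \<longleftrightarrow> j \<le> multiplicity p n" if "prime p"
      using that assms by (intro power_dvd_iff_le_multiplicity) (auto simp: prime_nat_iff)
    moreover have "p dvd n" if "p ^ j dvd n" "1 \<le> j"
      using that by (meson dvd_power dvd_trans less_le_trans zero_less_one)
    ultimately show "(p, j) \<in> {(p, j). prime p \<and> 1 \<le> j \<and> p ^ j dvd n} \<longleftrightarrow>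
        (p, j) \<in> (SIGMA p:prime_factors n. {1..multiplicity p n})"
      using assms by (auto simp: in_prime_factors_iff)
  qed
  show ?fin unfolding eq by auto
  have "card (SIGMA p:prime_factors n. {1..multiplicity p n}) = (\<Sum>p\<in>prime_factors n. multiplicity p n)"
    by (simp add: card_SigmaI)
  also have "\<dots> = bigomega n"
    unfolding bigomega_def size_multiset_overloaded_eq
    by (intro sum.cong) (auto simp: count_prime_factorization_prime in_prime_factors_iff)
  finally show ?card unfolding eq .
qed

text \<open>Double counting: both sides add up \<open>n powr - s\<close> over the triples
  \<open>(n, p, j)\<close> with \<open>p ^ j\<close> dividing \<open>n\<close>. Each
  \<open>n\<close> occurs in \<open>k\<close> of them; for fixed \<open>j\<close> the substitution
  \<open>n = p ^ j * m\<close> factors the term and leaves a \<open>(k - j)\<close>-almost prime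
  \<open>m\<close>.\<close>

lemma apz_rec:
  assumes "s > 1"
  shows "real k * apz s k = (\<Sum>j=1..k. apz s (k - j) * pzeta (real j * s))"
proof -
  define D where "D n = {(p, j). prime p \<and> 1 \<le> j \<and> p ^ j dvd n}" for n :: nat
  define T where "T = (SIGMA n:almost_primes k. D n)"
  define U where "U = (SIGMA j:{1..k}. almost_primes (k - j) \<times> {p::nat. prime p})"
  have inner: "((\<lambda>y. (\<lambda>(n,_). real n powr - s) (n, y)) has_sum real k * real n powr - s) (D n)"
    if "n \<in> almost_primes k" for n
  proof -
    have n: "n \<ge> 1" "bigomega n = k" using that by (auto simp: almost_primes_def)
    then have "finite (D n)" "card (D n) = k"
      using bigomega_eq_card [of n] by (simp_all add: D_def)
    then show ?thesis
      by (intro has_sum_finiteI) auto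
  qed
  have lhs: "((\<lambda>n. real k * real n powr - s) has_sum real k * apz s k) (almost_primes k)"
    using apz_has_sum [OF assms] by (intro has_sum_cmult_right)
  have sT: "(\<lambda>(n,_). real n powr - s) summable_on T"
    unfolding T_def
    by (rule summable_on_SigmaI [OF inner])
       (use lhs in \<open>auto simp: summable_on_def\<close>)
  have hT: "((\<lambda>(n,_). real n powr - s) has_sum real k * apz s k) T"
    unfolding T_def by (rule has_sum_SigmaI [OF inner lhs sT [unfolded T_def]])
  have hU: "((\<lambda>(j,m,p). real m powr - s * real p powr - (real j * s)) has_sum real k * apz s k) U"
  proof -
    have "((\<lambda>(n,_). real n powr - s) has_sum real k * apz s k) T \<longleftrightarrow>
      ((\<lambda>(j,m,p). real m powr - s * real p powr - (real j * s)) has_sum real k * apz s k) U"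
    proof (rule has_sum_reindex_bij_witness
        [where j = "\<lambda>(n,p,j). (j, n div p ^ j, p)" and i = "\<lambda>(j,m,p). (p ^ j * m, p, j)"])
      fix a assume a: "a \<in> T"
      obtain n p j where anpj: "a = (n, p, j)" by (cases a) auto
      have n: "n \<ge> 1" "bigomega n = k" "prime p" "1 \<le> j" "p ^ j dvd n"
        using a by (auto simp: anpj T_def D_def almost_primes_def)
      then have p0: "p ^ j \<noteq> 0" by (auto simp: prime_nat_iff)
      obtain m where m: "n = p ^ j * m" using n(5) by blast
      have mm: "n div p ^ j = m" using p0 m by simp
      have m1: "m \<ge> 1" using n(1) m by (cases m) auto
      have b: "bigomega m + j = k" using n(2) m bigomega_prime_power_mult [OF n(3) m1, of j] by simp
      show "(\<lambda>(j,m,p). (p ^ j * m, p, j)) ((\<lambda>(n,p,j). (j, n div p ^ j, p)) a) = a"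
        using mm m by (simp add: anpj)
      show "(\<lambda>(n,p,j). (j, n div p ^ j, p)) a \<in> U"
        using mm m m1 b n by (auto simp: anpj U_def almost_primes_def)
      have "real n powr - s = real m powr - s * (real p ^ j) powr - s"
        by (simp add: m powr_mult)
      also have "(real p ^ j) powr - s = real p powr - (real j * s)"
        using n(3) by (simp add: powr_realpow [symmetric] powr_powr prime_gt_0_nat)
      finally show "(\<lambda>(j,m,p). real m powr - s * real p powr - (real j * s)) ((\<lambda>(n,p,j). (j, n div p ^ j, p)) a)
          = (\<lambda>(n,_). real n powr - s) a"
        using mm by (simp add: anpj)
    next
      fix b assume b: "b \<in> U"
      obtain j m p where bj: "b = (j, m, p)" by (cases b) auto
      have h: "1 \<le> j" "j \<le> k" "m \<ge> 1" "bigomega m = k - j" "prime p"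
        using b by (auto simp: bj U_def almost_primes_def)
      then have p0: "p ^ j \<noteq> 0" by (auto simp: prime_nat_iff)
      show "(\<lambda>(n,p,j). (j, n div p ^ j, p)) ((\<lambda>(j,m,p). (p ^ j * m, p, j)) b) = b"
        using p0 by (simp add: bj)
      show "(\<lambda>(j,m,p). (p ^ j * m, p, j)) b \<in> T"
        using h p0 bigomega_prime_power_mult [OF h(5,3), of j] prime_gt_0_nat [OF h(5)]
        by (auto simp: bj T_def D_def almost_primes_def Suc_le_eq)
    qed auto
    then show ?thesis using hT by blast
  qed
  have prod: "((\<lambda>(m,p). real m powr - s * real p powr - (real j * s)) has_sum apz s (k - j) * pzeta (real j * s))
      (almost_primes (k - j) \<times> {p. prime p})" if "j \<in> {1..k}" for j
  proof -
    have "1 * s \<le> real j * s" using that assms by (intro mult_right_mono) auto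
    then have js: "real j * s > 1" using assms by linarith
    have in1: "((\<lambda>p. (\<lambda>(m,p). real m powr - s * real p powr - (real j * s)) (m, p))
        has_sum real m powr - s * pzeta (real j * s)) {p. prime p}" for m
      using has_sum_cmult_right [OF pzeta_has_sum [OF js]] by auto
    have out: "((\<lambda>m. real m powr - s * pzeta (real j * s)) has_sum apz s (k - j) * pzeta (real j * s)) (almost_primes (k - j))"
      by (rule has_sum_cmult_left [OF apz_has_sum [OF assms]])
    show ?thesis
      by (rule has_sum_SigmaI [OF in1 out], rule summable_on_SigmaI [OF in1])
         (use out in \<open>auto simp: summable_on_def\<close>)
  qed
  have "((\<lambda>j. apz s (k - j) * pzeta (real j * s)) has_sum real k * apz s k) {1..k}"
    by (rule has_sum_SigmaD [OF hU [unfolded U_def]]) (use prod in auto)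
  then show ?thesis
    by (simp add: has_sum_finite_iff)
qed

lemma apz_eq_hom:
  assumes "s > 1"
  shows "apz s k = hom (\<lambda>j. pzeta (real j * s)) k"
  by (rule hom_unique) (use apz_rec [OF assms] in auto)

lemma apz_sums_zeta:
  assumes "s > 1"
  shows "apz s sums zeta s"
proof -
  have "((\<lambda>n::nat. real n powr - s) has_sum zeta s) {1..} \<longleftrightarrow>
     ((\<lambda>(k,n). real n powr - s) has_sum zeta s) (SIGMA k:UNIV. almost_primes k)"
    by (rule has_sum_reindex_bij_witness [where j = "\<lambda>n. (bigomega n, n)" and i = snd])
       (auto simp: almost_primes_def)
  then have "((\<lambda>(k,n). real n powr - s) has_sum zeta s) (SIGMA k:UNIV. almost_primes k)"
    using zeta_has_sum [OF assms] by blast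
  then have "(apz s has_sum zeta s) UNIV"
    by (rule has_sum_SigmaD) (use apz_has_sum [OF assms] in auto)
  then show ?thesis by (rule has_sum_imp_sums)
qed

text \<open>For \<open>f z = \<Sum>k. apz s k * z ^ k\<close> and the truncated logarithm
  \<open>L\<close>, Newton's identities give \<open>f' \<ge> f L'\<close>, so
  \<open>f exp (- L)\<close> increases from the value \<open>1\<close>. Termwise differentiation is
  available inside the unit interval only, hence the inequality is proved for \<open>z < 1\<close>
  and carried to \<open>z = 1\<close> by continuity of \<open>L\<close>.\<close>

lemma exp_le_zeta:
  assumes "s > 1"
  shows "exp (\<Sum>j=1..J. pzeta (real j * s) / real j) \<le> zeta s"
proof -
  define q where "q = apz s"
  define p where "p j = pzeta (real j * s)" for j :: nat
  have q0: "0 \<le> q k" for k by (simp add: q_def apz_nonneg)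
  have p0: "0 \<le> p k" for k by (simp add: p_def pzeta_nonneg)
  have rec: "real k * q k = (\<Sum>j=1..k. q (k - j) * p j)" for k
    using apz_rec [OF assms] by (simp add: q_def p_def)
  have sq: "q sums zeta s" using apz_sums_zeta [OF assms] by (simp add: q_def)
  define f where "f z = (\<Sum>k. q k * z ^ k)" for z
  define f' where "f' z = (\<Sum>k. diffs q k * z ^ k)" for z
  define L where "L z = (\<Sum>j=1..J. p j * z ^ j / real j)" for z
  define L' where "L' z = (\<Sum>j=1..J. p j * z ^ (j - 1))" for z
  have sm1: "summable (\<lambda>k. q k * 1 ^ k)"
    using sq by (simp add: sums_iff)
  have sm: "summable (\<lambda>k. q k * z ^ k)" if "0 \<le> z" "z < 1" for z
    using powser_inside [OF sm1, of z] that by simp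
  have df: "(f has_real_derivative f' z) (at z)" if "0 \<le> z" "z < 1" for z
    unfolding f_def f'_def using that by (intro termdiffs_strong [OF sm1]) auto
  have dL: "(L has_real_derivative L' z) (at z)" for z
    unfolding L_def L'_def by (auto intro!: derivative_eq_intros sum.cong)
  have smd: "summable (\<lambda>k. diffs q k * z ^ k)" if z: "0 \<le> z" "z < 1" for z
  proof -
    obtain r where r: "z < r" "r < 1" using dense [OF z(2)] by blast
    show ?thesis
    proof (rule termdiff_converges [where K = r])
      show "norm z < r" using r z by simp
      fix x :: real assume "norm x < r"
      then have "norm x < norm (1::real)" using r by simp
      then show "summable (\<lambda>n. q n * x ^ n)" by (rule powser_inside [OF sm1])
    qed
  qed
  have ge: "f z * L' z \<le> f' z" if z: "0 \<le> z" "z < 1" for z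
  proof -
    have fin: "(\<Sum>k\<le>N. q k * z ^ k) * L' z \<le> f' z" for N
    proof -
      have "(\<Sum>k\<le>N. q k * z ^ k) * L' z = (\<Sum>(k,j)\<in>{..N} \<times> {1..J}. (q k * z ^ k) * (p j * z ^ (j - 1)))"
        unfolding L'_def by (simp add: sum_product sum.cartesian_product)
      also have "\<dots> = (\<Sum>(m,j)\<in>(\<lambda>(k,j). (k + j, j)) ` ({..N} \<times> {1..J}). q (m - j) * p j * z ^ (m - 1))"
        by (subst sum.reindex) (auto simp: inj_on_def power_add [symmetric] intro!: sum.cong)
      also have "\<dots> \<le> (\<Sum>(m,j)\<in>(SIGMA m:{1..N+J}. {1..m}). q (m - j) * p j * z ^ (m - 1))"
        using q0 p0 z by (intro sum_mono2) (auto intro!: mult_nonneg_nonneg)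
      also have "\<dots> = (\<Sum>m=1..N+J. (\<Sum>j=1..m. q (m - j) * p j) * z ^ (m - 1))"
        by (simp add: sum.Sigma [symmetric] sum_distrib_right)
      also have "\<dots> = (\<Sum>m=1..N+J. real m * q m * z ^ (m - 1))"
        by (simp add: rec)
      also have "\<dots> = (\<Sum>m<N+J. diffs q m * z ^ m)"
        by (rule sum.reindex_bij_witness [of _ Suc "\<lambda>m. m - 1"]) (auto simp: diffs_def)
      also have "\<dots> \<le> f' z"
        unfolding f'_def using smd [OF z] q0 z
        by (intro sum_le_suminf) (auto simp: diffs_def)
      finally show ?thesis .
    qed
    have "(\<lambda>N. (\<Sum>k\<le>N. q k * z ^ k) * L' z) \<longlonglongrightarrow> f z * L' z"
      unfolding f_def by (intro tendsto_intros summable_LIMSEQ' sm z)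
    then show ?thesis
      by (rule LIMSEQ_le_const2) (use fin in blast)
  qed
  have L0: "L 0 = 0" unfolding L_def by (auto intro!: sum.neutral)
  have f0: "f 0 = 1" unfolding f_def by (subst powser_zero) (simp add: q_def)
  have key: "exp (L z) \<le> zeta s" if z: "0 \<le> z" "z < 1" for z
  proof -
    have "f 0 * exp (- L 0) \<le> f z * exp (- L z)"
    proof (rule DERIV_nonneg_imp_nondecreasing [OF \<open>0 \<le> z\<close>])
      fix x :: real assume x: "0 \<le> x" "x \<le> z"
      then have "((\<lambda>x. f x * exp (- L x)) has_real_derivative (f' x - f x * L' x) * exp (- L x)) (at x)"
        using z by (auto intro!: derivative_eq_intros df dL simp: algebra_simps)
      moreover have "(f' x - f x * L' x) * exp (- L x) \<ge> 0"
        using ge [of x] x z by (intro mult_nonneg_nonneg) auto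
      ultimately show "\<exists>y. ((\<lambda>x. f x * exp (- L x)) has_real_derivative y) (at x) \<and> 0 \<le> y" by blast
    qed
    then have "exp (L z) \<le> f z" by (simp add: L0 f0 exp_minus field_simps)
    also have "f z \<le> (\<Sum>k. q k)"
      unfolding f_def
    proof (rule suminf_le)
      fix k show "q k * z ^ k \<le> q k"
        using q0 [of k] z power_le_one [of z k] by (simp add: mult_left_le)
    qed (use sm z sq in \<open>auto simp: sums_iff\<close>)
    also have "\<dots> = zeta s" using sq by (simp add: sums_iff)
    finally show ?thesis .
  qed
  have "((\<lambda>z. exp (L z)) \<longlongrightarrow> exp (L 1)) (at_left 1)"
    unfolding L_def by (intro tendsto_intros) auto
  moreover have "eventually (\<lambda>z. exp (L z) \<le> zeta s) (at_left 1)"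
    using eventually_at_left [of 0 "1::real"] key by (auto intro!: exI [of _ 0])
  ultimately have "exp (L 1) \<le> zeta s"
    by (intro tendsto_upperbound) auto
  then show ?thesis by (simp add: L_def p_def)
qed

text \<open>The partial sums are squeezed between \<open>ln\<close> of the partial sums of
  \<open>apz s\<close> and \<open>ln (zeta s)\<close>, so that the identity follows from Newton's
  identities without an Euler product.\<close>

lemma ln_zeta_sums:
  assumes "s > 1"
  shows "(\<lambda>j. pzeta (real (Suc j) * s) / real (Suc j)) sums ln (zeta s)"
proof -
  define S where "S J = (\<Sum>j=1..J. pzeta (real j * s) / real j)" for J
  have up: "S J \<le> ln (zeta s)" for J
    using exp_le_zeta [OF assms, of J] zeta_ge_1 [OF assms] by (simp add: S_def ln_ge_iff)
  have lo: "ln (\<Sum>k\<le>J. apz s k) \<le> S J" for J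
  proof -
    have "(\<Sum>k\<le>J. apz s k) \<le> exp (S J)"
      using hom_partial_sum_le_exp [of "\<lambda>j. pzeta (real j * s)" 1 J]
      by (simp add: S_def apz_eq_hom [OF assms] pzeta_nonneg)
    moreover have "apz s 0 \<le> (\<Sum>k\<le>J. apz s k)"
      by (rule member_le_sum) (auto simp: apz_nonneg simp del: apz_0)
    ultimately show ?thesis
      using ln_mono [of "\<Sum>k\<le>J. apz s k" "exp (S J)"] by simp
  qed
  have "(\<lambda>J. ln (\<Sum>k\<le>J. apz s k)) \<longlonglongrightarrow> ln (zeta s)"
    using apz_sums_zeta [OF assms] zeta_ge_1 [OF assms]
    by (intro tendsto_ln) (auto simp: sums_def_le)
  then have "S \<longlonglongrightarrow> ln (zeta s)"
    by (rule tendsto_sandwich [rotated 2]) (use up lo in auto)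
  moreover have "S = (\<lambda>n. \<Sum>j<n. pzeta (real (Suc j) * s) / real (Suc j))"
    unfolding S_def by (intro ext, rule sum.reindex_bij_witness [of _ Suc "\<lambda>m. m - 1"]) auto
  ultimately show ?thesis unfolding sums_def by (simp only:)
qed

section \<open>Euler-Maclaurin summation for the zeta function\<close>

lemma DERIV_nonneg_imp_nonneg:
  fixes f :: "real \<Rightarrow> real"
  assumes "f 0 = 0" "0 \<le> h" "\<And>x. 0 \<le> x \<Longrightarrow> x \<le> h \<Longrightarrow> (f has_real_derivative f' x) (at x)"
    and "\<And>x. 0 \<le> x \<Longrightarrow> x \<le> h \<Longrightarrow> 0 \<le> f' x"
  shows "0 \<le> f h"
  using DERIV_nonneg_imp_nondecreasing [of 0 h f] assms by force

text \<open>As a function of the step length \<open>h\<close>, the error vanishes at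
  \<open>0\<close> together with its first two derivatives, and its third derivative is
  \<open>h^2 * f4 h / 12\<close>. Integrating \<open>0 \<le> f4 h \<le> f4 0\<close> three times
  produces \<open>h^5 / 720\<close>.\<close>

lemma trapezoid_correction:
  fixes F f f1 f2 f3 f4 :: "real \<Rightarrow> real"
  assumes d: "\<And>x. 0 \<le> x \<Longrightarrow> (F has_real_derivative - f x) (at x)"
      "\<And>x. 0 \<le> x \<Longrightarrow> (f has_real_derivative f1 x) (at x)"
      "\<And>x. 0 \<le> x \<Longrightarrow> (f1 has_real_derivative f2 x) (at x)"
      "\<And>x. 0 \<le> x \<Longrightarrow> (f2 has_real_derivative f3 x) (at x)"
      "\<And>x. 0 \<le> x \<Longrightarrow> (f3 has_real_derivative f4 x) (at x)"
    and f4: "\<And>x. 0 \<le> x \<Longrightarrow> 0 \<le> f4 x" "\<And>x. 0 \<le> x \<Longrightarrow> f4 x \<le> f4 0"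
  defines "E \<equiv> F 0 - F 1 - (f 0 + f 1) / 2 - (f1 0 - f1 1) / 12"
  shows "0 \<le> E" "E \<le> f4 0 / 720"
proof -
  define e where "e h = F 0 - F h - h * (f 0 + f h) / 2 - h ^ 2 * (f1 0 - f1 h) / 12" for h
  define e1 where "e1 h = (f h - f 0) / 2 - h * f1 h / 2 - h * (f1 0 - f1 h) / 6
    + h ^ 2 * f2 h / 12" for h
  define e2 where "e2 h = - h * f2 h / 6 - (f1 0 - f1 h) / 6 + h ^ 2 * f3 h / 12" for h
  define e3 where "e3 h = h ^ 2 * f4 h / 12" for h
  have D: "(e has_real_derivative e1 h) (at h)" "(e1 has_real_derivative e2 h) (at h)"
      "(e2 has_real_derivative e3 h) (at h)" if "0 \<le> h" for h
    unfolding e_def e1_def e2_def e3_def using that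
    by (auto intro!: derivative_eq_intros d simp: field_simps power2_eq_square)
  have z: "e 0 = 0" "e1 0 = 0" "e2 0 = 0"
    by (simp_all add: e_def e1_def e2_def)
  have e3: "0 \<le> e3 h" "e3 h \<le> h ^ 2 * f4 0 / 12" if "0 \<le> h" for h
    using f4 [of h] that by (auto simp: e3_def intro!: mult_left_mono divide_right_mono)
  have "0 \<le> e2 h" if "0 \<le> h" for h
    by (rule DERIV_nonneg_imp_nonneg [OF z(3) that D(3)]) (use e3 in auto)
  then have "0 \<le> e1 h" if "0 \<le> h" for h
    by (intro DERIV_nonneg_imp_nonneg [OF z(2) that D(2)]) auto
  then have "0 \<le> e 1"
    by (intro DERIV_nonneg_imp_nonneg [OF z(1) _ D(1)]) auto
  then show "0 \<le> E" by (simp add: e_def E_def)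
  have e2': "0 \<le> f4 0 * h ^ 3 / 36 - e2 h" if "0 \<le> h" for h
  proof (rule DERIV_nonneg_imp_nonneg [where f = "\<lambda>h. f4 0 * h ^ 3 / 36 - e2 h", OF _ that])
    show "((\<lambda>h. f4 0 * h ^ 3 / 36 - e2 h) has_real_derivative h ^ 2 * f4 0 / 12 - e3 h) (at h)" if "0 \<le> h" for h
      using D(3) [OF that] by (auto intro!: derivative_eq_intros)
  qed (use e3 z in auto)
  have e1': "0 \<le> f4 0 * h ^ 4 / 144 - e1 h" if "0 \<le> h" for h
  proof (rule DERIV_nonneg_imp_nonneg [where f = "\<lambda>h. f4 0 * h ^ 4 / 144 - e1 h", OF _ that])
    show "((\<lambda>h. f4 0 * h ^ 4 / 144 - e1 h) has_real_derivative f4 0 * h ^ 3 / 36 - e2 h) (at h)" if "0 \<le> h" for h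
      using D(2) [OF that] by (auto intro!: derivative_eq_intros)
  qed (use e2' z in auto)
  have "0 \<le> f4 0 * 1 ^ 5 / 720 - e 1"
  proof (rule DERIV_nonneg_imp_nonneg [where f = "\<lambda>h. f4 0 * h ^ 5 / 720 - e h", OF _ zero_le_one])
    show "((\<lambda>h. f4 0 * h ^ 5 / 720 - e h) has_real_derivative f4 0 * h ^ 4 / 144 - e1 h) (at h)" if "0 \<le> h" for h
      using D(1) [OF that] by (auto intro!: derivative_eq_intros)
  qed (use e1' z in auto)
  then show "E \<le> f4 0 / 720" by (simp add: e_def E_def)
qed

definition em_main :: "real \<Rightarrow> real \<Rightarrow> real" where
  "em_main s x = x powr (1 - s) / (s - 1) + x powr - s / 2 + s * x powr (- s - 1) / 12"

definition em_err :: "real \<Rightarrow> real \<Rightarrow> real" where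
  "em_err s x = (s * (s + 1) * (s + 2) * (s + 3) * x powr (- s - 4)
     + s * (s + 1) * (s + 2) * x powr (- s - 3)) / 720"

text \<open>The remainder \<open>f4 a / 720\<close> of each step is summed by comparing \<open>f4\<close> with the increments
  of its antiderivative \<open>f3\<close>; this accounts for the two terms of \<^const>\<open>em_err\<close>.\<close>

lemma em_step:
  assumes "s > 1" "x > 0"
  shows "x powr - s \<le> em_main s x - em_main s (x + 1)"
    and "em_main s x - em_err s x - (em_main s (x + 1) - em_err s (x + 1)) \<le> x powr - s"
proof -
  define F where "F h = (x + h) powr (1 - s) / (s - 1)" for h
  define f where "f h = (x + h) powr - s" for h
  define f1 where "f1 h = - s * (x + h) powr (- s - 1)" for h
  define f2 where "f2 h = s * (s + 1) * (x + h) powr (- s - 2)" for h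
  define f3 where "f3 h = - s * (s + 1) * (s + 2) * (x + h) powr (- s - 3)" for h
  define f4 where "f4 h = s * (s + 1) * (s + 2) * (s + 3) * (x + h) powr (- s - 4)" for h
  have d: "(F has_real_derivative - f y) (at y)" "(f has_real_derivative f1 y) (at y)"
     "(f1 has_real_derivative f2 y) (at y)" "(f2 has_real_derivative f3 y) (at y)"
     "(f3 has_real_derivative f4 y) (at y)" if "0 \<le> y" for y
  proof -
    have y: "x + y > 0" using that assms by linarith
    have "(F has_real_derivative (1 - s) * (x + y) powr (1 - s - 1) * (0 + 1) / (s - 1)) (at y)"
      unfolding F_def using y assms by (auto intro!: derivative_eq_intros)
    also have "(1 - s) * (x + y) powr (1 - s - 1) * (0 + 1) / (s - 1) = - f y"
      using assms by (simp add: f_def minus_divide_left [symmetric] divide_eq_eq algebra_simps)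
    finally show "(F has_real_derivative - f y) (at y)" .
  qed (unfold f_def f1_def f2_def f3_def f4_def, use that assms in
     \<open>auto intro!: derivative_eq_intros simp: algebra_simps\<close>)
  have f4: "0 \<le> f4 y" for y
    using assms by (auto simp: f4_def)
  have f4_mono: "f4 z \<le> f4 y" if "0 \<le> y" "y \<le> z" for y z
    unfolding f4_def using that assms by (intro mult_left_mono powr_mono2') auto
  have t: "0 \<le> F 0 - F 1 - (f 0 + f 1) / 2 - (f1 0 - f1 1) / 12"
    "F 0 - F 1 - (f 0 + f 1) / 2 - (f1 0 - f1 1) / 12 \<le> f4 0 / 720"
    by (rule trapezoid_correction [OF d f4 f4_mono]; simp)+
  have em: "em_main s (x + y) = F y + f y / 2 - f1 y / 12" "em_err s (x + y) = (f4 y - f3 y) / 720" for y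
    by (simp_all add: em_main_def em_err_def F_def f_def f1_def f3_def f4_def)
  note em0 = em [of 0, unfolded add_0_right] and em1 = em [of 1]
  have f0: "x powr - s = f 0" by (simp add: f_def)
  show "x powr - s \<le> em_main s x - em_main s (x + 1)"
    using t(1) unfolding em0 em1 f0 by (simp add: field_simps)
  obtain y where "0 < y" "y < 1" "f3 1 - f3 0 = (1 - 0) * f4 y"
    using MVT2 [of 0 1 f3 f4] d(5) by auto
  then have "f4 1 \<le> f3 1 - f3 0"
    using f4_mono [of y 1] by auto
  then show "em_main s x - em_err s x - (em_main s (x + 1) - em_err s (x + 1)) \<le> x powr - s"
    using t(2) unfolding em0 em1 f0 by (simp add: field_simps)
qed

lemma em_main_nonneg: "s > 1 \<Longrightarrow> 0 \<le> em_main s x"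
  by (auto simp: em_main_def)

lemma em_tendsto_0:
  assumes "s > 1"
  shows "(\<lambda>n. em_main s (real n) - em_err s (real n)) \<longlonglongrightarrow> 0"
proof -
  have *: "(\<lambda>n. real n powr a) \<longlonglongrightarrow> 0" if "a < 0" for a
    by (rule tendsto_neg_powr [OF that filterlim_real_sequentially])
  have "(\<lambda>n. em_main s (real n) - em_err s (real n)) \<longlonglongrightarrow> (0 / (s - 1) + 0 / 2 + s * 0 / 12)
     - (s * (s + 1) * (s + 2) * (s + 3) * 0 + s * (s + 1) * (s + 2) * 0) / 720"
    unfolding em_main_def em_err_def using assms by (intro tendsto_intros *) auto
  then show ?thesis by simp
qed

lemma zeta_em:
  assumes "s > 1" "N \<ge> 1"
  shows "zeta s \<le> (\<Sum>n=1..<N. real n powr - s) + em_main s (real N)"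
    and "(\<Sum>n=1..<N. real n powr - s) + em_main s (real N) - em_err s (real N) \<le> zeta s"
proof -
  define S where "S M = (\<Sum>n=1..<M. real n powr - s)" for M
  have lim: "S \<longlonglongrightarrow> zeta s"
  proof -
    have "(\<lambda>M. \<Sum>n<M. real (Suc n) powr - s) \<longlonglongrightarrow> zeta s"
      using summable_LIMSEQ [OF summable_zeta [OF assms(1)]] by (simp only: zeta_def)
    moreover have "(\<Sum>n<M. real (Suc n) powr - s) = S (Suc M)" for M
      unfolding S_def by (rule sum.reindex_bij_witness [of _ "\<lambda>m. m - 1" Suc]) auto
    ultimately show ?thesis by (subst filterlim_sequentially_Suc [symmetric]) simp
  qed
  have step: "S (N + m) \<le> S N + em_main s (real N) - em_main s (real (N + m))
     \<and> S N + (em_main s (real N) - em_err s (real N)) - (em_main s (real (N + m)) - em_err s (real (N + m))) \<le> S (N + m)" for m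
  proof (induction m)
    case (Suc m)
    define x where "x = real (N + m)"
    have S: "S (N + Suc m) = S (N + m) + x powr - s"
      using assms(2) by (simp add: S_def x_def)
    have x: "real (N + Suc m) = x + 1" "x > 0" using assms(2) by (simp_all add: x_def)
    show ?case
      using Suc em_step [OF assms(1) x(2)] unfolding x S x_def [symmetric] by linarith
  qed simp
  have lim': "(\<lambda>m. S (N + m)) \<longlonglongrightarrow> zeta s"
    using LIMSEQ_ignore_initial_segment [OF lim, of N] by (simp add: add.commute)
  have bd: "S (N + m) \<le> S N + em_main s (real N)" for m
    using step [of m] em_main_nonneg [OF assms(1), of "real (N + m)"] by linarith
  show "zeta s \<le> S N + em_main s (real N)"
    by (rule LIMSEQ_le_const2 [OF lim']) (use bd in blast)
  have "(\<lambda>m. S N + (em_main s (real N) - em_err s (real N)) - (em_main s (real (N + m)) - em_err s (real (N + m))))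
     \<longlonglongrightarrow> S N + (em_main s (real N) - em_err s (real N)) - 0"
    using LIMSEQ_ignore_initial_segment [OF em_tendsto_0 [OF assms(1)], of N]
    by (intro tendsto_intros) (simp add: add.commute)
  then have "S N + (em_main s (real N) - em_err s (real N)) - 0 \<le> zeta s"
    by (rule LIMSEQ_le [OF _ lim']) (use step in blast)
  then show "S N + em_main s (real N) - em_err s (real N) \<le> zeta s" by simp
qed

text \<open>Euler-Maclaurin at \<open>N = 1\<close>. The two constants enclose Euler's constant
  \<open>0.577...\<close>, the constant term of zeta at its pole.\<close>

lemma zeta_bounds_near_1:
  assumes "0 < t" "t \<le> 1 / 8"
  shows "1 / t + 53 / 100 \<le> zeta (1 + t)" "zeta (1 + t) \<le> 1 / t + 3 / 5"
proof -
  define s where "s = 1 + t"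
  have s: "1 < s" "s \<le> 9 / 8" using assms by (auto simp: s_def)
  have "zeta s \<le> 1 / t + 1 / 2 + s / 12"
    using zeta_em(1) [OF s(1), of 1] by (simp add: em_main_def s_def)
  then show "zeta (1 + t) \<le> 1 / t + 3 / 5"
    using s(2) unfolding s_def [symmetric] by linarith
  define X where "X = s * (s + 1) * (s + 2) * (s + 3) + s * (s + 1) * (s + 2)"
  have "1 / t + 1 / 2 + s / 12 - X / 720 \<le> zeta s"
    using zeta_em(2) [OF s(1), of 1] by (simp add: em_main_def em_err_def s_def X_def)
  moreover have "X \<le> 9/8 * (9/8+1) * (9/8+2) * (9/8+3) + 9/8 * (9/8+1) * (9/8+2)"
    unfolding X_def using s by (intro add_mono mult_mono) auto
  then have "X \<le> 156825 / 4096" by simp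
  ultimately show "1 / t + 53 / 100 \<le> zeta (1 + t)"
    using s(1) unfolding s_def [symmetric] by linarith
qed

section \<open>The octave sum\<close>

text \<open>Adding \<open>C / 2 * (x - a) * (x - b)\<close> makes \<open>f\<close> convex and leaves
  the values at both ends unchanged, so the chord bounds the modified function.\<close>

lemma chord_upper_bound:
  fixes f :: "real \<Rightarrow> real"
  assumes d: "\<And>x. x \<in> {a..b} \<Longrightarrow> (f has_real_derivative f' x) (at x)"
      "\<And>x. x \<in> {a..b} \<Longrightarrow> (f' has_real_derivative f'' x) (at x)"
      "\<And>x. x \<in> {a..b} \<Longrightarrow> - C \<le> f'' x"
    and y: "y \<in> {a..b}" and "0 \<le> C"
  shows "f y \<le> max (f a) (f b) + C * (b - a)\<^sup>2 / 8"
proof (cases "a = b")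
  case False
  define g where "g x = f x + C / 2 * ((x - a) * (x - b))" for x
  have "convex_on {a..b} g"
  proof (rule f''_ge0_imp_convex)
    fix x assume x: "x \<in> {a..b}"
    show "(g has_real_derivative f' x + C / 2 * (2 * x - a - b)) (at x)"
      unfolding g_def by (auto intro!: derivative_eq_intros d(1) x simp: algebra_simps)
    show "((\<lambda>x. f' x + C / 2 * (2 * x - a - b)) has_real_derivative f'' x + C) (at x)"
      by (auto intro!: derivative_eq_intros d(2) x)
    show "0 \<le> f'' x + C" using d(3) [OF x] by linarith
  qed simp
  define u where "u = (y - a) / (b - a)"
  have ab: "a < b" using y False by auto
  have u: "0 \<le> u" "u \<le> 1" using y ab by (auto simp: u_def)
  have yu: "y = (1 - u) * a + u * b"
  proof -
    have "u * (b - a) = y - a" using ab by (simp add: u_def)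
    then show ?thesis by (simp add: algebra_simps)
  qed
  have "g y \<le> (1 - u) * g a + u * g b"
    using \<open>convex_on {a..b} g\<close> u ab yu by (auto simp: convex_on_def)
  also have "\<dots> \<le> (1 - u) * max (f a) (f b) + u * max (f a) (f b)"
    using u by (intro add_mono mult_left_mono) (auto simp: g_def)
  also have "\<dots> = max (f a) (f b)" by (simp add: algebra_simps)
  finally have "f y \<le> max (f a) (f b) + C / 2 * ((y - a) * (b - y))"
    by (simp add: g_def algebra_simps)
  also have "(y - a) * (b - y) \<le> (b - a)\<^sup>2 / 4"
    using zero_le_power2 [of "(y - a) - (b - y)"] by (simp add: power2_eq_square algebra_simps)
  then have "C / 2 * ((y - a) * (b - y)) \<le> C / 2 * ((b - a)\<^sup>2 / 4)"
    using \<open>0 \<le> C\<close> by (intro mult_left_mono) auto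
  finally show ?thesis by simp
qed (use y \<open>0 \<le> C\<close> in auto)

text \<open>Up to the factor \<open>ln 2\<close>, this is the trapezoidal rule with step \<open>ln 2\<close> for
  the integral over \<open>u\<close> of \<open>exp (u - y exp u) * y\<close>, which equals \<open>1\<close>. It
  converges so fast that a step of one octave is already accurate to \<open>10\<^sup>-\<^sup>5\<close>.\<close>

definition octave_sum :: "real \<Rightarrow> real" where
  "octave_sum y = (\<Sum>n. y / 2 ^ n * exp (- (y / 2 ^ n)))"

lemma summable_div_power2: "summable (\<lambda>n. y / 2 ^ n :: real)"
proof -
  have "summable (\<lambda>n. y * (1 / 2) ^ n)" by (intro summable_mult summable_geometric) simp
  moreover have "(\<lambda>n. y * (1 / 2) ^ n) = (\<lambda>n. y / 2 ^ n)" by (simp add: power_one_over)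
  ultimately show ?thesis by (simp only:)
qed

lemma suminf_div_power2: "(\<Sum>n. y / 2 ^ n :: real) = 2 * y"
proof -
  have "(\<Sum>n. y * (1 / 2) ^ n) = y * (\<Sum>n. (1 / 2) ^ n)"
    by (intro suminf_mult summable_geometric) simp
  moreover have "(\<lambda>n. y * (1 / 2) ^ n) = (\<lambda>n. y / 2 ^ n)" by (simp add: power_one_over)
  moreover have "(\<Sum>n. (1 / 2) ^ n) = (2::real)" using suminf_geometric [of "1 / 2 :: real"] by simp
  ultimately show ?thesis by (simp only: mult.commute)
qed

lemma octave_summable:
  fixes y :: real
  assumes "0 \<le> y"
  shows "summable (\<lambda>n. y / 2 ^ n * exp (- (y / 2 ^ n)))"
proof (rule summable_comparison_test' [OF summable_div_power2 [of y], where N = 0])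
  fix n
  have "y / 2 ^ n * exp (- (y / 2 ^ n)) \<le> y / 2 ^ n * 1"
    using assms by (intro mult_left_mono) auto
  then show "norm (y / 2 ^ n * exp (- (y / 2 ^ n))) \<le> y / 2 ^ n"
    using assms by simp
qed

lemma octave_sum_split:
  assumes "0 \<le> y"
  shows "octave_sum y = (\<Sum>n<N. y / 2 ^ n * exp (- (y / 2 ^ n))) + octave_sum (y / 2 ^ N)"
  unfolding octave_sum_def
  by (subst suminf_split_initial_segment [OF octave_summable [OF assms], of N])
     (simp add: power_add mult_ac)

lemma octave_sum_nonneg: "0 \<le> y \<Longrightarrow> 0 \<le> octave_sum y"
  unfolding octave_sum_def by (intro suminf_nonneg octave_summable) auto

lemma octave_sum_double: "0 \<le> y \<Longrightarrow> octave_sum (2 * y) = 2 * y * exp (- (2 * y)) + octave_sum y"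
  using octave_sum_split [of "2 * y" 1] by simp

lemma octave_sum_small:
  assumes "0 \<le> u"
  shows "octave_sum u \<le> 2 * u" "2 * u - 4 / 3 * u\<^sup>2 \<le> octave_sum u"
proof -
  have "u / 2 ^ n * exp (- (u / 2 ^ n)) \<le> u / 2 ^ n * 1" for n
    using assms by (intro mult_left_mono) auto
  then have "octave_sum u \<le> (\<Sum>n. u / 2 ^ n)"
    unfolding octave_sum_def using assms
    by (intro suminf_le octave_summable summable_div_power2) simp_all
  then show "octave_sum u \<le> 2 * u" by (simp add: suminf_div_power2)
  have q: "(\<lambda>n. u\<^sup>2 * (1 / 4) ^ n) sums (u\<^sup>2 * (4 / 3))"
    using geometric_sums [of "1 / 4 :: real"] by (intro sums_mult) simp
  have l: "(\<lambda>n. u / 2 ^ n) sums (2 * u)"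
    using summable_div_power2 [of u] suminf_div_power2 [of u] by (simp add: sums_iff)
  have "(\<lambda>n. u / 2 ^ n - u\<^sup>2 * (1 / 4) ^ n) sums (2 * u - u\<^sup>2 * (4 / 3))"
    by (rule sums_diff [OF l q])
  moreover have "u / 2 ^ n - u\<^sup>2 * (1 / 4) ^ n \<le> u / 2 ^ n * exp (- (u / 2 ^ n))" for n
  proof -
    have "u / 2 ^ n * (1 + - (u / 2 ^ n)) \<le> u / 2 ^ n * exp (- (u / 2 ^ n))"
      using assms by (intro mult_left_mono exp_ge_add_one_self) auto
    moreover have "u / 2 ^ n * (1 + - (u / 2 ^ n)) = u / 2 ^ n - u\<^sup>2 * (1 / 4) ^ n"
      by (simp add: algebra_simps power2_eq_square power_one_over power_mult_distrib [symmetric])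
    ultimately show ?thesis by linarith
  qed
  ultimately have "2 * u - u\<^sup>2 * (4 / 3) \<le> octave_sum u"
    unfolding octave_sum_def using octave_summable [OF assms]
    by (intro sums_le [OF _ _ summable_sums]) auto
  then show "2 * u - 4 / 3 * u\<^sup>2 \<le> octave_sum u" by (simp add: mult.commute)
qed

section \<open>Numerical evaluation of the octave sum on \<open>[8, 16]\<close>\<close>

definition octave_trunc :: "real \<Rightarrow> real" where
  "octave_trunc y = (\<Sum>n<12. y / 2 ^ n * exp (- (y / 2 ^ n))) + 2 * (y / 2 ^ 12)"

definition octave_trunc' :: "real \<Rightarrow> real" where
  "octave_trunc' y = (\<Sum>n<12. (1 - y / 2 ^ n) * exp (- (y / 2 ^ n)) / 2 ^ n) + 2 / 2 ^ 12"

definition octave_trunc'' :: "real \<Rightarrow> real" where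
  "octave_trunc'' y = (\<Sum>n<12. (y / 2 ^ n - 2) * exp (- (y / 2 ^ n)) / 4 ^ n)"

lemma octave_trunc_deriv:
  "(octave_trunc has_real_derivative octave_trunc' y) (at y)"
  "(octave_trunc' has_real_derivative octave_trunc'' y) (at y)"
proof -
  show "(octave_trunc has_real_derivative octave_trunc' y) (at y)"
    unfolding octave_trunc_def octave_trunc'_def
    by (auto intro!: derivative_eq_intros sum.cong simp: field_simps)
  have "((\<lambda>y. (1 - y / 2 ^ n) * exp (- (y / 2 ^ n)) / 2 ^ n)
      has_real_derivative (y / 2 ^ n - 2) * exp (- (y / 2 ^ n)) / 4 ^ n) (at y)" for n
  proof -
    have "(4::real) ^ n = 2 ^ n * 2 ^ n" by (simp add: power_mult_distrib [symmetric])
    then show ?thesis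
      by (auto intro!: derivative_eq_intros simp: field_simps)
  qed
  then show "(octave_trunc' has_real_derivative octave_trunc'' y) (at y)"
    unfolding octave_trunc'_def octave_trunc''_def
    by (intro DERIV_cong [OF DERIV_add [OF DERIV_sum DERIV_const]]) auto
qed

lemma exp_numeric:
  "exp (- 8) \<le> (1 / 2800 :: real)" "exp (- 3) \<le> (1 / 19 :: real)" "exp (- 1) \<le> (3 / 8 :: real)"
  "exp (- (1 / 2)) \<le> (5 / 8 :: real)" "exp (- 16) \<le> (1 / 7000000 :: real)"
proof -
  have h: "8 / 5 \<le> exp (1 / 2 :: real)"
    using exp_lower_Taylor_quadratic [of "1 / 2 :: real"] by (simp add: power2_eq_square)
  have "145 / 128 \<le> exp (1 / 8 :: real)"
    using exp_lower_Taylor_quadratic [of "1 / 8 :: real"] by (simp add: power2_eq_square)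
  then have "(145 / 128) ^ 8 \<le> exp (1 / 8 :: real) ^ 8" by (rule power_mono) simp
  also have "exp (1 / 8 :: real) ^ 8 = exp 1"
    by (simp add: exp_of_nat_mult [symmetric])
  finally have "(145 / 128) ^ 8 \<le> exp (1 :: real)" .
  moreover have "27 / 10 \<le> (145 / 128 :: real) ^ 8" by (simp add: power_divide)
  ultimately have e1: "27 / 10 \<le> exp (1 :: real)" by linarith
  have p: "(27 / 10) ^ n \<le> exp (real n)" for n
    using power_mono [OF e1, of n] by (simp add: exp_of_nat_mult [symmetric])
  show "exp (- 8) \<le> (1 / 2800 :: real)" "exp (- 3) \<le> (1 / 19 :: real)" "exp (- 16) \<le> (1 / 7000000 :: real)"
    using p [of 8] p [of 3] p [of 16] by (simp_all add: exp_minus field_simps)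
  show "exp (- 1) \<le> (3 / 8 :: real)"
    using p [of 1] e1 by (simp add: exp_minus field_simps)
  show "exp (- (1 / 2)) \<le> (5 / 8 :: real)"
    using h by (simp add: exp_minus field_simps)
qed

lemma octave_trunc''_bound:
  assumes y: "y \<in> {8..16}"
  shows "\<bar>octave_trunc'' y\<bar> \<le> 34 / 1000"
proof -
  \<comment> \<open>\<open>c n\<close> bounds \<open>|v - 2| exp (- v)\<close> for \<open>v\<close>
    in \<open>[8 / 2^n, 16 / 2^n]\<close>. For \<open>n = 1, 2\<close> it comes from the maximum
    \<open>exp (- 3)\<close> on \<open>v \<ge> 2\<close>, taken at \<open>v = 3\<close>; for
    \<open>n \<ge> 5\<close> the divisor \<open>4 ^ n\<close> makes the crude value \<open>2\<close>
    good enough.\<close>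
  define c :: "nat \<Rightarrow> real" where
    "c n = (if n = 0 then 1 / 200 else if n \<le> 2 then 1 / 19 else if n = 3 then 3 / 8
       else if n = 4 then 94 / 100 else 2)" for n
  have v: "\<bar>(v - 2) * exp (- v)\<bar> \<le> c n" if "v = y / 2 ^ n" for v n
  proof -
    have v0: "0 \<le> v" using that y by auto
    have gen: "\<bar>(v - 2) * exp (- v)\<bar> \<le> 2"
    proof (cases "v \<le> 2")
      case True
      have "\<bar>v - 2\<bar> * exp (- v) \<le> 2 * 1" using v0 True by (intro mult_mono) auto
      then show ?thesis by (simp add: abs_mult)
    next
      case False
      have "(v - 2) * exp (- v) \<le> exp v * exp (- v)"
        using exp_ge_add_one_self [of v] by (intro mult_right_mono; linarith?) auto
      then show ?thesis using False by (simp add: abs_mult exp_minus)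
    qed
    consider "n = 0" | "n = 1 \<or> n = 2" | "n = 3" | "n = 4" | "n \<ge> 5" by linarith
    then show ?thesis
    proof cases
      case 1
      then have "8 \<le> v" "v \<le> 16" using that y by auto
      then have "\<bar>v - 2\<bar> * exp (- v) \<le> 14 * exp (- 8)" by (intro mult_mono) auto
      then show ?thesis using 1 exp_numeric(1) by (simp add: abs_mult c_def)
    next
      case 2
      then have "2 \<le> v" using that y by auto
      have "(v - 2) * exp (- v) \<le> exp (v - 3) * exp (- v)"
        using exp_ge_add_one_self [of "v - 3"] by (intro mult_right_mono) auto
      also have "\<dots> = exp (- 3)" by (simp add: exp_add [symmetric])
      finally show ?thesis using 2 exp_numeric(2) \<open>2 \<le> v\<close> by (auto simp: abs_mult c_def)
    next
      case 3
      then have "1 \<le> v" "v \<le> 2" using that y by auto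
      then have "\<bar>v - 2\<bar> * exp (- v) \<le> 1 * exp (- 1)" by (intro mult_mono) auto
      then show ?thesis using 3 exp_numeric(3) by (simp add: abs_mult c_def)
    next
      case 4
      then have "1 / 2 \<le> v" "v \<le> 1" using that y by auto
      then have "\<bar>v - 2\<bar> * exp (- v) \<le> 3 / 2 * exp (- (1 / 2))" by (intro mult_mono) auto
      then show ?thesis using 4 exp_numeric(4) by (simp add: abs_mult c_def)
    next
      case 5
      then show ?thesis using gen by (simp add: c_def)
    qed
  qed
  have "\<bar>octave_trunc'' y\<bar> \<le> (\<Sum>n<12. \<bar>(y / 2 ^ n - 2) * exp (- (y / 2 ^ n)) / 4 ^ n\<bar>)"
    unfolding octave_trunc''_def by (rule sum_abs)
  also have "\<dots> \<le> (\<Sum>n<12. c n / 4 ^ n)"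
    using v [OF refl] by (intro sum_mono) (simp add: abs_divide divide_right_mono)
  also have "\<dots> \<le> 34 / 1000"
    by (simp add: c_def eval_nat_numeral)
  finally show ?thesis .
qed

text \<open>After twelve exact terms the truncation replaces \<open>exp\<close> by \<open>1\<close>.
  With \<open>u = y / 2^12 \<le> 1 / 256\<close> this costs at most \<open>4 / 3 * u^2\<close>,
  which is below \<open>2.1 * 10^-5\<close>.\<close>

lemma octave_sum_trunc:
  assumes "y \<in> {8..16}"
  shows "octave_sum y \<le> octave_trunc y" "octave_trunc y - 21 / 1000000 \<le> octave_sum y"
proof -
  have "(y / 2 ^ 12)\<^sup>2 \<le> (16 / 2 ^ 12)\<^sup>2"
    using assms by (intro power_mono divide_right_mono) auto
  then show "octave_sum y \<le> octave_trunc y" "octave_trunc y - 21 / 1000000 \<le> octave_sum y"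
    using octave_sum_split [of y 12] octave_sum_small [of "y / 2 ^ 12"] assms
    by (auto simp: octave_trunc_def power2_eq_square)
qed

text \<open>Horner scheme for \<open>\<Sum>i<n. 2^i x^(2^i)\<close> with one squaring per level, so
  that a single exponential determines all of them. All values are scaled by
  \<open>2^40 = 1099511627776\<close>.\<close>

fun sq_lower :: "nat \<Rightarrow> int \<Rightarrow> int" where
  "sq_lower 0 e = 0"
| "sq_lower (Suc n) e = e + 2 * sq_lower n (e * e div 1099511627776)"

fun sq_upper :: "nat \<Rightarrow> int \<Rightarrow> int" where
  "sq_upper 0 e = 0"
| "sq_upper (Suc n) e = e + 2 * sq_upper n (e * e div 1099511627776 + 1)"

text \<open>The mesh points are \<open>c / 16\<close> for \<open>c = 128, \<dots>, 256\<close>; the numbers \<open>l, u\<close> enclose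
  \<open>2\<^sup>4\<^sup>0 exp (- c / 2\<^sup>1\<^sup>5)\<close>, whose iterated squares are the exponentials in
  \<^const>\<open>octave_trunc\<close>. The thresholds are \<open>1.44268\<close> and \<open>1.44273\<close>, scaled by \<open>2\<^sup>5\<^sup>5\<close>.\<close>

fun mesh_check :: "nat \<Rightarrow> int \<Rightarrow> int \<Rightarrow> int \<Rightarrow> bool" where
  "mesh_check 0 c l u \<longleftrightarrow> True"
| "mesh_check (Suc k) c l u \<longleftrightarrow>
     51978024883318936 \<le> c * (sq_lower 12 l + 1099511627776) \<and>
     c * (sq_upper 12 u + 1099511627776) \<le> 51979826323172000 \<and>
     mesh_check k (c + 1) (l * 1099478073854 div 1099511627776) (u * 1099478073857 div 1099511627776 + 1)"

lemma sq_lower_le: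
  assumes "0 \<le> e" "real_of_int e \<le> 2 ^ 40 * x"
  shows "real_of_int (sq_lower n e) \<le> 2 ^ 40 * (\<Sum>i<n. 2 ^ i * x ^ (2 ^ i))"
  using assms
proof (induction n arbitrary: e x)
  case (Suc n)
  have "real_of_int (e * e div 1099511627776) \<le> real_of_int (e * e) / 1099511627776"
    by linarith
  also have "\<dots> \<le> (2 ^ 40 * x) * (2 ^ 40 * x) / 1099511627776"
    unfolding of_int_mult using Suc.prems by (intro divide_right_mono mult_mono) auto
  also have "\<dots> = 2 ^ 40 * x\<^sup>2" by (simp add: power2_eq_square)
  finally have "real_of_int (sq_lower n (e * e div 1099511627776))
      \<le> 2 ^ 40 * (\<Sum>i<n. 2 ^ i * (x\<^sup>2) ^ (2 ^ i))"
    by (intro Suc.IH) (auto simp: pos_imp_zdiv_nonneg_iff)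
  moreover have "(\<Sum>i<Suc n. 2 ^ i * x ^ (2 ^ i)) = x + 2 * (\<Sum>i<n. 2 ^ i * (x\<^sup>2) ^ (2 ^ i))"
    by (simp add: sum.lessThan_Suc_shift sum_distrib_left power_mult [symmetric] mult_ac del: sum.lessThan_Suc)
  ultimately show ?case using Suc.prems by (simp add: algebra_simps)
qed simp

lemma sq_upper_ge:
  assumes "0 \<le> x" "2 ^ 40 * x \<le> real_of_int e"
  shows "2 ^ 40 * (\<Sum>i<n. 2 ^ i * x ^ (2 ^ i)) \<le> real_of_int (sq_upper n e)"
  using assms
proof (induction n arbitrary: e x)
  case (Suc n)
  have "2 ^ 40 * x\<^sup>2 = (2 ^ 40 * x) * (2 ^ 40 * x) / 1099511627776"
    by (simp add: power2_eq_square)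
  also have "\<dots> \<le> real_of_int (e * e) / 1099511627776"
    unfolding of_int_mult using Suc.prems by (intro divide_right_mono mult_mono) auto
  also have "\<dots> \<le> real_of_int (e * e div 1099511627776 + 1)"
    by linarith
  finally have "2 ^ 40 * (\<Sum>i<n. 2 ^ i * (x\<^sup>2) ^ (2 ^ i))
      \<le> real_of_int (sq_upper n (e * e div 1099511627776 + 1))"
    by (intro Suc.IH) auto
  moreover have "(\<Sum>i<Suc n. 2 ^ i * x ^ (2 ^ i)) = x + 2 * (\<Sum>i<n. 2 ^ i * (x\<^sup>2) ^ (2 ^ i))"
    by (simp add: sum.lessThan_Suc_shift sum_distrib_left power_mult [symmetric] mult_ac del: sum.lessThan_Suc)
  ultimately show ?case using Suc.prems by (simp add: algebra_simps)
qed simp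

text \<open>Reversing the order of summation makes the smallest exponent \<open>c / 2^15\<close> the
  base, and each further exponential is the square of the one before. The summand \<open>1\<close>
  is the linearised rest of the series.\<close>

lemma octave_trunc_eq:
  "octave_trunc (c / 16) = c * ((\<Sum>i<12. 2 ^ i * exp (- (c / 32768)) ^ (2 ^ i)) + 1) / 2 ^ 15"
proof -
  have "(\<Sum>n<12. c / 16 / 2 ^ n * exp (- (c / 16 / 2 ^ n)))
      = (\<Sum>i<12. c / 16 / 2 ^ (11 - i) * exp (- (c / 16 / 2 ^ (11 - i))))"
    by (rule sum.reindex_bij_witness [of _ "\<lambda>i. 11 - i" "\<lambda>i. 11 - i"]) auto
  also have "\<dots> = (\<Sum>i<12. c / 2 ^ 15 * (2 ^ i * exp (- (c / 32768)) ^ (2 ^ i)))"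
  proof (intro sum.cong refl)
    fix i :: nat assume "i \<in> {..<12}"
    then have "(2::real) ^ 11 = 2 ^ (11 - i) * 2 ^ i"
      by (simp only: power_add [symmetric]) simp
    then have *: "c / 16 / 2 ^ (11 - i) = c / 32768 * 2 ^ i"
      by (simp add: field_simps)
    show "c / 16 / 2 ^ (11 - i) * exp (- (c / 16 / 2 ^ (11 - i)))
        = c / 2 ^ 15 * (2 ^ i * exp (- (c / 32768)) ^ (2 ^ i))"
      unfolding * by (simp add: exp_of_nat_mult [symmetric] mult_ac)
  qed
  also have "\<dots> = c / 2 ^ 15 * (\<Sum>i<12. 2 ^ i * exp (- (c / 32768)) ^ (2 ^ i))"
    by (simp only: sum_distrib_left)
  finally show ?thesis
    unfolding octave_trunc_def by (simp add: algebra_simps add_divide_distrib)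
qed

text \<open>The bounds are a little weaker than \<open>1.44268\<close> and \<open>1.44273\<close>
  because the integer thresholds in \<open>mesh_check\<close> are rounded outwards.\<close>

lemma mesh_check_sound:
  assumes "mesh_check k c l u" "0 \<le> l" "0 \<le> c"
    "real_of_int l \<le> 2 ^ 40 * exp (- (real_of_int c / 32768))"
    "2 ^ 40 * exp (- (real_of_int c / 32768)) \<le> real_of_int u"
    and r: "1099478073854 \<le> 2 ^ 40 * exp (- (1 / 32768 :: real))"
       "2 ^ 40 * exp (- (1 / 32768 :: real)) \<le> 1099478073857"
    and "i < k"
  shows "144267999 / 100000000 \<le> octave_trunc (real_of_int (c + int i) / 16)
       \<and> octave_trunc (real_of_int (c + int i) / 16) \<le> 144273001 / 100000000"
  using assms(1-5,8)
proof (induction k arbitrary: c l u i)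
  case (Suc k)
  define x where "x = exp (- (real_of_int c / 32768))"
  define \<Sigma> where "\<Sigma> = (\<Sum>i<12. 2 ^ i * x ^ (2 ^ i))"
  have x0: "0 \<le> x" by (simp add: x_def)
  show ?case
  proof (cases i)
    case 0
    have lo: "real_of_int (sq_lower 12 l) \<le> 2 ^ 40 * \<Sigma>" and up: "2 ^ 40 * \<Sigma> \<le> real_of_int (sq_upper 12 u)"
      unfolding \<Sigma>_def using Suc.prems(2,4,5) x0 by (intro sq_lower_le sq_upper_ge; simp add: x_def)+
    have eq: "octave_trunc (real_of_int c / 16) = real_of_int c * (\<Sigma> + 1) / 2 ^ 15"
      by (simp add: octave_trunc_eq \<Sigma>_def x_def)
    have "real_of_int 51978024883318936 \<le> real_of_int (c * (sq_lower 12 l + 1099511627776))"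
      using Suc.prems(1) unfolding mesh_check.simps of_int_le_iff by blast
    also have "\<dots> \<le> real_of_int c * (2 ^ 40 * (\<Sigma> + 1))"
      unfolding of_int_mult using lo Suc.prems by (intro mult_left_mono) auto
    finally have 1: "51978024883318936 \<le> real_of_int c * (2 ^ 40 * (\<Sigma> + 1))" by simp
    have "real_of_int c * (2 ^ 40 * (\<Sigma> + 1)) \<le> real_of_int (c * (sq_upper 12 u + 1099511627776))"
      unfolding of_int_mult using up Suc.prems by (intro mult_left_mono) auto
    also have "\<dots> \<le> real_of_int 51979826323172000"
      using Suc.prems(1) unfolding mesh_check.simps of_int_le_iff by blast
    finally have 2: "real_of_int c * (2 ^ 40 * (\<Sigma> + 1)) \<le> 51979826323172000" by simp
    show ?thesis
      using 1 2 0 by (simp add: eq algebra_simps)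
  next
    case (Suc j)
    have e: "exp (- (real_of_int (c + 1) / 32768)) = x * exp (- (1 / 32768))"
      by (simp add: x_def exp_add [symmetric] add_divide_distrib)
    have "real_of_int (l * 1099478073854 div 1099511627776) \<le> real_of_int (l * 1099478073854) / 1099511627776"
      by linarith
    also have "\<dots> \<le> (2 ^ 40 * x) * (2 ^ 40 * exp (- (1 / 32768))) / 1099511627776"
      unfolding of_int_mult using Suc.prems r by (intro divide_right_mono mult_mono) (auto simp: x_def)
    finally have 1: "real_of_int (l * 1099478073854 div 1099511627776) \<le> 2 ^ 40 * exp (- (real_of_int (c + 1) / 32768))"
      unfolding e by simp
    have "(2 ^ 40 * x) * (2 ^ 40 * exp (- (1 / 32768))) / 1099511627776
       \<le> real_of_int (u * 1099478073857) / 1099511627776"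
      unfolding of_int_mult using Suc.prems r x0 by (intro divide_right_mono mult_mono) (auto simp: x_def)
    also have "\<dots> \<le> real_of_int (u * 1099478073857 div 1099511627776 + 1)"
      by linarith
    finally have 2: "2 ^ 40 * exp (- (real_of_int (c + 1) / 32768)) \<le> real_of_int (u * 1099478073857 div 1099511627776 + 1)"
      unfolding e by simp
    have "144267999 / 100000000 \<le> octave_trunc (real_of_int (c + 1 + int j) / 16)
       \<and> octave_trunc (real_of_int (c + 1 + int j) / 16) \<le> 144273001 / 100000000"
      by (rule Suc.IH [OF _ _ _ 1 2]) (use Suc.prems Suc in auto)
    then show ?thesis using Suc by (simp add: add_ac)
  qed
qed simp

lemma mesh_check_ok: "mesh_check 129 128 1095225038163 1095225038177"
  by code_simp

lemma exp_neg_taylor: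
  fixes x :: real
  assumes "0 \<le> x"
  shows "1 - x + x\<^sup>2 / 2 - x ^ 3 / 6 \<le> exp (- x)" "exp (- x) \<le> 1 - x + x\<^sup>2 / 2 - x ^ 3 / 6 + x ^ 4 / 24"
proof -
  have d: "((\<lambda>x. exp (- x) - (1 - x + x\<^sup>2 / 2 - x ^ 3 / 6)) has_real_derivative
      1 - y + y\<^sup>2 / 2 - exp (- y)) (at y)" for y :: real
    by (auto intro!: derivative_eq_intros simp: algebra_simps power2_eq_square)
  have d4: "((\<lambda>x. 1 - x + x\<^sup>2 / 2 - x ^ 3 / 6 + x ^ 4 / 24 - exp (- x)) has_real_derivative
      exp (- y) - (1 - y + y\<^sup>2 / 2 - y ^ 3 / 6)) (at y)" for y :: real
    by (auto intro!: derivative_eq_intros simp: algebra_simps power2_eq_square power3_eq_cube)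
  have d2: "((\<lambda>x. 1 - x + x\<^sup>2 / 2 - exp (- x)) has_real_derivative exp (- y) - (1 - y)) (at y)" for y :: real
    by (auto intro!: derivative_eq_intros simp: algebra_simps power2_eq_square)
  have h: "0 \<le> exp (- y) - (1 - y)" for y :: real
    using exp_ge_add_one_self [of "- y"] by simp
  have 1: "0 \<le> 1 - y + y\<^sup>2 / 2 - exp (- y)" if "0 \<le> y" for y :: real
    by (rule DERIV_nonneg_imp_nonneg [OF _ that d2]) (use h in auto)
  have 2: "0 \<le> exp (- y) - (1 - y + y\<^sup>2 / 2 - y ^ 3 / 6)" if "0 \<le> y" for y :: real
    by (rule DERIV_nonneg_imp_nonneg [OF _ that d]) (use 1 in auto)
  show "1 - x + x\<^sup>2 / 2 - x ^ 3 / 6 \<le> exp (- x)" using 2 [OF assms] by simp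
  have "0 \<le> 1 - x + x\<^sup>2 / 2 - x ^ 3 / 6 + x ^ 4 / 24 - exp (- x)"
    by (rule DERIV_nonneg_imp_nonneg [OF _ assms d4]) (use 2 in auto)
  then show "exp (- x) \<le> 1 - x + x\<^sup>2 / 2 - x ^ 3 / 6 + x ^ 4 / 24" by simp
qed

lemma octave_trunc_mesh:
  assumes "i \<le> 128"
  shows "144267999 / 100000000 \<le> octave_trunc (8 + real i / 16)"
    and "octave_trunc (8 + real i / 16) \<le> 144273001 / 100000000"
proof -
  have "144267999 / 100000000 \<le> octave_trunc (real_of_int (128 + int i) / 16)
       \<and> octave_trunc (real_of_int (128 + int i) / 16) \<le> 144273001 / 100000000"
  proof (rule mesh_check_sound [OF mesh_check_ok])
    show "real_of_int 1095225038163 \<le> 2 ^ 40 * exp (- (real_of_int 128 / 32768))"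
      "2 ^ 40 * exp (- (real_of_int 128 / 32768)) \<le> real_of_int 1095225038177"
      using exp_neg_taylor [of "1 / 256"] by (simp_all add: field_simps)
    show "1099478073854 \<le> 2 ^ 40 * exp (- (1 / 32768 :: real))"
       "2 ^ 40 * exp (- (1 / 32768 :: real)) \<le> 1099478073857"
      using exp_neg_taylor [of "1 / 32768"] by (simp_all add: field_simps)
  qed (use assms in auto)
  moreover have "real_of_int (128 + int i) / 16 = 8 + real i / 16" by (simp add: add_divide_distrib)
  ultimately show "144267999 / 100000000 \<le> octave_trunc (8 + real i / 16)"
    "octave_trunc (8 + real i / 16) \<le> 144273001 / 100000000" by (simp_all only:)
qed

lemma octave_sum_base:
  assumes y: "y \<in> {8..16}"
  shows "144264 / 100000 \<le> octave_sum y" "octave_sum y \<le> 144274668 / 100000000"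
proof -
  \<comment> \<open>The cap at \<open>127\<close> puts the end point \<open>y = 16\<close> into the
    last mesh interval.\<close>
  define i where "i = min 127 (nat \<lfloor>(y - 8) * 16\<rfloor>)"
  define a where "a = 8 + real i / 16"
  have i: "i \<le> 127" by (simp add: i_def)
  have ya: "y \<in> {a..a + 1 / 16}"
  proof (cases "(y - 8) * 16 < 128")
    case True
    then have le: "\<lfloor>(y - 8) * 16\<rfloor> \<le> 127" by linarith
    have "0 \<le> (y - 8) * 16" using y by simp
    then have ge: "0 \<le> \<lfloor>(y - 8) * 16\<rfloor>" by linarith
    have "i = nat \<lfloor>(y - 8) * 16\<rfloor>" using le by (simp only: i_def)
    then have "real i = real_of_int \<lfloor>(y - 8) * 16\<rfloor>" using ge by (simp only: of_nat_nat)
    then show ?thesis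
      using floor_correct [of "(y - 8) * 16"] by (simp add: a_def field_simps)
  next
    case False
    then have "y = 16" using y by simp
    moreover from this have "i = 127" by (simp add: i_def)
    ultimately show ?thesis by (simp add: a_def)
  qed
  have sub: "x \<in> {8..16}" if "x \<in> {a..a + 1 / 16}" for x
    using that i by (auto simp: a_def)
  have b: "\<bar>octave_trunc'' x\<bar> \<le> 34 / 1000" if "x \<in> {a..a + 1 / 16}" for x
    using octave_trunc''_bound [OF sub [OF that]] .
  have a1: "a + 1 / 16 = 8 + real (i + 1) / 16" by (simp add: a_def add_divide_distrib)
  have sq: "34 / 1000 * (a + 1 / 16 - a)\<^sup>2 / 8 = 17 / 1024000" by (simp add: power2_eq_square)
  note m = octave_trunc_mesh [of i] octave_trunc_mesh [of "i + 1"]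
  have "octave_trunc y \<le> max (octave_trunc a) (octave_trunc (a + 1 / 16)) + 34 / 1000 * (a + 1 / 16 - a)\<^sup>2 / 8"
    by (rule chord_upper_bound [OF octave_trunc_deriv _ ya]) (use b in force)+
  moreover have "- octave_trunc y \<le> max (- octave_trunc a) (- octave_trunc (a + 1 / 16)) + 34 / 1000 * (a + 1 / 16 - a)\<^sup>2 / 8"
    by (rule chord_upper_bound [OF DERIV_minus DERIV_minus _ ya, OF octave_trunc_deriv])
       (use b in force)+
  ultimately have "octave_trunc y \<le> 144274668 / 100000000" "1442661 / 1000000 \<le> octave_trunc y"
    using m i unfolding sq unfolding a1 unfolding a_def max_def by (simp_all split: if_splits)
  then show "144264 / 100000 \<le> octave_sum y" "octave_sum y \<le> 144274668 / 100000000"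
    using octave_sum_trunc [OF y] by auto
qed

text \<open>Doubling \<open>y\<close> adds the term \<open>2 y exp (- 2 y)\<close>, and the second
  claim keeps twice that term in reserve. Since the reserve required after the doubling is no larger
  than the term just added, the old reserve pays for both, and the induction over octaves
  closes.\<close>

lemma octave_ge_8:
  assumes "8 \<le> y"
  shows "144264 / 100000 \<le> octave_sum y"
    and "octave_sum y + 2 * (2 * y * exp (- (2 * y))) \<le> 1442756 / 1000000"
proof -
  have base: "144264 / 100000 \<le> octave_sum y \<and> octave_sum y + 2 * (2 * y * exp (- (2 * y))) \<le> 1442756 / 1000000"
    if "y \<in> {8..16}" for y
  proof -
    have "2 * y * exp (- (2 * y)) \<le> 32 * exp (- 16)"
      using that by (intro mult_mono) auto
    also have "\<dots> \<le> 32 * (1 / 7000000)" using exp_numeric(5) by simp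
    finally show ?thesis
      using octave_sum_base [OF that] by linarith
  qed
  have "144264 / 100000 \<le> octave_sum y \<and> octave_sum y + 2 * (2 * y * exp (- (2 * y))) \<le> 1442756 / 1000000"
    if "8 \<le> y" "y \<le> 8 * 2 ^ Suc m" for m y
    using that
  proof (induction m arbitrary: y)
    case 0
    then show ?case using base by auto
  next
    case (Suc m)
    show ?case
    proof (cases "y \<le> 16")
      case False
      define z where "z = y / 2"
      have z: "8 \<le> z" "z \<le> 8 * 2 ^ Suc m" "y = 2 * z" using False Suc.prems by (auto simp: z_def)
      note IH = Suc.IH [OF z(1,2)]
      have d: "octave_sum y = 2 * z * exp (- (2 * z)) + octave_sum z"
        using octave_sum_double [of z] z by simp
      have "exp (- (2 * z)) \<le> exp (- 16)" using z by simp
      then have "4 * exp (- (2 * z)) \<le> 1" using exp_numeric(5) by linarith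
      then have "4 * exp (- (2 * z)) * (2 * z * exp (- (2 * z))) \<le> 1 * (2 * z * exp (- (2 * z)))"
        using z by (intro mult_right_mono) auto
      moreover have "2 * (2 * y * exp (- (2 * y))) = 4 * exp (- (2 * z)) * (2 * z * exp (- (2 * z)))"
        unfolding z(3) by (simp add: exp_add [symmetric] algebra_simps)
      moreover have "0 \<le> 2 * z * exp (- (2 * z))" using z by simp
      ultimately show ?thesis using IH d by linarith
    qed (use Suc.prems base [of y] in auto)
  qed
  moreover obtain m where "y / 8 < 2 ^ m" using real_arch_pow [of 2 "y / 8"] by auto
  then have "y \<le> 8 * 2 ^ Suc m" using assms by simp
  ultimately show "144264 / 100000 \<le> octave_sum y"
    "octave_sum y + 2 * (2 * y * exp (- (2 * y))) \<le> 1442756 / 1000000"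
    using assms by blast+
qed

text \<open>Doubling only adds a nonnegative term, so each \<open>y > 0\<close> is dominated by some
  \<open>2 ^ m * y \<ge> 8\<close>.\<close>

lemma octave_sum_le:
  assumes "0 < y"
  shows "octave_sum y \<le> 1442756 / 1000000"
proof -
  have *: "octave_sum y \<le> octave_sum (2 ^ m * y)" for m
  proof (induction m)
    case (Suc m)
    then show ?case
    proof -
      define z where "z = 2 ^ m * y"
      have z: "0 \<le> z" "2 ^ Suc m * y = 2 * z" using assms by (simp_all add: z_def)
      have "0 \<le> 2 * z * exp (- (2 * z))" using z by simp
      then show ?thesis
        using Suc octave_sum_double [OF z(1)] unfolding z(2) z_def [symmetric] by linarith
    qed
  qed simp
  obtain m where "8 / y < 2 ^ m" using real_arch_pow [of 2 "8 / y"] by auto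
  then have z8: "8 \<le> 2 ^ m * y" using assms by (simp add: field_simps)
  then have "0 \<le> 2 * (2 ^ m * y) * exp (- (2 * (2 ^ m * y)))"
    by (intro mult_nonneg_nonneg) (use assms in auto)
  then show ?thesis
    using octave_ge_8(2) [OF z8] * [of m] by linarith
qed

text \<open>A crude positive bound that also covers small \<open>n\<close>; its purpose is the
  summability of \<open>1 / (n ln n)\<close> over all almost primes.\<close>

lemma octave_sum_ge:
  assumes "1 \<le> y"
  shows "exp (- 8) \<le> octave_sum y"
proof (cases "8 \<le> y")
  case True
  have "exp (- 8) \<le> (1 :: real)" by simp
  then show ?thesis using octave_ge_8(1) [OF True] by linarith
next
  case False
  have "1 * exp (- 8) \<le> y * exp (- y)" using assms False by (intro mult_mono) auto
  then show ?thesis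
    using octave_sum_split [of y 1] octave_sum_nonneg [of "y / 2"] assms by simp
qed

section \<open>Reduction to sums of almost prime zeta values\<close>

definition octave_t :: "nat \<Rightarrow> real" where
  "octave_t i = 2 / 2 ^ i"

lemma octave_t_pos: "0 < octave_t i" and octave_t_le: "octave_t i \<le> 2"
  by (simp_all add: octave_t_def divide_le_eq)

definition axp :: "nat \<Rightarrow> nat \<Rightarrow> real" where
  "axp k i = apz (1 + octave_t i) k"

lemma axp_nonneg: "0 \<le> axp k i"
  by (simp add: axp_def apz_nonneg)

lemma axp_eq_hom: "axp k i = hom (\<lambda>j. pzeta (real j * (1 + octave_t i))) k"
  using octave_t_pos [of i] by (simp add: axp_def apz_eq_hom)

lemma almost_primes_ge:
  assumes "n \<in> almost_primes k"
  shows "2 ^ k \<le> n"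
proof -
  have "2 ^ size M \<le> prod_mset M" if "\<And>p. p \<in># M \<Longrightarrow> prime p" for M :: "nat multiset"
    using that
  proof (induction M)
    case (add p M)
    then have "2 ^ size M \<le> prod_mset M" "2 \<le> p" by (auto intro: prime_ge_2_nat)
    then show ?case by (simp add: mult_mono)
  qed simp
  from this [of "prime_factorization n"] show ?thesis
    using assms by (auto simp: almost_primes_def bigomega_def prod_mset_prime_factorization_nat)
qed

lemma almost_primes_ge_2: "k \<ge> 1 \<Longrightarrow> n \<in> almost_primes k \<Longrightarrow> n \<ge> 2"
  using almost_primes_ge [of n k] power_increasing [of 1 k "2::nat"] by simp

lemma octave_terms:
  assumes "n \<ge> 2"
  shows "octave_t i * real n powr - (1 + octave_t i)
    = 1 / (real n * ln (real n)) * (2 * ln (real n) / 2 ^ i * exp (- (2 * ln (real n) / 2 ^ i)))"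
proof -
  have "ln (real n) > 0" using assms by simp
  moreover have "real n powr - (1 + octave_t i) = exp (- (2 * ln (real n) / 2 ^ i)) / real n"
  proof -
    have "real n powr - (1 + octave_t i) = exp (- (2 * ln (real n) / 2 ^ i) - ln (real n))"
      using assms by (simp add: powr_def octave_t_def algebra_simps)
    then show ?thesis using assms by (simp add: exp_diff)
  qed
  ultimately show ?thesis
    using assms by (simp add: octave_t_def field_simps)
qed

lemma octave_terms_sums:
  assumes "n \<ge> 2"
  shows "(\<lambda>i. octave_t i * real n powr - (1 + octave_t i)) sums
     (1 / (real n * ln (real n)) * octave_sum (2 * ln (real n)))"
  unfolding octave_terms [OF assms] octave_sum_def
  using assms by (intro sums_mult summable_sums octave_summable) simp

lemma sum_octave_finite:
  assumes "\<And>M. (\<Sum>i<M. octave_t i * axp k i) \<le> U" "finite F" "F \<subseteq> almost_primes k" "k \<ge> 1"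
  shows "(\<Sum>n\<in>F. 1 / (real n * ln (real n)) * octave_sum (2 * ln (real n))) \<le> U"
proof -
  have "(\<lambda>i. \<Sum>n\<in>F. octave_t i * real n powr - (1 + octave_t i)) sums
      (\<Sum>n\<in>F. 1 / (real n * ln (real n)) * octave_sum (2 * ln (real n)))"
    using assms almost_primes_ge_2 by (intro sums_sum octave_terms_sums) auto
  then have "(\<lambda>M. \<Sum>i<M. \<Sum>n\<in>F. octave_t i * real n powr - (1 + octave_t i))
      \<longlonglongrightarrow> (\<Sum>n\<in>F. 1 / (real n * ln (real n)) * octave_sum (2 * ln (real n)))"
    by (simp add: sums_def)
  moreover have "(\<Sum>i<M. \<Sum>n\<in>F. octave_t i * real n powr - (1 + octave_t i)) \<le> U" for M
  proof -
    have "(\<Sum>i<M. \<Sum>n\<in>F. octave_t i * real n powr - (1 + octave_t i)) \<le> (\<Sum>i<M. octave_t i * axp k i)"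
    proof (intro sum_mono)
      fix i
      have "(\<Sum>n\<in>F. real n powr - (1 + octave_t i)) \<le> axp k i"
        using apz_has_sum [of "1 + octave_t i" k] octave_t_pos [of i] assms
        unfolding axp_def by (intro finite_sum_le_has_sum) auto
      then show "(\<Sum>n\<in>F. octave_t i * real n powr - (1 + octave_t i)) \<le> octave_t i * axp k i"
        using octave_t_pos [of i] by (simp add: sum_distrib_left [symmetric])
    qed
    then show ?thesis using assms(1) [of M] by linarith
  qed
  ultimately show ?thesis by (intro LIMSEQ_le_const2) auto
qed

text \<open>Summability is derived together with the bound because \<open>infsum\<close> is
  \<open>0\<close> for a divergent series. Both follow from finite subsets, for which the sums over
  \<open>n\<close> and over the nodes may be interchanged.\<close>

lemma erdos_sum_upper:
  assumes U: "\<And>M. (\<Sum>i<M. octave_t i * axp k i) \<le> U" and "k \<ge> 1"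
    and A: "\<And>n. n \<in> almost_primes k \<Longrightarrow> A \<le> octave_sum (2 * ln (real n))" and "0 < A"
  shows "(\<lambda>n. 1 / (real n * ln (real n))) summable_on almost_primes k"
    and "A * erdos_sum (almost_primes k) \<le> U"
proof -
  have pos: "0 \<le> 1 / (real n * ln (real n))" if "n \<in> almost_primes k" for n
    using almost_primes_ge_2 [OF \<open>k \<ge> 1\<close> that] by simp
  have fin: "(\<Sum>n\<in>F. 1 / (real n * ln (real n))) \<le> U / A" if "finite F" "F \<subseteq> almost_primes k" for F
  proof -
    have "(\<Sum>n\<in>F. 1 / (real n * ln (real n))) * A \<le> (\<Sum>n\<in>F. 1 / (real n * ln (real n)) * octave_sum (2 * ln (real n)))"
      unfolding sum_distrib_right using A pos that by (intro sum_mono mult_left_mono) auto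
    also have "\<dots> \<le> U" using that assms by (intro sum_octave_finite) auto
    finally show ?thesis using \<open>0 < A\<close> by (simp add: field_simps)
  qed
  show s: "(\<lambda>n. 1 / (real n * ln (real n))) summable_on almost_primes k"
    by (rule nonneg_bdd_above_summable_on) (use pos fin in \<open>auto intro!: bdd_aboveI\<close>)
  have "erdos_sum (almost_primes k) \<le> U / A"
    unfolding erdos_sum_def by (rule infsum_le_finite_sums [OF s]) (use fin in auto)
  then show "A * erdos_sum (almost_primes k) \<le> U"
    using \<open>0 < A\<close> by (simp add: field_simps)
qed

lemma erdos_sum_lower:
  assumes "(\<lambda>n. 1 / (real n * ln (real n))) summable_on almost_primes k" and "k \<ge> 1"
  shows "(\<Sum>i<M. octave_t i * axp k i) \<le> 1442756 / 1000000 * erdos_sum (almost_primes k)"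
proof -
  have "((\<lambda>n. octave_t i * real n powr - (1 + octave_t i)) has_sum octave_t i * axp k i) (almost_primes k)" for i
    unfolding axp_def using octave_t_pos [of i] by (intro has_sum_cmult_right apz_has_sum) auto
  then have "((\<lambda>n. \<Sum>i<M. octave_t i * real n powr - (1 + octave_t i)) has_sum (\<Sum>i<M. octave_t i * axp k i)) (almost_primes k)"
    by (induction M) (auto intro: has_sum_add)
  moreover have "((\<lambda>n. 1442756 / 1000000 * (1 / (real n * ln (real n)))) has_sum
      1442756 / 1000000 * erdos_sum (almost_primes k)) (almost_primes k)"
    unfolding erdos_sum_def by (intro has_sum_cmult_right has_sum_infsum assms)
  moreover have "(\<Sum>i<M. octave_t i * real n powr - (1 + octave_t i)) \<le> 1442756 / 1000000 * (1 / (real n * ln (real n)))"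
    if "n \<in> almost_primes k" for n
  proof -
    have n: "n \<ge> 2" using almost_primes_ge_2 [OF \<open>k \<ge> 1\<close> that] .
    have "(\<Sum>i<M. octave_t i * real n powr - (1 + octave_t i)) \<le> 1 / (real n * ln (real n)) * octave_sum (2 * ln (real n))"
      using octave_terms_sums [OF n] octave_t_pos
      by (subst sums_unique [OF octave_terms_sums [OF n]], intro sum_le_suminf)
         (auto simp: less_imp_le sums_iff)
    also have "\<dots> \<le> 1 / (real n * ln (real n)) * (1442756 / 1000000)"
      using n by (intro mult_left_mono octave_sum_le) auto
    finally show ?thesis by (simp only: mult.commute)
  qed
  ultimately show ?thesis by (rule has_sum_mono)
qed

section \<open>Convergence over the nodes\<close>

lemma zeta_le:
  assumes "0 < t" "t \<le> 2"
  shows "zeta (1 + t) \<le> 1 / t + 1"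
proof -
  have "zeta (1 + t) \<le> 1 / t + (1 / 2 + (1 + t) / 12)"
    using zeta_em(1) [of "1 + t" 1] assms by (simp add: em_main_def)
  also have "\<dots> \<le> 1 / t + 1"
    using assms(2) by (intro add_left_mono) (simp add: field_simps)
  finally show ?thesis .
qed

text \<open>The generating function is taken at \<open>z = 1 / 2\<close>: as
  \<open>z ^ j \<le> z\<close>, the exponent is at most half of \<open>ln (zeta s)\<close>. The
  resulting growth of order \<open>t powr (- 1 / 2)\<close> is beaten by the weight
  \<open>t\<close>, which gives a convergent sum over the octaves.\<close>

lemma axp_le: "axp k i \<le> 2 ^ k * sqrt (1 / octave_t i + 1)"
proof -
  define s where "s = 1 + octave_t i"
  have s: "s > 1" using octave_t_pos by (simp add: s_def)
  have "axp k i \<le> exp (\<Sum>j=1..k. pzeta (real j * s) * (1 / 2) ^ j / real j) / (1 / 2) ^ k"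
    unfolding axp_eq_hom s_def by (rule hom_le_exp) (simp_all add: pzeta_nonneg)
  also have "(\<Sum>j=1..k. pzeta (real j * s) * (1 / 2) ^ j / real j) \<le> (\<Sum>j=1..k. pzeta (real j * s) / real j * (1 / 2))"
  proof (rule sum_mono)
    fix j assume "j \<in> {1..k}"
    then have "(1 / 2 :: real) ^ j \<le> (1 / 2) ^ 1" by (intro power_decreasing) auto
    then have "pzeta (real j * s) / real j * (1 / 2) ^ j \<le> pzeta (real j * s) / real j * (1 / 2)"
      using pzeta_nonneg by (intro mult_left_mono) auto
    then show "pzeta (real j * s) * (1 / 2) ^ j / real j \<le> pzeta (real j * s) / real j * (1 / 2)"
      by simp
  qed
  also have "(\<Sum>j=1..k. pzeta (real j * s) / real j * (1 / 2)) = (\<Sum>j=1..k. pzeta (real j * s) / real j) * (1 / 2)"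
    by (simp only: sum_distrib_right)
  also have "\<dots> \<le> ln (zeta s) * (1 / 2)"
    using exp_le_zeta [OF s, of k] zeta_ge_1 [OF s] by (intro mult_right_mono) (simp_all add: ln_ge_iff)
  finally have "axp k i \<le> exp (ln (zeta s) * (1 / 2)) / (1 / 2) ^ k"
    by (simp add: divide_right_mono)
  also have "exp (ln (zeta s) * (1 / 2)) = sqrt (zeta s)"
    using zeta_ge_1 [OF s] by (simp add: powr_half_sqrt [symmetric] powr_def)
  also have "sqrt (zeta s) / (1 / 2) ^ k = 2 ^ k * sqrt (zeta s)"
    by (simp add: power_one_over)
  also have "\<dots> \<le> 2 ^ k * sqrt (1 / octave_t i + 1)"
    unfolding s_def using octave_t_pos octave_t_le by (intro mult_left_mono real_sqrt_le_mono zeta_le) auto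
  finally show ?thesis .
qed

lemma summable_octave_axp: "summable (\<lambda>i. octave_t i * axp k i)"
proof (rule summable_comparison_test')
  show "summable (\<lambda>i. 2 ^ k * sqrt 6 * (1 / sqrt 2) ^ i)"
    by (intro summable_mult summable_geometric) simp
  fix i :: nat
  define t where "t = octave_t i"
  have t: "0 < t" "t \<le> 2" using octave_t_pos octave_t_le by (simp_all add: t_def)
  have "t * sqrt (1 / t + 1) = sqrt (t ^ 2 * (1 / t + 1))"
    using t by (simp add: real_sqrt_mult)
  also have "t ^ 2 * (1 / t + 1) = t * (1 + t)"
    using t by (simp add: power2_eq_square field_simps)
  also have "sqrt (t * (1 + t)) \<le> sqrt (t * 3)"
    using t by (intro real_sqrt_le_mono mult_left_mono) auto
  also have "t * 3 = 6 * (1 / 2) ^ i" by (simp add: t_def octave_t_def power_one_over)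
  also have "sqrt (6 * (1 / 2) ^ i) = sqrt 6 * (1 / sqrt 2) ^ i"
    by (simp add: real_sqrt_mult real_sqrt_power real_sqrt_divide)
  finally have "t * sqrt (1 / t + 1) \<le> sqrt 6 * (1 / sqrt 2) ^ i" .
  then have "2 ^ k * (t * sqrt (1 / t + 1)) \<le> 2 ^ k * (sqrt 6 * (1 / sqrt 2) ^ i)" by simp
  moreover have "t * axp k i \<le> t * (2 ^ k * sqrt (1 / t + 1))"
    using axp_le [of k i] t by (simp add: t_def)
  moreover have "t * (2 ^ k * sqrt (1 / t + 1)) = 2 ^ k * (t * sqrt (1 / t + 1))" by simp
  ultimately have "t * axp k i \<le> 2 ^ k * (sqrt 6 * (1 / sqrt 2) ^ i)" by linarith
  then show "norm (octave_t i * axp k i) \<le> 2 ^ k * sqrt 6 * (1 / sqrt 2) ^ i"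
    using axp_nonneg [of k i] t by (simp add: t_def abs_mult)
qed

lemma erdos_summable:
  assumes "k \<ge> 1"
  shows "(\<lambda>n. 1 / (real n * ln (real n))) summable_on almost_primes k"
proof (rule erdos_sum_upper(1) [OF _ assms])
  show "(\<Sum>i<M. octave_t i * axp k i) \<le> (\<Sum>i. octave_t i * axp k i)" for M
    using octave_t_pos axp_nonneg by (intro sum_le_suminf summable_octave_axp) (auto simp: less_imp_le)
  fix n assume n: "n \<in> almost_primes k"
  then have "2 \<le> n" using almost_primes_ge_2 assms by blast
  then have "ln 2 \<le> ln (real n)" by simp
  then show "exp (- 8) \<le> octave_sum (2 * ln (real n))"
    using ln2_ge_two_thirds by (intro octave_sum_ge) linarith
qed simp

lemma erdos_sum_ge:
  assumes "k \<ge> 1"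
  shows "(\<Sum>i<M. octave_t i * axp k i) \<le> 1442756 / 1000000 * erdos_sum (almost_primes k)"
  by (rule erdos_sum_lower [OF erdos_summable [OF assms] assms])

lemma erdos_sum_6_le:
  assumes "\<And>M. (\<Sum>i<M. octave_t i * axp 6 i) \<le> U"
  shows "144264 / 100000 * erdos_sum (almost_primes 6) \<le> U"
proof (rule erdos_sum_upper(2) [OF assms])
  fix n assume "n \<in> almost_primes 6"
  then have "2 ^ 6 \<le> real n" using almost_primes_ge [of n 6] by simp
  then have "ln (2 ^ 6) \<le> ln (real n)" by (subst ln_le_cancel_iff) auto
  moreover have "ln (2 ^ 6 :: real) = 6 * ln 2" by (subst ln_realpow) auto
  ultimately have "6 * ln 2 \<le> ln (real n)" by linarith
  then have "8 \<le> 2 * ln (real n)" using ln2_ge_two_thirds by linarith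
  then show "144264 / 100000 \<le> octave_sum (2 * ln (real n))" by (rule octave_ge_8)
qed auto

section \<open>Interval arithmetic for the prime zeta function\<close>

text \<open>The suffix \<open>B\<close> marks functions from which the contribution of the primes up to \<open>7\<close> is removed.\<close>

definition PB :: "real \<Rightarrow> real" where
  "PB s = (\<Sum>\<^sub>\<infinity>p\<in>{p::nat. prime p \<and> 7 < p}. real p powr - s)"

definition zB :: "real \<Rightarrow> real" where
  "zB s = zeta s * (1 - 2 powr - s) * (1 - 3 powr - s) * (1 - 5 powr - s) * (1 - 7 powr - s)"

lemma primes_split: "{p::nat. prime p} = {2, 3, 5, 7} \<union> {p. prime p \<and> 7 < p}"
proof -
  have "p \<in> {2, 3, 5, 7}" if "prime p" "p \<le> 7" for p :: nat
  proof -
    have "p \<in> {0, 1, 2, 3, 4, 5, 6, 7}" using that(2) by auto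
    moreover have "\<not> prime (4::nat)" "\<not> prime (6::nat)"
      by simp_all
    ultimately show ?thesis using that(1) by auto
  qed
  moreover have "prime (2::nat)" "prime (3::nat)" "prime (5::nat)" "prime (7::nat)"
    by simp_all
  ultimately show ?thesis using leI by blast
qed

lemma PB_has_sum: "s > 1 \<Longrightarrow> ((\<lambda>p. real p powr - s) has_sum PB s) {p. prime p \<and> 7 < p}"
  unfolding PB_def by (intro has_sum_infsum powr_summable_on)

lemma PB_nonneg: "0 \<le> PB s"
  unfolding PB_def by (rule infsum_nonneg) simp

lemma pzeta_eq_PB:
  assumes "s > 1"
  shows "pzeta s = 2 powr - s + 3 powr - s + 5 powr - s + 7 powr - s + PB s"
proof -
  have "((\<lambda>p. real p powr - s) has_sum (\<Sum>p\<in>{2,3,5,7::nat}. real p powr - s) + PB s)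
      ({2, 3, 5, 7} \<union> {p. prime p \<and> 7 < p})"
    by (intro has_sum_Un_disjoint has_sum_finite PB_has_sum assms) auto
  then show ?thesis
    using pzeta_has_sum [OF assms] unfolding primes_split [symmetric]
    by (auto dest: has_sum_unique)
qed

text \<open>Each removed Euler factor has the logarithm series \<open>- ln (1 - q powr - s)\<close>,
  which is subtracted term by term from the series for \<open>ln (zeta s)\<close>.\<close>

lemma ln_zB_sums:
  assumes "s > 1"
  shows "(\<lambda>m. PB (real (Suc m) * s) / real (Suc m)) sums ln (zB s)"
proof -
  have l: "(\<lambda>m. (q powr - (real (Suc m) * s)) / real (Suc m)) sums (- ln (1 - q powr - s))"
    if "q > 1" for q :: real
  proof -
    define y where "y = q powr - s"
    have y: "0 < y" "y < 1" using that assms by (auto simp: y_def powr_less_one)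
    have "(\<lambda>n. - ((- (- y)) ^ n) / real n) sums ln (1 + (- y))"
      using ln_series' [of "- y"] y by simp
    then have "(\<lambda>n. - (y ^ Suc n) / real (Suc n)) sums ln (1 - y)"
      using sums_Suc_iff [of "\<lambda>n. - (y ^ n) / real n" "ln (1 - y)"] by simp
    from sums_minus [OF this] have "(\<lambda>n. y ^ Suc n / real (Suc n)) sums (- ln (1 - y))"
      by (simp only: minus_divide_left minus_minus)
    moreover have "y ^ Suc n = q powr - (real (Suc n) * s)" for n
      using that unfolding y_def by (subst powr_power) (auto simp: algebra_simps)
    ultimately show ?thesis by (simp only: y_def)
  qed
  have "(\<lambda>m. pzeta (real (Suc m) * s) / real (Suc m) - 2 powr - (real (Suc m) * s) / real (Suc m)
      - 3 powr - (real (Suc m) * s) / real (Suc m) - 5 powr - (real (Suc m) * s) / real (Suc m)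
      - 7 powr - (real (Suc m) * s) / real (Suc m))
     sums (ln (zeta s) - - ln (1 - 2 powr - s) - - ln (1 - 3 powr - s) - - ln (1 - 5 powr - s) - - ln (1 - 7 powr - s))"
    by (intro sums_diff ln_zeta_sums assms l) auto
  also have "(\<lambda>m. pzeta (real (Suc m) * s) / real (Suc m) - 2 powr - (real (Suc m) * s) / real (Suc m)
      - 3 powr - (real (Suc m) * s) / real (Suc m) - 5 powr - (real (Suc m) * s) / real (Suc m)
      - 7 powr - (real (Suc m) * s) / real (Suc m)) = (\<lambda>m. PB (real (Suc m) * s) / real (Suc m))"
  proof
    fix m
    have "1 * s \<le> real (Suc m) * s" using assms by (intro mult_right_mono) auto
    then have "real (Suc m) * s > 1" using assms by linarith
    then show "pzeta (real (Suc m) * s) / real (Suc m) - 2 powr - (real (Suc m) * s) / real (Suc m)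
      - 3 powr - (real (Suc m) * s) / real (Suc m) - 5 powr - (real (Suc m) * s) / real (Suc m)
      - 7 powr - (real (Suc m) * s) / real (Suc m) = PB (real (Suc m) * s) / real (Suc m)"
      by (simp add: pzeta_eq_PB add_divide_distrib)
  qed
  also have "ln (zeta s) - - ln (1 - 2 powr - s) - - ln (1 - 3 powr - s) - - ln (1 - 5 powr - s) - - ln (1 - 7 powr - s)
    = ln (zB s)"
  proof -
    have "0 < 1 - q powr - s" if "q > 1" for q :: real
      using that assms by (simp add: powr_less_one)
    then have pos: "0 < 1 - 2 powr - s" "0 < 1 - 3 powr - s" "0 < 1 - 5 powr - s" "0 < 1 - 7 powr - s"
      by simp_all
    moreover have "0 < zeta s" using zeta_ge_1 [OF assms] by linarith
    ultimately show ?thesis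
      unfolding zB_def by (simp add: ln_mult_pos)
  qed
  finally show ?thesis .
qed

lemma zB_pos: "s > 1 \<Longrightarrow> 0 < zB s"
  unfolding zB_def using zeta_ge_1 [of s]
  by (auto intro!: mult_pos_pos simp: powr_less_one)

text \<open>\<open>PB 5\<close> is the leading term of a nonnegative series, whence
  \<open>PB 5 \<le> ln (zB 5) \<le> zB 5 - 1\<close>. This one value anchors the decay estimate
  \<open>PB_le\<close>.\<close>

lemma PB_5_le: "PB 5 \<le> 11 / 1000000"
proof -
  have p: "real n powr - 5 = 1 / real n ^ 5" if "n > 0" for n
    using that powr_realpow [of "real n" 5] by (simp add: powr_minus_divide)
  have sm: "summable (\<lambda>m. PB (real (Suc m) * 5) / real (Suc m))"
    "(\<Sum>m. PB (real (Suc m) * 5) / real (Suc m)) = ln (zB 5)"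
    using ln_zB_sums [of 5] by (auto simp: sums_iff)
  have "PB 5 \<le> ln (zB 5)"
    using sum_le_suminf [OF sm(1), of "{0}"] by (simp add: sm(2) [symmetric] PB_nonneg)
  also have "\<dots> \<le> zB 5 - 1" using ln_le_minus_one [OF zB_pos [of 5]] by simp
  also have "zeta 5 \<le> (\<Sum>n=1..<8. real n powr - 5) + em_main 5 (real 8)"
    by (rule zeta_em) auto
  then have "zeta 5 \<le> (\<Sum>n=1..<8. 1 / real n ^ 5) + (1 / (8 ^ 4 * 4) + 1 / (2 * 8 ^ 5) + 5 / (12 * 8 ^ 6))"
    using powr_realpow [of 8 4] powr_realpow [of 8 5] powr_realpow [of 8 6]
    by (simp add: em_main_def p powr_minus_divide)
  have q: "2 powr - 5 = (1 / 2 ^ 5 :: real)" "3 powr - 5 = (1 / 3 ^ 5 :: real)"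
    "5 powr - 5 = (1 / 5 ^ 5 :: real)" "7 powr - 5 = (1 / 7 ^ 5 :: real)"
    by (rule powr_neg_numeral; simp)+
  from \<open>zeta 5 \<le> (\<Sum>n=1..<8. 1 / real n ^ 5) + _\<close> have "zB 5 - 1 \<le> ((\<Sum>n=1..<8. 1 / real n ^ 5) + (1 / (8 ^ 4 * 4) + 1 / (2 * 8 ^ 5) + 5 / (12 * 8 ^ 6)))
     * (1 - 1 / 2 ^ 5) * (1 - 1 / 3 ^ 5) * (1 - 1 / 5 ^ 5) * (1 - 1 / 7 ^ 5) - 1"
    unfolding zB_def q by (intro diff_right_mono mult_right_mono) simp_all
  also have "\<dots> \<le> 11 / 1000000"
    by (simp add: eval_nat_numeral)
  finally show ?thesis by simp
qed

lemma PB_le: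
  assumes "s \<ge> 5"
  shows "PB s \<le> 11 / 1000000 * 11 powr (5 - s)"
proof -
  have "PB s \<le> 11 powr (5 - s) * PB 5"
  proof (rule has_sum_mono [OF PB_has_sum has_sum_cmult_right [OF PB_has_sum]])
    fix p :: nat assume "p \<in> {p. prime p \<and> 7 < p}"
    then have p: "prime p" "7 < p" by auto
    moreover have "\<not> prime (8::nat)" "\<not> prime (9::nat)" "\<not> prime (10::nat)"
      by simp_all
    ultimately have "p \<noteq> 8" "p \<noteq> 9" "p \<noteq> 10" by auto
    then have "11 \<le> p" using p(2) by linarith
    then have "real p powr (5 - s) \<le> 11 powr (5 - s)"
      using assms by (intro powr_mono2') auto
    then have "real p powr (5 - s) * real p powr - 5 \<le> 11 powr (5 - s) * real p powr - 5"
      by (intro mult_right_mono) auto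
    moreover have "real p powr (5 - s) * real p powr - 5 = real p powr - s"
      by (simp add: powr_add [symmetric])
    ultimately show "real p powr - s \<le> 11 powr (5 - s) * real p powr - 5" by simp
  qed (use assms in auto)
  also have "\<dots> \<le> 11 powr (5 - s) * (11 / 1000000)"
    by (intro mult_left_mono PB_5_le) auto
  finally show ?thesis by (simp only: mult.commute)
qed

text \<open>Removing the primes up to \<open>7\<close> pays off here: consecutive terms shrink by a
  factor of at least \<open>11\<close>, so a few terms determine the logarithm. The value
  \<open>1 / 5\<close> in the hypothesis fits \<open>M = 4\<close> with \<open>s\<close> near
  \<open>1\<close>, and \<open>11 * 10^-6 / 5 * 11 / 10 = 2.42 * 10^-6\<close>.\<close>

lemma ln_zB_remainder:
  assumes "s > 1" "5 \<le> real (Suc M) * s" "11 powr (5 - real (Suc M) * s) / real (Suc M) \<le> 1 / 5"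
  defines "r \<equiv> ln (zB s) - (\<Sum>m<M. PB (real (Suc m) * s) / real (Suc m))"
  shows "0 \<le> r" "r \<le> 25 / 10000000"
proof -
  have r: "(\<lambda>m. PB (real (Suc (m + M)) * s) / real (Suc (m + M))) sums r"
    unfolding r_def using sums_split_initial_segment [OF ln_zB_sums [OF assms(1)], of M] by simp
  then show "0 \<le> r"
    using sums_le [OF _ sums_zero r] PB_nonneg by simp
  define c where "c = 11 / 1000000 * (11 powr (5 - real (Suc M) * s) / real (Suc M))"
  have g: "(\<lambda>m. c * (1 / 11) ^ m) sums (c * (1 / (1 - 1 / 11)))"
    by (intro sums_mult geometric_sums) simp
  have "r \<le> c * (1 / (1 - 1 / 11))"
  proof (rule sums_le [OF _ r g])
    fix m
    have a: "real (Suc M) * s + real m * 1 \<le> real (Suc M) * s + real m * s"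
      using assms(1) by (intro add_left_mono mult_left_mono) auto
    have e: "real (Suc (m + M)) * s = real (Suc M) * s + real m * s"
      by (simp add: algebra_simps)
    have "PB (real (Suc (m + M)) * s) \<le> 11 / 1000000 * 11 powr (5 - real (Suc (m + M)) * s)"
      using assms(1,2) a e by (intro PB_le) (auto simp: add_increasing2)
    also have "\<dots> \<le> 11 / 1000000 * 11 powr (5 - real (Suc M) * s - real m)"
      using a e by (intro mult_left_mono powr_mono) auto
    also have "\<dots> = 11 / 1000000 * 11 powr (5 - real (Suc M) * s) * (1 / 11) ^ m"
      by (simp add: powr_diff powr_realpow power_one_over)
    finally have "PB (real (Suc (m + M)) * s) / real (Suc (m + M))
       \<le> 11 / 1000000 * 11 powr (5 - real (Suc M) * s) * (1 / 11) ^ m / real (Suc M)"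
      using PB_nonneg by (intro frac_le) auto
    then show "PB (real (Suc (m + M)) * s) / real (Suc (m + M)) \<le> c * (1 / 11) ^ m"
      by (simp add: c_def)
  qed
  also have "c \<le> 11 / 1000000 * (1 / 5)"
    unfolding c_def using assms(3) by (intro mult_left_mono) auto
  finally show "r \<le> 25 / 10000000" by simp
qed

text \<open>A pair \<open>(l, u)\<close> of integers stands for the interval \<open>[l / 2\<^sup>4\<^sup>0, u / 2\<^sup>4\<^sup>0]\<close>; all
  quantities are nonnegative, and every operation rounds outwards.\<close>

type_synonym bracket = "int \<times> int"

definition encl :: "bracket \<Rightarrow> real \<Rightarrow> bool" where
  "encl b x \<longleftrightarrow> 0 \<le> fst b \<and> real_of_int (fst b) \<le> 2 ^ 40 * x \<and> 2 ^ 40 * x \<le> real_of_int (snd b)"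

fun badd :: "bracket \<Rightarrow> bracket \<Rightarrow> bracket" where
  "badd (a, b) (c, d) = (a + c, b + d)"

text \<open>The cut at \<open>0\<close> keeps the lower end admissible for \<open>encl\<close>; it
  is sound because \<open>encl_sub\<close> forms differences with \<open>y \<le> x\<close>
  only.\<close>

fun bsub :: "bracket \<Rightarrow> bracket \<Rightarrow> bracket" where
  "bsub (a, b) (c, d) = (max 0 (a - d), b - c)"

fun bmul :: "bracket \<Rightarrow> bracket \<Rightarrow> bracket" where
  "bmul (a, b) (c, d) = (a * c div 1099511627776, b * d div 1099511627776 + 1)"

fun bscale :: "int \<Rightarrow> int \<Rightarrow> bracket \<Rightarrow> bracket" where
  "bscale m d (a, b) = (a * m div d, b * m div d + 1)"

definition bone :: "bracket" where
  "bone = (1099511627776, 1099511627776)"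

lemma encl_nonneg: "encl b x \<Longrightarrow> 0 \<le> x"
proof -
  assume "encl b x"
  then have "0 \<le> real_of_int (fst b)" "real_of_int (fst b) \<le> 2 ^ 40 * x" by (auto simp: encl_def)
  then have "0 \<le> 2 ^ 40 * x" by linarith
  then show ?thesis by simp
qed

lemma encl_one: "encl bone 1"
  by (simp add: encl_def bone_def)

lemma encl_add: "encl b x \<Longrightarrow> encl c y \<Longrightarrow> encl (badd b c) (x + y)"
  by (cases b; cases c) (simp add: encl_def algebra_simps)

lemma encl_sub: "encl b x \<Longrightarrow> encl c y \<Longrightarrow> y \<le> x \<Longrightarrow> encl (bsub b c) (x - y)"
  by (cases b; cases c) (auto simp: encl_def algebra_simps max_def)

lemma div_bounds:
  assumes "(0::int) < d"
  shows "real_of_int (n div d) \<le> real_of_int n / real_of_int d"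
    and "real_of_int n / real_of_int d \<le> real_of_int (n div d + 1)"
proof -
  have "real_of_int (n div d) = real_of_int \<lfloor>real_of_int n / real_of_int d\<rfloor>"
    by (simp add: floor_divide_of_int_eq)
  then show "real_of_int (n div d) \<le> real_of_int n / real_of_int d"
    "real_of_int n / real_of_int d \<le> real_of_int (n div d + 1)" by linarith+
qed

lemma encl_mul:
  assumes "encl b x" "encl c y"
  shows "encl (bmul b c) (x * y)"
proof -
  obtain b1 b2 c1 c2 where bc: "b = (b1, b2)" "c = (c1, c2)" by (cases b; cases c) auto
  have x: "0 \<le> b1" "real_of_int b1 \<le> 2 ^ 40 * x" "2 ^ 40 * x \<le> real_of_int b2" "0 \<le> x"
    and y: "0 \<le> c1" "real_of_int c1 \<le> 2 ^ 40 * y" "2 ^ 40 * y \<le> real_of_int c2" "0 \<le> y"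
    using assms encl_nonneg by (auto simp: encl_def bc)
  have e: "2 ^ 40 * (x * y) = (2 ^ 40 * x) * (2 ^ 40 * y) / real_of_int 1099511627776" by simp
  have "real_of_int (b1 * c1) / real_of_int 1099511627776 \<le> 2 ^ 40 * (x * y)"
    unfolding e of_int_mult using x y by (intro divide_right_mono mult_mono) auto
  moreover have "2 ^ 40 * (x * y) \<le> real_of_int (b2 * c2) / real_of_int 1099511627776"
    unfolding e of_int_mult using x y by (intro divide_right_mono mult_mono) auto
  moreover have "0 \<le> b1 * c1 div 1099511627776"
    using x y by (simp add: pos_imp_zdiv_nonneg_iff)
  ultimately show ?thesis
    using div_bounds [of 1099511627776 "b1 * c1"] div_bounds [of 1099511627776 "b2 * c2"]
    unfolding encl_def bc bmul.simps fst_conv snd_conv by (meson order_trans zero_less_numeral)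
qed

lemma encl_scale:
  assumes "encl b x" "0 \<le> m" "0 < d"
  shows "encl (bscale m d b) (real_of_int m / real_of_int d * x)"
proof -
  obtain b1 b2 where b: "b = (b1, b2)" by (cases b) auto
  have x: "0 \<le> b1" "real_of_int b1 \<le> 2 ^ 40 * x" "2 ^ 40 * x \<le> real_of_int b2"
    using assms(1) by (auto simp: encl_def b)
  have e: "2 ^ 40 * (real_of_int m / real_of_int d * x) = (2 ^ 40 * x) * real_of_int m / real_of_int d" by simp
  have "real_of_int (b1 * m) / real_of_int d \<le> 2 ^ 40 * (real_of_int m / real_of_int d * x)"
    unfolding e of_int_mult using x assms by (intro divide_right_mono mult_mono) auto
  moreover have "2 ^ 40 * (real_of_int m / real_of_int d * x) \<le> real_of_int (b2 * m) / real_of_int d"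
    unfolding e of_int_mult using x assms by (intro divide_right_mono mult_mono) auto
  moreover have "0 \<le> b1 * m div d"
    using x assms by (simp add: pos_imp_zdiv_nonneg_iff)
  ultimately show ?thesis
    using div_bounds [OF assms(3), of "b1 * m"] div_bounds [OF assms(3), of "b2 * m"]
    unfolding encl_def b bscale.simps fst_conv snd_conv by (meson order_trans)
qed

section \<open>Logarithms in integer arithmetic\<close>

fun atanh_lower :: "nat \<Rightarrow> int \<Rightarrow> int \<Rightarrow> int" where
  "atanh_lower 0 m w = 0"
| "atanh_lower (Suc n) m w =
     1099511627776 div (2 * m + 1) + w * atanh_lower n (m + 1) w div 1099511627776"

text \<open>The seed \<open>1 / m\<close> represents the remainder of the series as a last Horner
  coefficient; after nine levels from \<open>m = 0\<close> it is the \<open>1 / 9\<close> in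
  \<open>ln_series_bounds\<close>.\<close>

fun atanh_upper :: "nat \<Rightarrow> int \<Rightarrow> int \<Rightarrow> int" where
  "atanh_upper 0 m w = 1099511627776 div m + 1"
| "atanh_upper (Suc n) m w =
     1099511627776 div (2 * m + 1) + 1 + w * atanh_upper n (m + 1) w div 1099511627776 + 1"

lemma atanh_lower_le:
  assumes "0 \<le> w" "real_of_int w \<le> 2 ^ 40 * y" "0 \<le> m"
  shows "0 \<le> atanh_lower n m w \<and>
    real_of_int (atanh_lower n m w) \<le> 2 ^ 40 * (\<Sum>k<n. y ^ k / (2 * (real_of_int m + real k) + 1))"
  using assms(3)
proof (induction n arbitrary: m)
  case (Suc n)
  define a where "a = atanh_lower n (m + 1) w"
  define T where "T = (\<Sum>k<n. y ^ k / (2 * (real_of_int (m + 1) + real k) + 1))"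
  have a: "0 \<le> a" "real_of_int a \<le> 2 ^ 40 * T"
    using Suc.IH [of "m + 1"] Suc.prems by (simp_all add: a_def T_def)
  have "0 \<le> 2 ^ 40 * y" using assms(1,2) by linarith
  have "real_of_int (w * a div 1099511627776) \<le> real_of_int (w * a) / real_of_int 1099511627776"
    by (rule div_bounds) simp
  also have "\<dots> \<le> (2 ^ 40 * y) * (2 ^ 40 * T) / real_of_int 1099511627776"
    unfolding of_int_mult using assms a \<open>0 \<le> 2 ^ 40 * y\<close>
    by (intro divide_right_mono mult_mono) auto
  finally have 1: "real_of_int (w * a div 1099511627776) \<le> 2 ^ 40 * (y * T)" by (simp add: mult_ac)
  have 2: "real_of_int (1099511627776 div (2 * m + 1)) \<le> 2 ^ 40 * (1 / (2 * real_of_int m + 1))"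
    using div_bounds(1) [of "2 * m + 1" 1099511627776] Suc.prems by simp
  have "0 \<le> w * a div 1099511627776" "0 \<le> 1099511627776 div (2 * m + 1)"
    using a assms Suc.prems by (simp_all add: pos_imp_zdiv_nonneg_iff)
  moreover have eq: "(\<Sum>k<Suc n. y ^ k / (2 * (real_of_int m + real k) + 1)) = 1 / (2 * real_of_int m + 1) + y * T"
    unfolding T_def sum_distrib_left
    by (subst sum.lessThan_Suc_shift) (simp add: add_ac)
  ultimately show ?case
    using 1 2 unfolding eq atanh_lower.simps a_def [symmetric] by (simp add: algebra_simps)
qed simp

lemma atanh_upper_ge:
  assumes "0 \<le> y" "y \<le> 1 / 9" "2 ^ 40 * y \<le> real_of_int w" "0 \<le> m" "0 < m + int n"
  shows "2 ^ 40 * ((\<Sum>k<n. y ^ k / (2 * (real_of_int m + real k) + 1)) +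
      y ^ n / (real_of_int m + real n)) \<le> real_of_int (atanh_upper n m w)"
  using assms(4,5)
proof (induction n arbitrary: m)
  case 0
  then show ?case using div_bounds(2) [of m 1099511627776] by simp
next
  case (Suc n)
  define a where "a = atanh_upper n (m + 1) w"
  define T where "T = (\<Sum>k<n. y ^ k / (2 * (real_of_int (m + 1) + real k) + 1)) + y ^ n / (real_of_int (m + 1) + real n)"
  have a: "2 ^ 40 * T \<le> real_of_int a"
    using Suc.IH [of "m + 1"] Suc.prems by (simp add: a_def T_def)
  have T0: "0 \<le> T" unfolding T_def using assms(1) Suc.prems
    by (intro add_nonneg_nonneg sum_nonneg divide_nonneg_nonneg) auto
  have "2 ^ 40 * (y * T) = (2 ^ 40 * y) * (2 ^ 40 * T) / real_of_int 1099511627776" by simp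
  also have "\<dots> \<le> real_of_int (w * a) / real_of_int 1099511627776"
    unfolding of_int_mult using assms(1,3) a T0 by (intro divide_right_mono mult_mono) auto
  also have "\<dots> \<le> real_of_int (w * a div 1099511627776 + 1)"
    by (rule div_bounds) simp
  finally have 1: "2 ^ 40 * (y * T) \<le> real_of_int (w * a div 1099511627776 + 1)" .
  have 2: "2 ^ 40 * (1 / (2 * real_of_int m + 1)) \<le> real_of_int (1099511627776 div (2 * m + 1) + 1)"
    using div_bounds(2) [of "2 * m + 1" 1099511627776] Suc.prems by simp
  have eq: "(\<Sum>k<Suc n. y ^ k / (2 * (real_of_int m + real k) + 1)) + y ^ Suc n / (real_of_int m + real (Suc n))
      = 1 / (2 * real_of_int m + 1) + y * T"
    unfolding T_def distrib_left sum_distrib_left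
    by (subst sum.lessThan_Suc_shift) (simp add: add_ac)
  show ?case
    unfolding eq atanh_upper.simps a_def [symmetric] using 1 2 by (simp add: algebra_simps)
qed

text \<open>This is \<open>ln x = 2 artanh y\<close>. In the remainder, \<open>9\<close> takes the
  place of \<open>19 * (1 - y^2)\<close>, which is larger because
  \<open>y^2 \<le> 1 / 9\<close>.\<close>

lemma ln_series_bounds:
  assumes "1 < x" "x \<le> 2"
  defines "y \<equiv> (x - 1) / (x + 1)"
  shows "2 * y * (\<Sum>k<9. (y\<^sup>2) ^ k / (2 * real k + 1)) \<le> ln x"
    and "ln x \<le> 2 * y * ((\<Sum>k<9. (y\<^sup>2) ^ k / (2 * real k + 1)) + (y\<^sup>2) ^ 9 / 9)"
    and "0 \<le> y" "y\<^sup>2 \<le> 1 / 9"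
proof -
  show y: "0 \<le> y" using assms by (simp add: y_def)
  have y3: "y \<le> 1 / 3" using assms by (simp add: y_def field_simps)
  then have "y\<^sup>2 \<le> (1 / 3)\<^sup>2" using y by (intro power_mono)
  then show y2: "y\<^sup>2 \<le> 1 / 9" by (simp add: power2_eq_square)
  have s: "(\<Sum>k<9. 2 * y ^ (2 * k + 1) / real (2 * k + 1)) = 2 * y * (\<Sum>k<9. (y\<^sup>2) ^ k / (2 * real k + 1))"
    unfolding sum_distrib_left by (intro sum.cong) (auto simp: power_mult [symmetric] add.commute mult_ac)
  note b = ln_approx_bounds [OF assms(1), of 9, folded y_def, unfolded s]
  show "2 * y * (\<Sum>k<9. (y\<^sup>2) ^ k / (2 * real k + 1)) \<le> ln x" using b by simp
  have "2 * (y ^ (2 * 9 + 1) / (1 - y\<^sup>2) / real (2 * 9 + 1)) = 2 * y * (y\<^sup>2) ^ 9 / ((1 - y\<^sup>2) * 19)"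
    by (simp add: power_mult [symmetric] power_Suc [symmetric] del: power_Suc)
  also have "\<dots> \<le> 2 * y * (y\<^sup>2) ^ 9 / 9"
    using y y2 by (intro divide_left_mono mult_nonneg_nonneg) auto
  finally show "ln x \<le> 2 * y * ((\<Sum>k<9. (y\<^sup>2) ^ k / (2 * real k + 1)) + (y\<^sup>2) ^ 9 / 9)"
    using b by (simp add: algebra_simps)
qed

lemma ln2_bounds: "762123384785 \<le> 2 ^ 40 * ln (2::real)" "2 ^ 40 * ln (2::real) \<le> 762123384787"
proof -
  have "(\<lambda>x. x) (ln (2::real)) \<in> {762123384785 / 2 ^ 40..762123384787 / 2 ^ 40}"
    using ln_approx_bounds [of 2 12] by (simp add: eval_nat_numeral)
  then show "762123384785 \<le> 2 ^ 40 * ln (2::real)" "2 ^ 40 * ln (2::real) \<le> 762123384787"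
    by (simp_all add: field_simps)
qed

text \<open>Where the series does not apply, \<open>ln_lower\<close> returns \<open>0\<close> and
  \<open>ln_upper\<close> returns \<open>u\<close> itself. These are sound since
  \<open>0 \<le> ln x \<le> x\<close> for \<open>x \<ge> 1\<close>, so no range conditions have to
  be carried along.\<close>

definition ln_lower :: "int \<Rightarrow> int" where
  "ln_lower l = (if l \<le> 1099511627776 \<or> 2199023255552 < l then 0 else
     let w = (l - 1099511627776) * 1099511627776 div (l + 1099511627776)
     in 2 * w * atanh_lower 9 0 (w * w div 1099511627776) div 1099511627776)"

definition ln_upper :: "int \<Rightarrow> int" where
  "ln_upper u = (if 2199023255552 < u then u else
     let w = (u - 1099511627776) * 1099511627776 div (u + 1099511627776) + 1
     in 2 * w * atanh_upper 9 0 (w * w div 1099511627776 + 1) div 1099511627776 + 1)"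

lemma ln_lower_le:
  assumes "real_of_int l \<le> 2 ^ 40 * x" "1 \<le> x"
  shows "0 \<le> ln_lower l" "real_of_int (ln_lower l) \<le> 2 ^ 40 * ln x"
proof -
  define w where "w = (l - 1099511627776) * 1099511627776 div (l + 1099511627776)"
  define v where "v = w * w div 1099511627776"
  have main: "0 \<le> ln_lower l \<and> real_of_int (ln_lower l) \<le> 2 ^ 40 * ln x"
    if l: "1099511627776 < l" and l2: "l \<le> 2199023255552"
  proof -
    define z where "z = real_of_int l / 2 ^ 40"
    define y where "y = (z - 1) / (z + 1)"
    have z: "1 < z" using l by (simp add: z_def)
    have y0: "0 \<le> y" using z by (simp add: y_def)
    have "real_of_int w \<le> real_of_int ((l - 1099511627776) * 1099511627776) / real_of_int (l + 1099511627776)"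
      unfolding w_def using l by (intro div_bounds) simp
    also have "\<dots> = 2 ^ 40 * y" using l by (simp add: y_def z_def field_simps)
    finally have w: "real_of_int w \<le> 2 ^ 40 * y" .
    have w0: "0 \<le> w" unfolding w_def using l by (simp add: pos_imp_zdiv_nonneg_iff)
    have "real_of_int v \<le> real_of_int (w * w) / real_of_int 1099511627776"
      unfolding v_def by (rule div_bounds) simp
    also have "\<dots> \<le> (2 ^ 40 * y) * (2 ^ 40 * y) / real_of_int 1099511627776"
      unfolding of_int_mult using w w0 y0 by (intro divide_right_mono mult_mono) auto
    finally have v: "real_of_int v \<le> 2 ^ 40 * y\<^sup>2" by (simp add: power2_eq_square)
    have v0: "0 \<le> v" unfolding v_def using w0 by (simp add: pos_imp_zdiv_nonneg_iff)
    define T where "T = (\<Sum>k<9. (y\<^sup>2) ^ k / (2 * real k + 1))"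
    have a: "0 \<le> atanh_lower 9 0 v" "real_of_int (atanh_lower 9 0 v) \<le> 2 ^ 40 * T"
      using atanh_lower_le [OF v0 v, of 0 9] by (simp_all add: T_def)
    have eq: "ln_lower l = 2 * w * atanh_lower 9 0 v div 1099511627776"
      using l l2 unfolding ln_lower_def w_def v_def Let_def by (subst if_not_P) auto
    have "real_of_int (ln_lower l) \<le> 2 ^ 40 * ln x"
    proof -
      have z2: "z \<le> 2" using l2 by (simp add: z_def)
      have "real_of_int (ln_lower l) \<le> real_of_int (2 * w * atanh_lower 9 0 v) / real_of_int 1099511627776"
        unfolding eq by (rule div_bounds) simp
      also have "\<dots> \<le> (2 * (2 ^ 40 * y)) * (2 ^ 40 * T) / real_of_int 1099511627776"
        unfolding of_int_mult using w w0 a y0 by (intro divide_right_mono mult_mono) auto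
      also have "\<dots> = 2 ^ 40 * (2 * y * T)" by simp
      also have "\<dots> \<le> 2 ^ 40 * ln z"
        using ln_series_bounds(1) [OF z z2] by (simp add: T_def y_def)
      also have "ln z \<le> ln x"
        using z assms by (simp add: z_def field_simps)
      finally show ?thesis by simp
    qed
    moreover have "0 \<le> ln_lower l"
      unfolding eq using w0 a by (simp add: pos_imp_zdiv_nonneg_iff)
    ultimately show ?thesis by blast
  qed
  have "0 \<le> ln_lower l \<and> real_of_int (ln_lower l) \<le> 2 ^ 40 * ln x"
  proof (cases "l \<le> 1099511627776 \<or> 2199023255552 < l")
    case True
    then show ?thesis using assms(2) by (auto simp: ln_lower_def)
  qed (use main in auto)
  then show "0 \<le> ln_lower l" "real_of_int (ln_lower l) \<le> 2 ^ 40 * ln x"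
    by auto
qed

lemma ln_upper_ge:
  assumes "2 ^ 40 * x \<le> real_of_int u" "1 \<le> x"
  shows "2 ^ 40 * ln x \<le> real_of_int (ln_upper u)"
proof (cases "2199023255552 < u")
  case True
  have "ln x \<le> x" using ln_le_minus_one [of x] assms by simp
  then show ?thesis using True assms by (simp add: ln_upper_def)
next
  case False
  define w where "w = (u - 1099511627776) * 1099511627776 div (u + 1099511627776) + 1"
  define v where "v = w * w div 1099511627776 + 1"
  define z where "z = real_of_int u / 2 ^ 40"
  define y where "y = (z - 1) / (z + 1)"
  have xz: "x \<le> z" using assms by (simp add: z_def field_simps)
  have z: "1 \<le> z" "z \<le> 2" using False xz assms by (simp_all add: z_def)
  have u0: "0 < u" using z(1) by (simp add: z_def)
  have y0: "0 \<le> y" using z by (simp add: y_def)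
  have "2 ^ 40 * y = real_of_int ((u - 1099511627776) * 1099511627776) / real_of_int (u + 1099511627776)"
    using u0 by (simp add: y_def z_def field_simps)
  also have "\<dots> \<le> real_of_int w"
    unfolding w_def using u0 by (intro div_bounds) simp
  finally have w: "2 ^ 40 * y \<le> real_of_int w" .
  then have w0: "0 \<le> real_of_int w" using y0 by (meson order_trans mult_nonneg_nonneg zero_le_numeral zero_le_power)
  have "2 ^ 40 * y\<^sup>2 = (2 ^ 40 * y) * (2 ^ 40 * y) / real_of_int 1099511627776"
    by (simp add: power2_eq_square)
  also have "\<dots> \<le> real_of_int (w * w) / real_of_int 1099511627776"
    unfolding of_int_mult using w w0 y0 by (intro divide_right_mono mult_mono) auto
  also have "\<dots> \<le> real_of_int v"
    unfolding v_def by (rule div_bounds) simp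
  finally have v: "2 ^ 40 * y\<^sup>2 \<le> real_of_int v" .
  define T where "T = (\<Sum>k<9. (y\<^sup>2) ^ k / (2 * real k + 1)) + (y\<^sup>2) ^ 9 / 9"
  have T0: "0 \<le> T" unfolding T_def by (intro add_nonneg_nonneg sum_nonneg) auto
  have eq: "ln_upper u = 2 * w * atanh_upper 9 0 v div 1099511627776 + 1"
    using False unfolding ln_upper_def w_def v_def Let_def by (subst if_not_P) auto
  have lnz: "ln z \<le> 2 * y * T \<and> y\<^sup>2 \<le> 1 / 9"
  proof (cases "z = 1")
    case True
    then show ?thesis by (simp add: y_def)
  next
    case False
    then show ?thesis using ln_series_bounds [of z] z by (simp add: T_def y_def)
  qed
  have a: "2 ^ 40 * T \<le> real_of_int (atanh_upper 9 0 v)"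
    using atanh_upper_ge [of "y\<^sup>2" v 0 9] lnz v by (simp add: T_def)
  have "ln x \<le> ln z" using xz assms by simp
  then have "2 ^ 40 * ln x \<le> 2 ^ 40 * (2 * y * T)" using lnz by (intro mult_left_mono) auto
  also have "\<dots> = (2 * (2 ^ 40 * y)) * (2 ^ 40 * T) / real_of_int 1099511627776" by simp
  also have "\<dots> \<le> real_of_int (2 * w * atanh_upper 9 0 v) / real_of_int 1099511627776"
    unfolding of_int_mult using w w0 a y0 T0 by (intro divide_right_mono mult_mono) auto
  also have "\<dots> \<le> real_of_int (ln_upper u)"
    unfolding eq by (rule div_bounds) simp
  finally show ?thesis .
qed

text \<open>Division by \<open>2 ^ b\<close> moves large values, as they occur near the pole, into
  the range of the series. For an unsuitable \<open>b\<close> the trivial bounds \<open>0\<close>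
  and \<open>x\<close> are returned, so soundness does not depend on the exponents stored in the
  rows.\<close>

definition bln :: "nat \<Rightarrow> bracket \<Rightarrow> bracket" where
  "bln b z = (if b = 0 \<or> 1099511627776 \<le> fst z div 2 ^ b
     then (ln_lower (fst z div 2 ^ b) + int b * 762123384785,
       ln_upper (snd z div 2 ^ b + 1) + int b * 762123384787)
     else (0, snd z))"

lemma encl_ln:
  assumes "encl z x" "1 \<le> x"
  shows "encl (bln b z) (ln x)"
proof (cases "b = 0 \<or> 1099511627776 \<le> fst z div 2 ^ b")
  case True
  define y where "y = x / 2 ^ b"
  have z: "0 \<le> fst z" "real_of_int (fst z) \<le> 2 ^ 40 * x" "2 ^ 40 * x \<le> real_of_int (snd z)"
    using assms by (auto simp: encl_def)
  have lo: "real_of_int (fst z div 2 ^ b) \<le> 2 ^ 40 * y"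
  proof -
    have "real_of_int (fst z) / 2 ^ b \<le> 2 ^ 40 * x / 2 ^ b" using z(2) by (intro divide_right_mono) auto
    then show ?thesis using div_bounds(1) [of "2 ^ b" "fst z"] by (simp add: y_def)
  qed
  have up: "2 ^ 40 * y \<le> real_of_int (snd z div 2 ^ b + 1)"
  proof -
    have "2 ^ 40 * x / 2 ^ b \<le> real_of_int (snd z) / 2 ^ b" using z(3) by (intro divide_right_mono) auto
    then show ?thesis using div_bounds(2) [of "2 ^ b" "snd z"] by (simp add: y_def)
  qed
  have y1: "1 \<le> y"
    using True
  proof
    assume "1099511627776 \<le> fst z div 2 ^ b"
    then have "real_of_int 1099511627776 \<le> real_of_int (fst z div 2 ^ b)" by (simp only: of_int_le_iff)
    with lo show ?thesis by simp
  qed (use assms y_def in simp)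
  have "ln x = ln y + real b * ln 2"
    using assms by (simp add: y_def ln_div ln_realpow)
  moreover have "real b * (762123384785 / 2 ^ 40) \<le> real b * ln 2" "real b * ln 2 \<le> real b * (762123384787 / 2 ^ 40)"
    using ln2_bounds by (intro mult_left_mono; simp)+
  ultimately show ?thesis
    using ln_lower_le [OF lo y1] ln_upper_ge [OF up y1] True
    by (simp add: bln_def encl_def algebra_simps)
next
  case False
  have "ln x \<le> x" using ln_le_minus_one [of x] assms by simp
  then show ?thesis
    using False assms by (auto simp: bln_def encl_def)
qed

text \<open>Euler-Maclaurin at \<open>N = 8\<close> for \<open>s = j (a + d) / d\<close>, with
  \<open>q\<close> enclosing \<open>8 powr - s\<close> and an integer \<open>M \<ge> s\<close> in
  the error term. Here \<open>96 = 8 * 12\<close> and \<open>2949120 = 720 * 8^4\<close>;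
  subtracting a bracket that starts at \<open>0\<close> lets the error lower the lower end
  only.\<close>

definition bzeta :: "int \<Rightarrow> int \<Rightarrow> int \<Rightarrow> bracket \<Rightarrow> bracket \<Rightarrow> bracket \<Rightarrow> bracket \<Rightarrow> bracket \<Rightarrow> bracket
    \<Rightarrow> bracket \<Rightarrow> int \<Rightarrow> bracket" where
  "bzeta a d j b2 b3 b4 b5 b6 b7 q M =
    bsub (badd (badd (badd (badd (badd (badd (badd (badd (badd bone b2) b3) b4) b5) b6) b7)
       (bscale (8 * d) (j * (a + d) - d) q)) (bscale 1 2 q)) (bscale (j * (a + d)) (96 * d) q))
     (0, snd (bscale (M * (M + 1) * (M + 2) * (M + 3) + 8 * M * (M + 1) * (M + 2)) 2949120 q))"

definition bcoprime :: "bracket \<Rightarrow> bracket \<Rightarrow> bracket \<Rightarrow> bracket \<Rightarrow> bracket \<Rightarrow> bracket" where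
  "bcoprime z b2 b3 b5 b7 =
     bmul (bmul (bmul (bmul z (bsub bone b2)) (bsub bone b3)) (bsub bone b5)) (bsub bone b7)"

definition bzB_aux where
  "bzB_aux a d j b2 b3 b4 b5 b7 =
     bcoprime (bzeta a d j b2 b3 b4 b5 (bmul b2 b3) b7 (bmul b2 b4) (j * (a + d) div d + 1)) b2 b3 b5 b7"

definition bzB where
  "bzB a d j b2 b3 b5 b7 = bzB_aux a d j b2 b3 (bmul b2 b2) b5 b7"

lemma encl_zeta:
  assumes s: "1 < s" "s = real_of_int (j * (a + d)) / real_of_int d" and d: "0 < d"
    and b: "encl b2 (2 powr - s)" "encl b3 (3 powr - s)" "encl b4 (4 powr - s)" "encl b5 (5 powr - s)"
      "encl b6 (6 powr - s)" "encl b7 (7 powr - s)" "encl q (8 powr - s)" and M: "s \<le> real_of_int M"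
  shows "encl (bzeta a d j b2 b3 b4 b5 b6 b7 q M) (zeta s)"
proof -
  define Q where "Q = 8 powr - s"
  have Q0: "0 < Q" by (simp add: Q_def)
  have e1: "8 powr (1 - s) = 8 * Q" "8 powr (- s - 1) = Q / 8" "8 powr (- s - 3) = Q / 512" "8 powr (- s - 4) = Q / 4096"
    by (simp_all add: Q_def powr_diff powr_minus_divide)
  have sd: "s * real_of_int d = real_of_int (j * (a + d))"
    using s(2) d by simp
  have sd1: "(s - 1) * real_of_int d = real_of_int (j * (a + d) - d)"
    using sd by (simp add: algebra_simps)
  have pos: "0 < j * (a + d)" "0 < j * (a + d) - d"
  proof -
    have "0 < (s - 1) * real_of_int d" "0 < s * real_of_int d" using s(1) d by simp_all
    then show "0 < j * (a + d)" "0 < j * (a + d) - d" unfolding sd sd1 of_int_0_less_iff by auto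
  qed
  have q1: "encl (bscale (8 * d) (j * (a + d) - d) q) (8 * Q / (s - 1))"
  proof -
    have "encl (bscale (8 * d) (j * (a + d) - d) q) (real_of_int (8 * d) / real_of_int (j * (a + d) - d) * Q)"
      unfolding Q_def using pos d b by (intro encl_scale) auto
    also have "real_of_int (8 * d) / real_of_int (j * (a + d) - d) * Q = 8 * Q / (s - 1)"
      unfolding sd1 [symmetric] using s d by simp
    finally show ?thesis .
  qed
  have q2: "encl (bscale 1 2 q) (Q / 2)"
    using encl_scale [OF b(7), of 1 2] by (simp add: Q_def)
  have q3: "encl (bscale (j * (a + d)) (96 * d) q) (s * (Q / 8) / 12)"
    using encl_scale [OF b(7), of "j * (a + d)" "96 * d"] pos d by (simp add: Q_def s(2))
  define E where "E = M * (M + 1) * (M + 2) * (M + 3) + 8 * M * (M + 1) * (M + 2)"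
  have M0: "0 < M" using M s(1) by linarith
  have q4: "encl (bscale E 2949120 q) (real_of_int E / 2949120 * Q)"
    using encl_scale [OF b(7), of E 2949120] M0 by (simp add: Q_def E_def)
  have err: "em_err s 8 \<le> real_of_int E / 2949120 * Q"
  proof -
    have "em_err s 8 = (s * (s + 1) * (s + 2) * (s + 3) + 8 * s * (s + 1) * (s + 2)) / 2949120 * Q"
      by (simp add: em_err_def e1 field_simps)
    also have "\<dots> \<le> (real_of_int M * (real_of_int M + 1) * (real_of_int M + 2) * (real_of_int M + 3)
        + 8 * real_of_int M * (real_of_int M + 1) * (real_of_int M + 2)) / 2949120 * Q"
      using s(1) M Q0 by (intro mult_right_mono divide_right_mono add_mono mult_mono) auto
    finally show ?thesis by (simp add: E_def)
  qed
  define m where "m = 1 + 2 powr - s + 3 powr - s + 4 powr - s + 5 powr - s + 6 powr - s + 7 powr - s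
    + 8 * Q / (s - 1) + Q / 2 + s * (Q / 8) / 12"
  have "(\<Sum>n=1..<8. real n powr - s) = 1 + 2 powr - s + 3 powr - s + 4 powr - s + 5 powr - s + 6 powr - s + 7 powr - s"
    by (simp add: eval_nat_numeral)
  then have m: "(\<Sum>n=1..<8. real n powr - s) + em_main s (real 8) = m"
    by (simp add: em_main_def m_def e1 Q_def [symmetric])
  have z: "zeta s \<le> m" "m - em_err s 8 \<le> zeta s"
    using zeta_em [OF s(1), of 8] m by simp_all
  have "encl (0, snd (bscale E 2949120 q)) (m - zeta s)"
  proof -
    have "m - zeta s \<le> real_of_int E / 2949120 * Q" using z err by linarith
    then have "2 ^ 40 * (m - zeta s) \<le> 2 ^ 40 * (real_of_int E / 2949120 * Q)" by (intro mult_left_mono) auto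
    also have "\<dots> \<le> real_of_int (snd (bscale E 2949120 q))" using q4 by (simp only: encl_def)
    finally show ?thesis using z(1) by (simp add: encl_def)
  qed
  moreover have "m - zeta s \<le> m" using zeta_ge_1 [OF s(1)] by simp
  moreover have "encl (badd (badd (badd (badd (badd (badd (badd (badd (badd bone b2) b3) b4) b5) b6) b7)
       (bscale (8 * d) (j * (a + d) - d) q)) (bscale 1 2 q)) (bscale (j * (a + d)) (96 * d) q)) m"
    unfolding m_def by (intro encl_add encl_one b q1 q2 q3)
  ultimately have "encl (bzeta a d j b2 b3 b4 b5 b6 b7 q M) (m - (m - zeta s))"
    unfolding bzeta_def E_def [symmetric] by (intro encl_sub)
  then show ?thesis by simp
qed

lemma encl_zB:
  assumes s: "1 < s" "s = real_of_int (j * (a + d)) / real_of_int d" and d: "0 < d"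
    and b: "encl b2 (2 powr - s)" "encl b3 (3 powr - s)" "encl b5 (5 powr - s)" "encl b7 (7 powr - s)"
  shows "encl (bzB a d j b2 b3 b5 b7) (zB s)"
proof -
  have m: "encl (bmul b c) ((x * y) powr - s)" if "encl b (x powr - s)" "encl c (y powr - s)" "0 < x" "0 < y" for b c x y
    using encl_mul [OF that(1,2)] that(3,4) by (simp add: powr_mult)
  have b4: "encl (bmul b2 b2) (4 powr - s)" using m [OF b(1) b(1)] by simp
  have b6: "encl (bmul b2 b3) (6 powr - s)" using m [OF b(1) b(2)] by simp
  have q: "encl (bmul b2 (bmul b2 b2)) (8 powr - s)" using m [OF b(1) b4] by simp
  have le: "x powr - s \<le> 1" if "x \<ge> 1" for x
    using that s(1) powr_mono [of "- s" 0 x] by simp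
  have "s \<le> real_of_int (j * (a + d) div d + 1)"
    using div_bounds(2) [OF d, of "j * (a + d)"] s(2) by simp
  then show ?thesis
    unfolding bzB_def bzB_aux_def bcoprime_def zB_def
    by (intro encl_mul encl_sub encl_one encl_zeta [OF s d] b b4 b6 q le) auto
qed

section \<open>Prime zeta values from zeta values\<close>

fun bpows :: "nat \<Rightarrow> bracket \<Rightarrow> bracket \<Rightarrow> bracket list" where
  "bpows 0 v w = []"
| "bpows (Suc n) v w = w # bpows n v (bmul v w)"

lemma length_bpows [simp]: "length (bpows n v w) = n"
  by (induction n arbitrary: w) auto

lemma encl_bpows:
  assumes "encl v x" "encl w y" "k < n"
  shows "encl (bpows n v w ! k) (x ^ k * y)"
  using assms(2,3)
proof (induction n arbitrary: k w y)
  case (Suc n)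
  show ?case
  proof (cases k)
    case (Suc i)
    then have "encl (bpows n v (bmul v w) ! i) (x ^ i * (x * y))"
      using Suc.prems assms(1) by (intro Suc.IH encl_mul) auto
    then show ?thesis using Suc by (simp add: mult_ac)
  qed (use Suc.prems in simp)
qed simp

definition bppow :: "int \<Rightarrow> bracket \<Rightarrow> bracket list" where
  "bppow p c = bpows 8 (bscale 1 p c) (bscale 1 p c)"

lemma encl_bppow:
  assumes "encl c (real_of_int p powr - t)" "0 < p" "k < 8"
  shows "encl (bppow p c ! k) (real_of_int p powr - (real (Suc k) * (1 + t)))"
proof -
  define x where "x = real_of_int p powr - (1 + t)"
  have "encl (bscale 1 p c) (real_of_int 1 / real_of_int p * real_of_int p powr - t)"
    using assms by (intro encl_scale) auto
  also have "real_of_int 1 / real_of_int p * real_of_int p powr - t = x"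
    using assms(2) by (simp add: x_def powr_diff powr_minus_divide powr_add)
  finally have "encl (bppow p c ! k) (x ^ k * x)"
    unfolding bppow_def using assms(3) by (intro encl_bpows)
  also have "x ^ k * x = x ^ Suc k" by simp
  also have "\<dots> = real_of_int p powr - (real (Suc k) * (1 + t))"
    using assms(2) unfolding x_def by (subst powr_power) (auto simp: algebra_simps)
  finally show ?thesis .
qed

definition blnzB where
  "blnzB a d k b P2 P3 P5 P7 = bln b (bzB a d (int k + 1) (P2 ! k) (P3 ! k) (P5 ! k) (P7 ! k))"

text \<open>Inversion of \<open>ln (zB s) = \<Sum>\<^sub>j PB (j s) / j\<close>. The number \<open>2748780\<close> bounds
  \<open>2\<^sup>4\<^sup>0\<close> times the truncation error \<open>2.5 * 10\<^sup>-\<^sup>6\<close> of \<open>ln_zB_remainder\<close>, and the last four entries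
  bound \<open>2\<^sup>4\<^sup>0 PB j\<close> for \<open>j = 5, \<dots>, 8\<close>.\<close>

definition bres_fin :: "bracket \<Rightarrow> bracket \<Rightarrow> bracket \<Rightarrow> bracket \<Rightarrow> bracket list" where
  "bres_fin L1 B2 B3 B4 = [bsub (bsub (bsub (bsub L1 (bscale 1 2 B2)) (bscale 1 3 B3)) (bscale 1 4 B4)) (0, 2748780),
     B2, B3, B4, (0, 12094629), (0, 1099512), (0, 99956), (0, 9087)]"

definition bres_mid where
  "bres_mid L1 L2 B3 B4 = bres_fin L1 (bsub (bsub L2 (bscale 1 2 B4)) (0, 2748780)) B3 B4"

definition bres where
  "bres L1 L2 L3 L4 = bres_mid L1 L2 (bsub L3 (0, 2748780)) (bsub L4 (0, 2748780))"

definition bpz_list where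
  "bpz_list a d b P2 P3 P5 P7 =
     map2 badd (map2 badd (map2 badd (map2 badd P2 P3) P5) P7)
       (bres (if a = 0 then (0, 0) else blnzB a d 0 b P2 P3 P5 P7) (blnzB a d 1 0 P2 P3 P5 P7)
         (blnzB a d 2 0 P2 P3 P5 P7) (blnzB a d 3 0 P2 P3 P5 P7))"

definition bpz where
  "bpz a d b c2 c3 c5 c7 = bpz_list a d b (bppow 2 c2) (bppow 3 c3) (bppow 5 c5) (bppow 7 c7)"

lemma zB_ge_1: "1 < s \<Longrightarrow> 1 \<le> zB s"
proof -
  assume s: "1 < s"
  have "0 \<le> ln (zB s)"
    using sums_le [OF _ sums_zero ln_zB_sums [OF s]] PB_nonneg by simp
  then show ?thesis using zB_pos [OF s] by simp
qed

lemma encl_eps: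
  assumes "0 \<le> r" "r \<le> 25 / 10000000"
  shows "encl (0, 2748780) r"
  using assms by (simp add: encl_def)

text \<open>The case \<open>a = 0\<close> is the pole \<open>s = 1\<close>. There the entry of index
  \<open>0\<close> is a dummy, excluded by the last hypothesis, while the other entries enclose the
  limits \<open>pzeta j\<close> with \<open>j \<ge> 2\<close>. The logarithms are solved backwards:
  \<open>PB (4 s)\<close> and \<open>PB (3 s)\<close> from one logarithm each, then
  \<open>PB (2 s)\<close>, and finally \<open>PB s\<close>.\<close>

lemma encl_bpz:
  assumes t: "t = real_of_int a / real_of_int d" "0 \<le> a" "0 < d"
    and c: "encl c2 (2 powr - t)" "encl c3 (3 powr - t)" "encl c5 (5 powr - t)" "encl c7 (7 powr - t)"
    and k: "k < 8" "0 < a \<or> 1 \<le> k"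
  shows "encl (bpz a d b c2 c3 c5 c7 ! k) (pzeta (real (Suc k) * (1 + t)))"
proof -
  define s where "s = 1 + t"
  have s1: "1 \<le> s" using t by (simp add: s_def)
  have s1': "1 < s" if "0 < a" using t that by (simp add: s_def)
  have gt: "1 < real (Suc k) * s" if "0 < a \<or> 1 \<le> k" for k
  proof (cases "1 \<le> k")
    case True
    then have "1 < real (Suc k) * 1" by simp
    also have "\<dots> \<le> real (Suc k) * s" using s1 by (intro mult_left_mono) auto
    finally show ?thesis .
  next
    case False
    then have "k = 0" by simp
    then show ?thesis using that s1' by simp
  qed
  define P2 P3 P5 P7 where P: "P2 = bppow 2 c2" "P3 = bppow 3 c3" "P5 = bppow 5 c5" "P7 = bppow 7 c7"
  have e: "encl (P2 ! k) (2 powr - (real (Suc k) * s))" "encl (P3 ! k) (3 powr - (real (Suc k) * s))"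
    "encl (P5 ! k) (5 powr - (real (Suc k) * s))" "encl (P7 ! k) (7 powr - (real (Suc k) * s))" if "k < 8" for k
    using encl_bppow [of c2 2 t k] encl_bppow [of c3 3 t k] encl_bppow [of c5 5 t k] encl_bppow [of c7 7 t k] c that
    by (simp_all add: P s_def)
  have len: "length P2 = 8" "length P3 = 8" "length P5 = 8" "length P7 = 8"
    by (simp_all add: P bppow_def)
  have L: "encl (blnzB a d k b P2 P3 P5 P7) (ln (zB (real (Suc k) * s)))"
    if "k < 8" "0 < a \<or> 1 \<le> k" for k b
    unfolding blnzB_def
  proof (intro encl_ln encl_zB)
    show "real (Suc k) * s = real_of_int ((int k + 1) * (a + d)) / real_of_int d"
      using t by (simp add: s_def field_simps)
  qed (use e gt that t zB_ge_1 in auto)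
  define L1 where "L1 = (if a = 0 then (0, 0) else blnzB a d 0 b P2 P3 P5 P7)"
  define B4 where "B4 = bsub (blnzB a d 3 0 P2 P3 P5 P7) (0, 2748780)"
  define B3 where "B3 = bsub (blnzB a d 2 0 P2 P3 P5 P7) (0, 2748780)"
  define B2 where "B2 = bsub (bsub (blnzB a d 1 0 P2 P3 P5 P7) (bscale 1 2 B4)) (0, 2748780)"
  define R where "R = bres_fin L1 B2 B3 B4"
  have powr11: "11 powr (5 - x) \<le> 1 / 11" if "6 \<le> x" for x :: real
    using powr_mono [of "5 - x" "-1" 11] that by (simp add: powr_minus_divide)
  have B: "encl B4 (PB (4 * s))" "encl B3 (PB (3 * s))" "encl B2 (PB (2 * s))"
  proof -
    define r4 where "r4 = ln (zB (4 * s)) - PB (4 * s)"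
    have "0 \<le> r4" "r4 \<le> 25 / 10000000"
      using ln_zB_remainder [of "4 * s" 1] s1 powr11 [of "2 * (4 * s)"] by (simp_all add: r4_def)
    then have "encl B4 (ln (zB (4 * s)) - r4)"
      unfolding B4_def using L [of 3 0] PB_nonneg [of "4 * s"] by (intro encl_sub encl_eps) (simp_all add: r4_def)
    then show b4: "encl B4 (PB (4 * s))" by (simp add: r4_def)
    define r3 where "r3 = ln (zB (3 * s)) - PB (3 * s)"
    have "0 \<le> r3" "r3 \<le> 25 / 10000000"
      using ln_zB_remainder [of "3 * s" 1] s1 powr11 [of "2 * (3 * s)"] by (simp_all add: r3_def)
    then have "encl B3 (ln (zB (3 * s)) - r3)"
      unfolding B3_def using L [of 2 0] PB_nonneg [of "3 * s"] by (intro encl_sub encl_eps) (simp_all add: r3_def)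
    then show "encl B3 (PB (3 * s))" by (simp add: r3_def)
    define r2 where "r2 = ln (zB (2 * s)) - 1 / 2 * PB (4 * s) - PB (2 * s)"
    have r2: "0 \<le> r2" "r2 \<le> 25 / 10000000"
      using ln_zB_remainder [of "2 * s" 2] s1 powr11 [of "3 * (2 * s)"]
      by (simp_all add: r2_def eval_nat_numeral)
    have "encl (bscale 1 2 B4) (1 / 2 * PB (4 * s))" using encl_scale [OF b4, of 1 2] by simp
    then have "encl B2 (ln (zB (2 * s)) - 1 / 2 * PB (4 * s) - r2)"
      unfolding B2_def using L [of 1 0] r2 PB_nonneg [of "2 * s"]
      by (intro encl_sub encl_eps) (simp_all add: r2_def)
    then show "encl B2 (PB (2 * s))" by (simp add: r2_def)
  qed
  have B1: "encl (R ! 0) (PB s)" if "0 < a"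
  proof -
    define r1 where "r1 = ln (zB s) - 1 / 2 * PB (2 * s) - 1 / 3 * PB (3 * s) - 1 / 4 * PB (4 * s) - PB s"
    have "11 powr (5 - 5 * s) \<le> 1"
      using powr_mono [of "5 - 5 * s" 0 11] s1 by simp
    then have r1: "0 \<le> r1" "r1 \<le> 25 / 10000000"
      using ln_zB_remainder [of s 4] s1' [OF that] by (simp_all add: r1_def eval_nat_numeral)
    have sc: "encl (bscale 1 2 B2) (1 / 2 * PB (2 * s))" "encl (bscale 1 3 B3) (1 / 3 * PB (3 * s))"
        "encl (bscale 1 4 B4) (1 / 4 * PB (4 * s))"
      using encl_scale [OF B(3), of 1 2] encl_scale [OF B(2), of 1 3] encl_scale [OF B(1), of 1 4] by simp_all
    have "encl (R ! 0) (ln (zB s) - 1 / 2 * PB (2 * s) - 1 / 3 * PB (3 * s) - 1 / 4 * PB (4 * s) - r1)"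
      unfolding R_def bres_fin_def L1_def nth_Cons_0
      using L [of 0 b] that sc r1 PB_nonneg [of s] PB_nonneg [of "2 * s"] PB_nonneg [of "3 * s"] PB_nonneg [of "4 * s"]
      by (intro encl_sub encl_eps) (simp_all add: r1_def)
    then show ?thesis by (simp add: r1_def)
  qed
  have tail: "encl (0, u) (PB (real n * s))" if "n \<ge> 5" "2 ^ 40 * (11 / 1000000) / 11 ^ (n - 5) \<le> real_of_int u" for n u
  proof -
    have ns: "real n * 1 \<le> real n * s" using s1 by (intro mult_left_mono) auto
    have n5: "5 \<le> real n" using that(1) by simp
    have "PB (real n * s) \<le> 11 / 1000000 * 11 powr (5 - real n * s)"
      using ns n5 by (intro PB_le) linarith
    also have "\<dots> \<le> 11 / 1000000 * 11 powr (- real (n - 5))"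
      using ns that(1) by (intro mult_left_mono powr_mono) (auto simp: of_nat_diff)
    also have "11 powr (- real (n - 5)) = 1 / (11 :: real) ^ (n - 5)"
      by (simp add: powr_minus_divide powr_realpow)
    finally have "2 ^ 40 * PB (real n * s) \<le> 2 ^ 40 * (11 / 1000000 * (1 / 11 ^ (n - 5)))"
      by (intro mult_left_mono) auto
    then show ?thesis using that(2) PB_nonneg [of "real n * s"] by (simp add: encl_def)
  qed
  have Rk: "encl (R ! k) (PB (real (Suc k) * s))"
  proof -
    have "k \<in> {0, 1, 2, 3, 4, 5, 6, 7}" using k(1) by auto
    then show ?thesis
      using B B1 k(2) tail [of 5 12094629] tail [of 6 1099512] tail [of 7 99956] tail [of 8 9087]
      unfolding R_def bres_fin_def
      by (elim insertE) (auto simp: eval_nat_numeral)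
  qed
  have lenR: "length R = 8" by (simp add: R_def bres_fin_def)
  have eq: "bpz a d b c2 c3 c5 c7 = map2 badd (map2 badd (map2 badd (map2 badd P2 P3) P5) P7) R"
    unfolding bpz_def bpz_list_def P [symmetric] R_def bres_def bres_mid_def B4_def B3_def B2_def L1_def by simp
  have "encl (bpz a d b c2 c3 c5 c7 ! k) (2 powr - (real (Suc k) * s) + 3 powr - (real (Suc k) * s)
      + 5 powr - (real (Suc k) * s) + 7 powr - (real (Suc k) * s) + PB (real (Suc k) * s))"
    unfolding eq using k(1) len lenR e [OF k(1)] Rk by (simp add: encl_add)
  then show ?thesis
    using pzeta_eq_PB [OF gt [OF k(2)]] by (simp add: s_def)
qed

section \<open>Newton's recursion in integer arithmetic\<close>

fun dot :: "int list \<Rightarrow> int list \<Rightarrow> int" where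
  "dot (x # xs) (y # ys) = x * y + dot xs ys"
| "dot xs ys = 0"

definition hom_lower_step :: "int list \<Rightarrow> int \<Rightarrow> int list \<Rightarrow> int list" where
  "hom_lower_step p m qs = dot p qs div (m * 1099511627776) # qs"

definition hom_upper_step :: "int list \<Rightarrow> int \<Rightarrow> int list \<Rightarrow> int list" where
  "hom_upper_step p m qs = (dot p qs div (m * 1099511627776) + 1) # qs"

text \<open>With the newest value at the head, the convolution in Newton's recursion becomes
  \<open>dot\<close> with the list \<open>p 1, p 2, ...\<close> in its natural order.\<close>

fun hom_lower :: "int list \<Rightarrow> nat \<Rightarrow> int list" where
  "hom_lower p 0 = [1099511627776]"
| "hom_lower p (Suc k) = hom_lower_step p (int (Suc k)) (hom_lower p k)"

fun hom_upper :: "int list \<Rightarrow> nat \<Rightarrow> int list" where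
  "hom_upper p 0 = [1099511627776]"
| "hom_upper p (Suc k) = hom_upper_step p (int (Suc k)) (hom_upper p k)"

lemma length_hom_lower [simp]: "length (hom_lower p k) = Suc k"
  by (induction k) (auto simp: hom_lower_step_def)

lemma length_hom_upper [simp]: "length (hom_upper p k) = Suc k"
  by (induction k) (auto simp: hom_upper_step_def)

text \<open>\<open>dot\<close> stops at the shorter list. For a lower bound the dropped products are
  nonnegative, so eight prime zeta values serve for all \<open>k \<le> 25\<close>; the upper bound
  \<open>dot_ge\<close> demands enough entries instead.\<close>

lemma dot_le:
  assumes "\<And>i. i < length xs \<Longrightarrow> 0 \<le> xs ! i \<and> real_of_int (xs ! i) \<le> 2 ^ 40 * X i"
    and "\<And>i. i < length ys \<Longrightarrow> 0 \<le> ys ! i \<and> real_of_int (ys ! i) \<le> 2 ^ 40 * Y i"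
    and "\<And>i. 0 \<le> X i" "\<And>i. 0 \<le> Y i"
  shows "0 \<le> dot xs ys \<and> real_of_int (dot xs ys) \<le> 2 ^ 80 * (\<Sum>i<length ys. X i * Y i)"
  using assms
proof (induction xs ys arbitrary: X Y rule: dot.induct)
  case (1 x xs y ys)
  have IH: "0 \<le> dot xs ys \<and> real_of_int (dot xs ys) \<le> 2 ^ 80 * (\<Sum>i<length ys. X (Suc i) * Y (Suc i))"
    using 1(2)[of "Suc i" for i] 1(3) [of "Suc i" for i] 1(4,5) by (intro "1.IH") auto
  have x: "0 \<le> x" "real_of_int x \<le> 2 ^ 40 * X 0" and y: "0 \<le> y" "real_of_int y \<le> 2 ^ 40 * Y 0"
    using 1(2) [of 0] 1(3) [of 0] by auto
  have "real_of_int x * real_of_int y \<le> (2 ^ 40 * X 0) * (2 ^ 40 * Y 0)"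
    using x y 1(4,5) by (intro mult_mono) auto
  moreover have "(\<Sum>i<length (y # ys). X i * Y i) = X 0 * Y 0 + (\<Sum>i<length ys. X (Suc i) * Y (Suc i))"
    by (simp add: sum.lessThan_Suc_shift del: sum.lessThan_Suc)
  ultimately show ?case using IH x y by (simp add: algebra_simps)
qed (auto intro!: sum_nonneg mult_nonneg_nonneg)

lemma dot_ge:
  assumes "\<And>i. i < length xs \<Longrightarrow> 2 ^ 40 * X i \<le> real_of_int (xs ! i)"
    and "\<And>i. i < length ys \<Longrightarrow> 2 ^ 40 * Y i \<le> real_of_int (ys ! i)"
    and "\<And>i. 0 \<le> X i" "\<And>i. 0 \<le> Y i" "length ys \<le> length xs"
  shows "2 ^ 80 * (\<Sum>i<length ys. X i * Y i) \<le> real_of_int (dot xs ys)"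
  using assms
proof (induction xs ys arbitrary: X Y rule: dot.induct)
  case (1 x xs y ys)
  have IH: "2 ^ 80 * (\<Sum>i<length ys. X (Suc i) * Y (Suc i)) \<le> real_of_int (dot xs ys)"
    using 1(2)[of "Suc i" for i] 1(3) [of "Suc i" for i] 1(4,5,6) by (intro "1.IH") auto
  have x: "2 ^ 40 * X 0 \<le> real_of_int x" and y: "2 ^ 40 * Y 0 \<le> real_of_int y"
    using 1(2) [of 0] 1(3) [of 0] by auto
  have "0 \<le> 2 ^ 40 * X 0" "0 \<le> 2 ^ 40 * Y 0" using 1(4,5) by auto
  then have "(2 ^ 40 * X 0) * (2 ^ 40 * Y 0) \<le> real_of_int x * real_of_int y"
    using x y by (intro mult_mono) linarith+
  moreover have "(\<Sum>i<length (y # ys). X i * Y i) = X 0 * Y 0 + (\<Sum>i<length ys. X (Suc i) * Y (Suc i))"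
    by (simp add: sum.lessThan_Suc_shift del: sum.lessThan_Suc)
  ultimately show ?case using IH by (simp add: algebra_simps)
qed auto

lemma hom_nonneg: "(\<And>j. 1 \<le> j \<Longrightarrow> 0 \<le> p j) \<Longrightarrow> 0 \<le> hom p k"
  using hom_mono [of k p p] by auto

lemma hom_Suc_eq: "hom p (Suc k) = (\<Sum>i<Suc k. p (Suc i) * hom p (k - i)) / real (Suc k)"
proof -
  have "(\<Sum>j=1..Suc k. hom p (Suc k - j) * p j) = (\<Sum>i<Suc k. p (Suc i) * hom p (k - i))"
    by (rule sum.reindex_bij_witness [of _ Suc "\<lambda>j. j - 1"]) auto
  then show ?thesis by (simp add: hom.simps [of p "Suc k"])
qed

lemma hom_lower_le:
  assumes "\<And>i. i < length ps \<Longrightarrow> 0 \<le> ps ! i \<and> real_of_int (ps ! i) \<le> 2 ^ 40 * p (Suc i)"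
    and p: "\<And>j. 1 \<le> j \<Longrightarrow> 0 \<le> p j" and "i \<le> k"
  shows "0 \<le> hom_lower ps k ! i \<and> real_of_int (hom_lower ps k ! i) \<le> 2 ^ 40 * hom p (k - i)"
  using assms(3)
proof (induction k arbitrary: i)
  case (Suc k)
  show ?case
  proof (cases i)
    case 0
    define D where "D = dot ps (hom_lower ps k)"
    have D: "0 \<le> D \<and> real_of_int D \<le> 2 ^ 80 * (\<Sum>i<length (hom_lower ps k). p (Suc i) * hom p (k - i))"
      unfolding D_def using assms(1) Suc.IH p hom_nonneg [of p] by (intro dot_le) auto
    have "real_of_int (D div (int (Suc k) * 1099511627776)) \<le> real_of_int D / real_of_int (int (Suc k) * 1099511627776)"
      by (rule div_bounds) simp
    also have "\<dots> \<le> 2 ^ 80 * (\<Sum>i<Suc k. p (Suc i) * hom p (k - i)) / real_of_int (int (Suc k) * 1099511627776)"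
      using D by (intro divide_right_mono) auto
    also have "\<dots> = 2 ^ 40 * hom p (Suc k)"
      unfolding hom_Suc_eq by (simp del: of_nat_Suc sum.lessThan_Suc)
    finally show ?thesis
      using 0 D by (simp add: hom_lower_step_def D_def pos_imp_zdiv_nonneg_iff)
  next
    case (Suc j)
    then show ?thesis using Suc.IH [of j] Suc.prems by (simp add: hom_lower_step_def)
  qed
qed simp

lemma hom_upper_ge:
  assumes "\<And>i. i < length ps \<Longrightarrow> 2 ^ 40 * p (Suc i) \<le> real_of_int (ps ! i)"
    and p: "\<And>j. 1 \<le> j \<Longrightarrow> 0 \<le> p j" and "i \<le> k" "k \<le> length ps"
  shows "2 ^ 40 * hom p (k - i) \<le> real_of_int (hom_upper ps k ! i)"
  using assms(3,4)
proof (induction k arbitrary: i)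
  case (Suc k)
  show ?case
  proof (cases i)
    case 0
    define D where "D = dot ps (hom_upper ps k)"
    have D: "2 ^ 80 * (\<Sum>i<length (hom_upper ps k). p (Suc i) * hom p (k - i)) \<le> real_of_int D"
      unfolding D_def using assms(1) Suc.IH Suc.prems p hom_nonneg [of p] by (intro dot_ge) auto
    have "2 ^ 40 * hom p (Suc k) = 2 ^ 80 * (\<Sum>i<Suc k. p (Suc i) * hom p (k - i)) / real_of_int (int (Suc k) * 1099511627776)"
      unfolding hom_Suc_eq by (simp del: of_nat_Suc sum.lessThan_Suc)
    also have "\<dots> \<le> real_of_int D / real_of_int (int (Suc k) * 1099511627776)"
      using D by (intro divide_right_mono) auto
    also have "\<dots> \<le> real_of_int (D div (int (Suc k) * 1099511627776) + 1)"
      by (rule div_bounds) simp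
    finally show ?thesis
      using 0 by (simp add: hom_upper_step_def D_def)
  next
    case (Suc j)
    then show ?thesis using Suc.IH [of j] Suc.prems by (simp add: hom_upper_step_def)
  qed
qed simp

section \<open>Halving the distance to the pole\<close>

text \<open>The bound imitates the antiderivative \<open>- (ln x + 1) / x\<close> of \<open>ln x / x\<^sup>2\<close>.\<close>

lemma ln_over_square_step:
  assumes "2 \<le> n"
  shows "ln (real n) / real n ^ 2 \<le> (ln (real n) + 1) / (real n - 1 / 2) - (ln (real (Suc n)) + 1) / (real (Suc n) - 1 / 2)"
proof -
  define x where "x = real n"
  have x: "2 \<le> x" using assms by (simp add: x_def)
  have "x + 1 = x * (1 + 1 / x)" using x by (simp add: distrib_left)
  then have "ln (x + 1) = ln x + ln (1 + 1 / x)"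
    using x by (simp only:) (rule ln_mult_pos; simp add: add_pos_pos)
  also have "ln (1 + 1 / x) \<le> 1 / x" using x by (intro ln_add_one_self_le_self) auto
  finally have "ln (x + 1) + 1 \<le> ln x + 1 + 1 / x" by simp
  then have "(ln (x + 1) + 1) / (x + 1 / 2) \<le> (ln x + 1 + 1 / x) / (x + 1 / 2)"
    using x by (intro divide_right_mono) auto
  moreover have "(ln x + 1) / (x - 1 / 2) - (ln x + 1 + 1 / x) / (x + 1 / 2) - ln x / x ^ 2
     = ln x * (1 / (x - 1 / 2) - 1 / (x + 1 / 2) - 1 / x ^ 2) + (1 / (x - 1 / 2) - 1 / (x + 1 / 2) - 1 / (x * (x + 1 / 2)))"
    by (simp add: algebra_simps add_divide_distrib diff_divide_distrib)
  moreover have d: "1 / (x - 1 / 2) - 1 / (x + 1 / 2) = 1 / ((x - 1 / 2) * (x + 1 / 2))"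
    using x by (subst diff_frac_eq) auto
  moreover have "1 / x ^ 2 \<le> 1 / ((x - 1 / 2) * (x + 1 / 2))"
  proof (intro frac_le)
    show "0 < (x - 1 / 2) * (x + 1 / 2)" using x by (intro mult_pos_pos) auto
    show "(x - 1 / 2) * (x + 1 / 2) \<le> x ^ 2" by (simp add: power2_eq_square algebra_simps)
  qed auto
  moreover have "1 / (x * (x + 1 / 2)) \<le> 1 / ((x - 1 / 2) * (x + 1 / 2))"
    using x by (intro frac_le mult_right_mono mult_pos_pos) auto
  moreover have "0 \<le> ln x" using x by simp
  ultimately have "ln x / x ^ 2 \<le> (ln x + 1) / (x - 1 / 2) - (ln (x + 1) + 1) / (x + 1 / 2)"
    by (smt (verit) mult_nonneg_nonneg)
  then show ?thesis by (simp add: x_def add_ac)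
qed

text \<open>\<open>D\<close> is \<open>- pzeta'\<close> at \<open>2\<close> and controls how
  \<open>pzeta (j s)\<close> with \<open>j \<ge> 2\<close> varies near \<open>s = 1\<close>.
  Extending the sum to all integers from \<open>2\<close> on and telescoping gives
  \<open>(ln 2 + 1) / (3 / 2) < 1.13\<close>.\<close>

lemma prime_log_sum:
  obtains D where "((\<lambda>p::nat. ln (real p) / real p ^ 2) has_sum D) {p. prime p}" "0 \<le> D" "D \<le> 113 / 100"
proof -
  define f where "f n = ln (real n) / real n ^ 2" for n :: nat
  define V where "V n = (ln (real n) + 1) / (real n - 1 / 2)" for n :: nat
  have f0: "0 \<le> f n" if "n \<ge> 1" for n using that by (simp add: f_def)
  have le: "sum f F \<le> 113 / 100" if F: "finite F" "F \<subseteq> {p. prime p}" for F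
  proof -
    obtain N where N: "F \<subseteq> {..<N}" using F(1) finite_nat_iff_bounded by blast
    have "F \<subseteq> {2..<2 + N}"
    proof
      fix p assume "p \<in> F"
      then have "p < N" "2 \<le> p" using N F(2) prime_ge_2_nat [of p] by auto
      then show "p \<in> {2..<2 + N}" by simp
    qed
    then have "sum f F \<le> sum f {2..<2 + N}"
      using f0 by (intro sum_mono2) auto
    also have "\<dots> \<le> V 2 - V (2 + N)"
    proof (induction N)
      case (Suc N)
      then show ?case
        using ln_over_square_step [of "2 + N"] by (simp add: f_def V_def)
    qed simp
    also have "\<dots> \<le> V 2"
    proof -
      have "0 \<le> V (2 + N)" unfolding V_def by (intro divide_nonneg_nonneg add_nonneg_nonneg) auto
      then show ?thesis by simp
    qed
    also have "V 2 \<le> 113 / 100"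
      using ln2_bounds by (simp add: V_def)
    finally show ?thesis .
  qed
  have s: "f summable_on {p. prime p}"
  proof (rule nonneg_bdd_above_summable_on)
    show "0 \<le> f p" if "p \<in> {p. prime p}" for p
      using that f0 [of p] prime_gt_0_nat [of p] by simp
    show "bdd_above (sum f ` {F. F \<subseteq> {p. prime p} \<and> finite F})"
      using le by (intro bdd_aboveI [of _ "113 / 100"]) blast
  qed
  show ?thesis
  proof (rule that [of "infsum f {p. prime p}"])
    show "((\<lambda>p. ln (real p) / real p ^ 2) has_sum infsum f {p. prime p}) {p. prime p}"
      using has_sum_infsum [OF s] by (simp add: f_def [abs_def])
    show "0 \<le> infsum f {p. prime p}"
      using f0 by (intro infsum_nonneg) (auto dest: prime_gt_0_nat simp: Suc_le_eq)
    show "infsum f {p. prime p} \<le> 113 / 100"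
      by (rule infsum_le_finite_sums [OF s]) (use le in auto)
  qed
qed

text \<open>Termwise this is \<open>exp (- x) - exp (- 2 x) \<le> x\<close> combined with
  \<open>p ^ j \<ge> 2 ^ (j - 2) * p ^ 2\<close>. The factor \<open>j\<close> will cancel against
  \<open>1 / j\<close> in the series for \<open>ln zeta\<close> and leave a geometric
  series.\<close>

lemma pzeta_diff_le:
  assumes D: "((\<lambda>p::nat. ln (real p) / real p ^ 2) has_sum D) {p. prime p}" and "2 \<le> j" "0 < t"
  shows "pzeta (real j * (1 + t / 2)) - pzeta (real j * (1 + t)) \<le> real j * t / 2 * (1 / 2) ^ (j - 2) * D"
proof -
  have gt: "1 < real j * (1 + u)" if "0 < u" for u
  proof -
    have "1 * 1 < real j * (1 + u)" using assms(2) that by (intro mult_strict_mono) auto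
    then show ?thesis by simp
  qed
  have "((\<lambda>p. real p powr - (real j * (1 + t / 2)) - real p powr - (real j * (1 + t)))
      has_sum pzeta (real j * (1 + t / 2)) - pzeta (real j * (1 + t))) {p. prime p}"
    using has_sum_add [OF pzeta_has_sum [OF gt [of "t / 2"]]
        has_sum_cmult_right [where c = "- 1", OF pzeta_has_sum [OF gt [of t]]]] \<open>0 < t\<close> by simp
  moreover have "((\<lambda>p. real j * t / 2 * (1 / 2) ^ (j - 2) * (ln (real p) / real p ^ 2)) has_sum
     real j * t / 2 * (1 / 2) ^ (j - 2) * D) {p. prime p}"
    by (rule has_sum_cmult_right [OF D])
  ultimately show ?thesis
  proof (rule has_sum_mono)
    fix p :: nat assume "p \<in> {p. prime p}"
    then have p: "2 \<le> real p" using prime_ge_2_nat [of p] by simp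
    define x where "x = real j * t / 2 * ln (real p)"
    have x: "0 \<le> x" using p \<open>0 < t\<close> by (simp add: x_def)
    have e: "real p powr - (real j * (1 + t / 2)) = exp (- x) / real p ^ j"
      "real p powr - (real j * (1 + t)) = exp (- (2 * x)) / real p ^ j"
      using p by (simp_all add: powr_def x_def exp_diff [symmetric] exp_of_nat_mult [symmetric]
          powr_realpow [symmetric] algebra_simps)
    have "exp (- (2 * x)) = exp (- x) * exp (- x)" by (simp add: exp_add [symmetric])
    then have "exp (- x) - exp (- (2 * x)) = exp (- x) * (1 - exp (- x))" by (simp add: algebra_simps)
    also have "\<dots> \<le> 1 * x"
      using x exp_ge_add_one_self [of "- x"] by (intro mult_mono) auto
    finally have 1: "exp (- x) - exp (- (2 * x)) \<le> x" by simp
    have 2: "(1 / real p) ^ j \<le> (1 / 2) ^ (j - 2) * (1 / real p ^ 2)"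
    proof -
      have "j = (j - 2) + 2" using assms(2) by simp
      then have "(1 / real p) ^ j = (1 / real p) ^ ((j - 2) + 2)" by (rule arg_cong)
      also have "\<dots> = (1 / real p) ^ (j - 2) * (1 / real p) ^ 2" by (rule power_add)
      also have "\<dots> \<le> (1 / 2) ^ (j - 2) * (1 / real p) ^ 2"
        using p by (intro mult_right_mono power_mono) (auto simp: field_simps)
      finally show ?thesis by (simp add: power_one_over)
    qed
    have "real p powr - (real j * (1 + t / 2)) - real p powr - (real j * (1 + t))
      = (exp (- x) - exp (- (2 * x))) * (1 / real p) ^ j"
      unfolding e by (simp add: diff_divide_distrib power_one_over left_diff_distrib)
    also have "\<dots> \<le> x * ((1 / 2) ^ (j - 2) * (1 / real p ^ 2))"
      using 1 2 x p by (intro mult_mono) auto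
    also have "\<dots> = real j * t / 2 * (1 / 2) ^ (j - 2) * (ln (real p) / real p ^ 2)"
      by (simp add: x_def)
    finally show "real p powr - (real j * (1 + t / 2)) - real p powr - (real j * (1 + t))
      \<le> real j * t / 2 * (1 / 2) ^ (j - 2) * (ln (real p) / real p ^ 2)" .
  qed
qed

lemma pzeta_le_ln_zeta_sums:
  assumes "s > 1"
  shows "(\<lambda>j. pzeta (real (Suc (Suc j)) * s) / real (Suc (Suc j))) sums (ln (zeta s) - pzeta s)"
  using sums_split_initial_segment [OF ln_zeta_sums [OF assms], of 1] by simp

text \<open>The terms of \<open>ln zeta\<close> with \<open>j \<ge> 2\<close> only grow when
  \<open>t\<close> is halved, so it suffices that
  \<open>zeta (1 + t / 2) \<le> 2 * zeta (1 + t)\<close>. The right side doubles the positive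
  constant term of zeta, the left side does not.\<close>

lemma pzeta_halve_upper:
  assumes t: "0 < t" "t \<le> 1 / 8"
  shows "pzeta (1 + t / 2) \<le> pzeta (1 + t) + ln 2"
proof -
  have "ln (zeta (1 + t)) - pzeta (1 + t) \<le> ln (zeta (1 + t / 2)) - pzeta (1 + t / 2)"
    using t by (intro sums_le [OF _ pzeta_le_ln_zeta_sums pzeta_le_ln_zeta_sums] divide_right_mono pzeta_antimono
        mult_left_mono) (auto intro!: less_1_mult)
  moreover have "zeta (1 + t / 2) \<le> 2 * zeta (1 + t)"
  proof -
    define a where "a = zeta (1 + t / 2)"
    define b where "b = zeta (1 + t)"
    have "a \<le> 2 * (1 / t) + 3 / 5" "1 / t + 53 / 100 \<le> b"
      using zeta_bounds_near_1(2) [of "t / 2"] zeta_bounds_near_1(1) [of t] t by (simp_all add: a_def b_def)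
    then show ?thesis unfolding a_def [symmetric] b_def [symmetric] by linarith
  qed
  then have "ln (zeta (1 + t / 2)) \<le> ln (2 * zeta (1 + t))"
    using zeta_ge_1 [of "1 + t / 2"] zeta_ge_1 [of "1 + t"] t by (subst ln_le_cancel_iff) auto
  moreover have "ln (2 * zeta (1 + t)) = ln 2 + ln (zeta (1 + t))"
    using zeta_ge_1 [of "1 + t"] t by (intro ln_mult_pos) auto
  ultimately show ?thesis by linarith
qed

text \<open>There are two losses. The terms with \<open>j \<ge> 2\<close> change by at most
  \<open>1.13 t\<close>. Moreover \<open>2 * zeta (1 + t)\<close> exceeds
  \<open>zeta (1 + t / 2)\<close> by a bounded amount, hence by a factor \<open>1 + O(t)\<close>;
  this loss is rounded up to \<open>0.87 t\<close>, so that the total is \<open>2 t\<close>.\<close>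

lemma pzeta_halve_lower:
  assumes t: "0 < t" "t \<le> 1 / 8"
  shows "pzeta (1 + t) + ln 2 - 2 * t \<le> pzeta (1 + t / 2)"
proof -
  obtain D where D: "((\<lambda>p::nat. ln (real p) / real p ^ 2) has_sum D) {p. prime p}" "0 \<le> D" "D \<le> 113 / 100"
    by (rule prime_log_sum)
  define M where "M u = ln (zeta (1 + u)) - pzeta (1 + u)" for u
  have sM: "(\<lambda>j. pzeta (real (Suc (Suc j)) * (1 + u)) / real (Suc (Suc j))) sums M u" if "0 < u" for u
    unfolding M_def using that by (intro pzeta_le_ln_zeta_sums) auto
  have "(\<lambda>j. pzeta (real (Suc (Suc j)) * (1 + t / 2)) / real (Suc (Suc j))
      - pzeta (real (Suc (Suc j)) * (1 + t)) / real (Suc (Suc j))) sums (M (t / 2) - M t)"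
    using t by (intro sums_diff sM) auto
  moreover have "(\<lambda>j. t / 2 * D * (1 / 2) ^ j) sums (t / 2 * D * (1 / (1 - 1 / 2)))"
    by (intro sums_mult geometric_sums) simp
  ultimately have "M (t / 2) - M t \<le> t / 2 * D * (1 / (1 - 1 / 2))"
  proof (rule sums_le [rotated])
    fix j
    have "pzeta (real (Suc (Suc j)) * (1 + t / 2)) - pzeta (real (Suc (Suc j)) * (1 + t))
        \<le> real (Suc (Suc j)) * t / 2 * (1 / 2) ^ j * D"
      using pzeta_diff_le [OF D(1), of "Suc (Suc j)" t] t by simp
    then show "pzeta (real (Suc (Suc j)) * (1 + t / 2)) / real (Suc (Suc j))
      - pzeta (real (Suc (Suc j)) * (1 + t)) / real (Suc (Suc j)) \<le> t / 2 * D * (1 / 2) ^ j"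
      unfolding diff_divide_distrib [symmetric]
      by (subst pos_divide_le_eq) (simp_all add: mult_ac)
  qed
  also have "\<dots> \<le> t * (113 / 100)" using D t by simp
  finally have m: "M (t / 2) - M t \<le> t * (113 / 100)" .
  define a where "a = zeta (1 + t / 2)"
  define b where "b = zeta (1 + t)"
  have ab: "1 \<le> a" "1 \<le> b" using t zeta_ge_1 by (auto simp: a_def b_def)
  have "2 / t + 53 / 100 \<le> a" "b \<le> 1 / t + 3 / 5"
    using zeta_bounds_near_1(1) [of "t / 2"] zeta_bounds_near_1(2) [of t] t by (simp_all add: a_def b_def)
  then have "2 * b - a \<le> 67 / 100" "2 / t \<le> a" by simp_all
  then have "2 * b - a \<le> 67 / 100" "1 \<le> t / 2 * a" using t by (simp_all add: field_simps)
  then have "2 * b - a \<le> 67 / 100 * (t / 2 * a)" by linarith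
  then have "2 * b / a - 1 \<le> 67 / 100 * (t / 2)" using ab by (simp add: field_simps)
  moreover have "ln (2 * b / a) \<le> 2 * b / a - 1" using ab by (intro ln_le_minus_one) auto
  moreover have "ln (2 * b / a) = ln 2 + ln b - ln a" using ab by (simp add: ln_div ln_mult_pos)
  ultimately have "ln 2 + ln b - ln a \<le> t * (87 / 100)" using t by simp
  then show ?thesis using m by (simp add: M_def a_def b_def algebra_simps)
qed

lemma pzeta_le_ln:
  assumes t: "0 < t" "t \<le> 1 / 8"
  shows "pzeta (1 + t) \<le> ln (1 / t) + 3 / 40"
proof -
  have "0 \<le> ln (zeta (1 + t)) - pzeta (1 + t)"
    using t by (intro sums_le [OF _ sums_zero pzeta_le_ln_zeta_sums]) (auto simp: pzeta_nonneg)
  moreover have "ln (zeta (1 + t)) \<le> ln (1 / t * (1 + 3 / 5 * t))"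
    using zeta_bounds_near_1(2) [OF t] zeta_ge_1 [of "1 + t"] t
    by (subst ln_le_cancel_iff) (auto simp: field_simps intro: add_pos_pos)
  moreover have "ln (1 / t * (1 + 3 / 5 * t)) = ln (1 / t) + ln (1 + 3 / 5 * t)"
    using t by (intro ln_mult_pos) auto
  moreover have "ln (1 + 3 / 5 * t) \<le> 3 / 5 * t" using t by (intro ln_add_one_self_le_self) auto
  ultimately show ?thesis using t by linarith
qed

section \<open>Recursions for the tail sums\<close>

lemma octave_t_Suc: "octave_t (Suc i) = octave_t i / 2"
  by (simp add: octave_t_def)

lemma octave_t_small: "4 \<le> i \<Longrightarrow> octave_t i \<le> 1 / 8"
  using power_increasing [of 4 i "2::real"] by (simp add: octave_t_def field_simps)

lemma octave_t_antimono: "i \<le> j \<Longrightarrow> octave_t j \<le> octave_t i"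
  by (simp add: octave_t_def frac_le power_increasing)

lemma axp_Suc_ge:
  assumes "4 \<le> i" "0 \<le> l" "l \<le> ln 2 - 2 * octave_t i"
  shows "(\<Sum>j\<le>k. l ^ j / fact j * axp (k - j) i) \<le> axp k (Suc i)"
  unfolding axp_eq_hom
proof (rule hom_shift_le)
  show "pzeta (real 1 * (1 + octave_t i)) + l \<le> pzeta (real 1 * (1 + octave_t (Suc i)))"
    using pzeta_halve_lower [OF octave_t_pos octave_t_small [OF assms(1)]] assms(3)
    by (simp add: octave_t_Suc)
  fix j :: nat assume "2 \<le> j"
  then have "1 * 1 < real j * (1 + octave_t (Suc i))"
    using octave_t_pos [of "Suc i"] by (intro mult_strict_mono) auto
  then show "pzeta (real j * (1 + octave_t i)) \<le> pzeta (real j * (1 + octave_t (Suc i)))"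
    using octave_t_antimono [of i "Suc i"] by (intro pzeta_antimono mult_left_mono) auto
qed (use assms pzeta_nonneg in auto)

definition axtail :: "nat \<Rightarrow> nat \<Rightarrow> real" where
  "axtail I k = (\<Sum>i. octave_t (i + I) * axp k (i + I))"

lemma summable_axtail: "summable (\<lambda>i. octave_t (i + I) * axp k (i + I))"
  using summable_octave_axp by (rule summable_ignore_initial_segment)

lemma axtail_split: "axtail I k = octave_t I * axp k I + axtail (Suc I) k"
  unfolding axtail_def using suminf_split_head [OF summable_axtail [of I k]] by simp

lemma axtail_nonneg: "0 \<le> axtail I k"
  unfolding axtail_def using octave_t_pos axp_nonneg
  by (intro suminf_nonneg summable_axtail) (auto simp: less_imp_le)

text \<open>A step from \<open>i\<close> to \<open>Suc i\<close> halves the weight and convolves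
  \<open>axp\<close> with \<open>l ^ j / fact j\<close>. The term \<open>j = 0\<close> thus returns
  half of \<open>axtail I k\<close>; solving for \<open>axtail I k\<close> doubles everything
  else.\<close>

lemma axtail_rec_lower:
  assumes "4 \<le> I" "0 \<le> l" "l \<le> ln 2 - 2 * octave_t I"
  shows "2 * octave_t I * axp k I + (\<Sum>j=1..k. l ^ j / fact j * axtail I (k - j)) \<le> axtail I k"
proof -
  have "(\<lambda>i. octave_t (i + I) / 2 * (\<Sum>j\<le>k. l ^ j / fact j * axp (k - j) (i + I)))
      sums (\<Sum>j\<le>k. l ^ j / fact j / 2 * axtail I (k - j))"
  proof -
    have "(\<lambda>i. \<Sum>j\<le>k. l ^ j / fact j / 2 * (octave_t (i + I) * axp (k - j) (i + I)))
      sums (\<Sum>j\<le>k. l ^ j / fact j / 2 * axtail I (k - j))"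
      unfolding axtail_def by (intro sums_sum sums_mult summable_sums summable_axtail)
    moreover have "octave_t (i + I) / 2 * (\<Sum>j\<le>k. l ^ j / fact j * axp (k - j) (i + I))
       = (\<Sum>j\<le>k. l ^ j / fact j / 2 * (octave_t (i + I) * axp (k - j) (i + I)))" for i
      unfolding sum_distrib_left by (intro sum.cong) (auto simp: field_simps)
    ultimately show ?thesis by (simp only:)
  qed
  moreover have "(\<lambda>i. octave_t (i + Suc I) * axp k (i + Suc I)) sums axtail (Suc I) k"
    unfolding axtail_def by (intro summable_sums summable_axtail)
  ultimately have "(\<Sum>j\<le>k. l ^ j / fact j / 2 * axtail I (k - j)) \<le> axtail (Suc I) k"
  proof (rule sums_le [rotated])
    fix i
    have "octave_t (i + I) \<le> octave_t I" by (rule octave_t_antimono) simp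
    then have "(\<Sum>j\<le>k. l ^ j / fact j * axp (k - j) (i + I)) \<le> axp k (Suc (i + I))"
      using assms by (intro axp_Suc_ge) auto
    then show "octave_t (i + I) / 2 * (\<Sum>j\<le>k. l ^ j / fact j * axp (k - j) (i + I))
        \<le> octave_t (i + Suc I) * axp k (i + Suc I)"
      using octave_t_pos [of "i + I"] by (simp add: octave_t_Suc)
  qed
  moreover have "(\<Sum>j\<le>k. l ^ j / fact j / 2 * axtail I (k - j))
     = axtail I k / 2 + (\<Sum>j=1..k. l ^ j / fact j * axtail I (k - j)) / 2"
  proof -
    have "{..k} = insert 0 {1..k}" by auto
    then show ?thesis by (simp add: sum_divide_distrib)
  qed
  ultimately show ?thesis
    using axtail_split [of I k] by linarith
qed

text \<open>In the tail \<open>i \<ge> I\<close> the prime zeta values of index \<open>j \<ge> 2\<close> are bounded by their limits, and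
  that of index \<open>1\<close> grows by at most \<open>ln 2\<close> in each step.\<close>

lemma axtail_upper:
  assumes I: "4 \<le> I" and P: "pzeta (1 + octave_t I) \<le> P"
    and V: "\<And>k. k \<le> K \<Longrightarrow> 2 * octave_t I * hom (\<lambda>j. if j = 1 then P else pzeta (real j)) k
       + (\<Sum>j=1..k. ln 2 ^ j / fact j * V (k - j)) \<le> V k"
    and "k \<le> K"
  shows "(\<Sum>i<M. octave_t (i + I) * axp k (i + I)) \<le> V k"
proof -
  define p where "p i j = (if j = 1 then P + real i * ln 2 else pzeta (real j))" for i j :: nat
  define h where "h i k = hom (p i) k" for i k
  have p1: "pzeta (1 + octave_t (i + I)) \<le> p i 1" for i
  proof (induction i)
    case (Suc i)
    then show ?case
      using pzeta_halve_upper [OF octave_t_pos octave_t_small, of "i + I"] I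
      by (simp add: p_def octave_t_Suc algebra_simps)
  qed (use P in \<open>simp add: p_def\<close>)
  have pge: "pzeta (real j * (1 + octave_t (i + I))) \<le> p i j" if "1 \<le> j" for i j
  proof (cases "j = 1")
    case False
    have "real j * 1 \<le> real j * (1 + octave_t (i + I))"
      using octave_t_pos [of "i + I"] by (intro mult_left_mono) auto
    then show ?thesis using False that by (auto simp: p_def intro!: pzeta_antimono)
  qed (use p1 in simp)
  have p0: "0 \<le> p i j" if "1 \<le> j" for i j
    using pge [OF that, of i] pzeta_nonneg [of "real j * (1 + octave_t (i + I))"] by linarith
  have ax: "axp k (i + I) \<le> h i k" for i k
    unfolding axp_eq_hom h_def by (intro hom_mono [THEN conjunct2] pzeta_nonneg pge)
  have h0: "0 \<le> h i k" for i k unfolding h_def using p0 by (rule hom_nonneg)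
  have hSuc: "h (Suc i) k = (\<Sum>j\<le>k. ln 2 ^ j / fact j * h i (k - j))" for i k
  proof -
    have "p (Suc i) = (p i)(1 := p i 1 + ln 2)" by (auto simp: p_def fun_eq_iff algebra_simps)
    then show ?thesis unfolding h_def by (simp only: hom_shift)
  qed
  define A where "A k = (\<Sum>i<M. octave_t (i + I) * h i k)" for k
  have "A k \<le> V k" using \<open>k \<le> K\<close>
  proof (induction k rule: less_induct)
    case (less k)
    \<comment> \<open>One additional term lets the index shift reproduce \<open>A\<close> with the
      same \<open>M\<close>, so the argument stays within finite sums.\<close>
    have "A k \<le> (\<Sum>i<Suc M. octave_t (i + I) * h i k)"
      unfolding A_def using octave_t_pos [of "M + I"] h0 by (simp add: less_imp_le)
    also have "\<dots> = octave_t I * h 0 k + (\<Sum>i<M. octave_t (i + I) / 2 * h (Suc i) k)"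
      by (subst sum.lessThan_Suc_shift) (simp add: octave_t_Suc)
    also have "(\<Sum>i<M. octave_t (i + I) / 2 * h (Suc i) k)
        = (\<Sum>j\<le>k. ln 2 ^ j / fact j / 2 * A (k - j))"
      unfolding A_def hSuc sum_distrib_left by (subst sum.swap) (simp add: mult_ac)
    also have "\<dots> = A k / 2 + (\<Sum>j=1..k. ln 2 ^ j / fact j * A (k - j)) / 2"
    proof -
      have "{..k} = insert 0 {1..k}" by auto
      then show ?thesis by (simp add: sum_divide_distrib)
    qed
    finally have "A k \<le> 2 * octave_t I * h 0 k + (\<Sum>j=1..k. ln 2 ^ j / fact j * A (k - j))" by simp
    also have "\<dots> \<le> 2 * octave_t I * h 0 k + (\<Sum>j=1..k. ln 2 ^ j / fact j * V (k - j))"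
      using less by (intro add_left_mono sum_mono mult_left_mono) auto
    also have "\<dots> \<le> V k"
    proof -
      have "p 0 = (\<lambda>j. if j = 1 then P else pzeta (real j))" by (auto simp: p_def fun_eq_iff)
      then show ?thesis using V [OF less.prems] by (simp add: h_def)
    qed
    finally show ?case .
  qed
  moreover have "(\<Sum>i<M. octave_t (i + I) * axp k (i + I)) \<le> A k"
    unfolding A_def using ax octave_t_pos by (intro sum_mono mult_left_mono) (auto simp: less_imp_le)
  ultimately show ?thesis by linarith
qed

section \<open>Numerical tables\<close>

type_synonym row = "int \<times> nat \<times> int \<times> int \<times> int \<times> int"

text \<open>Row \<open>i\<close> contains \<open>2\<^sup>i\<close>, the exponent of the power of two that scales \<open>zeta (1 + 2 / 2\<^sup>i)\<close>
  without its Euler factors at \<open>2, 3, 5, 7\<close> into \<open>[1, 2]\<close>, and the rounded values of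
  \<open>2\<^sup>4\<^sup>0 p powr (- 2 / 2\<^sup>i)\<close> for \<open>p = 2, 3, 5, 7\<close>.\<close>

definition rows :: "row list" where
  "rows =
  [(1, 0, 274877906944, 122167958641, 43980465111, 22439012811),
   (2, 0, 549755813888, 366503875925, 219902325555, 157073089682),
   (4, 0, 777472127993, 634803334273, 491716548351, 415576332959),
   (8, 0, 924575386326, 835448171572, 735287741283, 675966722788),
   (16, 1, 1008256608220, 958428390151, 899142603429, 862109779375),
   (32, 2, 1052895941923, 1026549150972, 994292586464, 973601420932),
   (64, 2, 1075951360881, 1062404220613, 1045579389730, 1034642973751),
   (128, 3, 1087667703027, 1080798683364, 1072206461821, 1066584258385),
   (256, 4, 1093573631098, 1090115002944, 1085773213958, 1082922801540),
   (512, 5, 1096538610000, 1094803234079, 1092620828043, 1091185691015),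
   (1024, 6, 1098024112667, 1097154905196, 1096060812721, 1095340748504),
   (2048, 7, 1098767618496, 1098332634375, 1097784864322, 1097424206657),
   (4096, 8, 1099139560183, 1098921972963, 1098647906801, 1098467421374),
   (8192, 9, 1099325578238, 1099216760830, 1099079682443, 1098989400555),
   (16384, 10, 1099418599071, 1099364184416, 1099295633894, 1099250483153),
   (32768, 11, 1099465112439, 1099437903624, 1099403625530, 1099381047710),
   (65536, 12, 1099488369861, 1099474765082, 1099457625326, 1099446335804)]"

fun row_bounds :: "row \<Rightarrow> bracket list" where
  "row_bounds (d, b, c2, c3, c5, c7) = bpz 2 d b (c2, c2 + 8) (c3, c3 + 8) (c5, c5 + 8) (c7, c7 + 8)"

definition row_lower :: "row \<Rightarrow> int list" where
  "row_lower r = hom_lower (map fst (row_bounds r)) 25"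

definition row_upper :: "row \<Rightarrow> int list" where
  "row_upper r = hom_upper (map snd (row_bounds r)) 6"

fun row_ok :: "nat \<Rightarrow> row \<Rightarrow> bool" where
  "row_ok i (d, b, c2, c3, c5, c7) \<longleftrightarrow> d = 2 ^ i \<and>
     encl (c2, c2 + 8) (2 powr - octave_t i) \<and> encl (c3, c3 + 8) (3 powr - octave_t i) \<and>
     encl (c5, c5 + 8) (5 powr - octave_t i) \<and> encl (c7, c7 + 8) (7 powr - octave_t i)"

fun sqrt_step_ok :: "int \<Rightarrow> int \<Rightarrow> bool" where
  "sqrt_step_ok a b \<longleftrightarrow> 0 \<le> b \<and> b * b \<le> a * 1099511627776 \<and> (a + 8) * 1099511627776 \<le> (b + 8) * (b + 8)"

lemma encl_sqrt_step:
  assumes "encl (a, a + 8) (p powr - t)" "sqrt_step_ok a b" "0 < p"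
  shows "encl (b, b + 8) (p powr - (t / 2))"
proof -
  define y where "y = p powr - (t / 2)"
  have y0: "0 < y" using assms(3) by (simp add: y_def)
  have y2: "y * y = p powr - t" by (simp add: y_def powr_add [symmetric])
  have b: "0 \<le> b" "b * b \<le> a * 1099511627776" "(a + 8) * 1099511627776 \<le> (b + 8) * (b + 8)"
    using assms(2) by auto
  have a: "real_of_int a \<le> 2 ^ 40 * (y * y)" "2 ^ 40 * (y * y) \<le> real_of_int (a + 8)"
    using assms(1) by (simp_all add: encl_def y2)
  have "real_of_int b * real_of_int b \<le> real_of_int a * 1099511627776"
    using b(2) by (metis of_int_le_iff of_int_mult of_int_numeral)
  also have "\<dots> \<le> (2 ^ 40 * y) * (2 ^ 40 * y)" using a(1) by simp
  finally have "(real_of_int b)\<^sup>2 \<le> (2 ^ 40 * y)\<^sup>2" by (simp only: power2_eq_square)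
  then have 1: "real_of_int b \<le> 2 ^ 40 * y" by (rule power2_le_imp_le) (use y0 in simp)
  have "(2 ^ 40 * y) * (2 ^ 40 * y) \<le> real_of_int (a + 8) * 1099511627776" using a(2) by simp
  also have "\<dots> \<le> real_of_int (b + 8) * real_of_int (b + 8)"
    using b(3) by (metis of_int_le_iff of_int_mult of_int_numeral)
  finally have "(2 ^ 40 * y)\<^sup>2 \<le> (real_of_int (b + 8))\<^sup>2" by (simp only: power2_eq_square)
  then have 2: "2 ^ 40 * y \<le> real_of_int (b + 8)" by (rule power2_le_imp_le) (use b(1) in simp)
  show ?thesis using 1 2 b(1) by (simp add: encl_def y_def)
qed

fun row_step_ok :: "row \<Rightarrow> row \<Rightarrow> bool" where
  "row_step_ok (d, b, c2, c3, c5, c7) (d', b', c2', c3', c5', c7') \<longleftrightarrow> d' = 2 * d \<and>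
     sqrt_step_ok c2 c2' \<and> sqrt_step_ok c3 c3' \<and> sqrt_step_ok c5 c5' \<and> sqrt_step_ok c7 c7'"

lemma row_step:
  assumes "row_ok i r" "row_step_ok r r'"
  shows "row_ok (Suc i) r'"
  using assms by (cases r; cases r') (auto simp: octave_t_Suc intro: encl_sqrt_step simp del: sqrt_step_ok.simps)

text \<open>From row \<open>3\<close> on all entries exceed \<open>1 / 2\<close>, so a square root
  does not widen a bracket and the width \<open>8\<close> persists. The earlier roots can widen it,
  for instance from \<open>1 / 49\<close> to \<open>1 / 7\<close>; the first three rows are
  therefore checked directly.\<close>

lemma row_ok_base: "row_ok 0 (rows ! 0)" "row_ok 1 (rows ! 1)" "row_ok 2 (rows ! 2)"
proof -
  show "row_ok 0 (rows ! 0)" "row_ok 1 (rows ! 1)"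
    by (simp_all add: rows_def octave_t_def encl_def powr_neg_numeral powr_minus_divide)
  have h: "encl (c, c + 8) (p powr - octave_t 2)"
    if "0 \<le> c" "real_of_int (c * c) * p \<le> 2 ^ 80" "2 ^ 80 \<le> real_of_int ((c + 8) * (c + 8)) * p" "0 < p" for c p
  proof -
    define y where "y = p powr - (1 / 2)"
    have y0: "0 < y" using that by (simp add: y_def)
    have "y * y = p powr - 1" by (simp add: y_def powr_add [symmetric])
    then have y2: "y * y * p = 1" using that by (simp add: powr_minus_divide)
    have "(real_of_int c)\<^sup>2 * p \<le> (2 ^ 40 * y)\<^sup>2 * p" using that(2) y2 by (simp add: power2_eq_square algebra_simps)
    then have "(real_of_int c)\<^sup>2 \<le> (2 ^ 40 * y)\<^sup>2" using that(4) by simp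
    then have 1: "real_of_int c \<le> 2 ^ 40 * y" by (rule power2_le_imp_le) (use y0 in simp)
    have "(2 ^ 40 * y)\<^sup>2 * p = 2 ^ 80 * (y * y * p)" by (simp add: power2_eq_square)
    also have "\<dots> \<le> (real_of_int (c + 8))\<^sup>2 * p"
      unfolding y2 using that(3) by (simp add: power2_eq_square)
    finally have "(2 ^ 40 * y)\<^sup>2 \<le> (real_of_int (c + 8))\<^sup>2" using that(4) by simp
    then have 2: "2 ^ 40 * y \<le> real_of_int (c + 8)" by (rule power2_le_imp_le) (use that(1) in simp)
    show ?thesis using 1 2 that(1) by (simp add: encl_def y_def octave_t_def)
  qed
  show "row_ok 2 (rows ! 2)"
    using h [of 777472127993 2] h [of 634803334273 3] h [of 491716548351 5] h [of 415576332959 7]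
    by (simp add: rows_def)
qed

lemma rows_steps: "list_all (\<lambda>i. row_step_ok (rows ! i) (rows ! Suc i)) [2..<16]"
  by code_simp

lemma row_ok_rows: "i < 17 \<Longrightarrow> row_ok i (rows ! i)"
proof (induction i)
  case (Suc i)
  show ?case
  proof (cases "i < 2")
    case True
    then have "i = 0 \<or> i = 1" by auto
    then show ?thesis using row_ok_base by (auto simp: numeral_2_eq_2)
  next
    case False
    then have "row_step_ok (rows ! i) (rows ! Suc i)"
      using rows_steps Suc.prems unfolding list_all_iff set_upt by auto
    then show ?thesis using Suc by (intro row_step) auto
  qed
qed (use row_ok_base in simp)

lemma length_bpz [simp]: "length (bpz a d b c2 c3 c5 c7) = 8"
  by (simp add: bpz_def bpz_list_def bppow_def bres_def bres_mid_def bres_fin_def)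

lemma length_row_bounds [simp]: "length (row_bounds r) = 8"
  by (cases r) simp

lemma encl_row_bounds:
  assumes "row_ok i r" "k < 8"
  shows "encl (row_bounds r ! k) (pzeta (real (Suc k) * (1 + octave_t i)))"
proof -
  obtain d b c2 c3 c5 c7 where r: "r = (d, b, c2, c3, c5, c7)" by (cases r) auto
  show ?thesis
    using assms unfolding r row_bounds.simps
    by (intro encl_bpz) (auto simp: octave_t_def)
qed

lemma row_lower_le:
  assumes "row_ok i r" "j \<le> 25"
  shows "0 \<le> row_lower r ! j \<and> real_of_int (row_lower r ! j) \<le> 2 ^ 40 * axp (25 - j) i"
  unfolding row_lower_def axp_eq_hom
  using encl_row_bounds [OF assms(1)] assms(2) pzeta_nonneg by (intro hom_lower_le) (auto simp: encl_def)

lemma row_upper_ge: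
  assumes "row_ok i r"
  shows "2 ^ 40 * axp 6 i \<le> real_of_int (hd (row_upper r))"
proof -
  have "2 ^ 40 * hom (\<lambda>j. pzeta (real j * (1 + octave_t i))) (6 - 0) \<le> real_of_int (row_upper r ! 0)"
    unfolding row_upper_def
    using encl_row_bounds [OF assms] pzeta_nonneg by (intro hom_upper_ge) (auto simp: encl_def)
  moreover have "row_upper r \<noteq> []" unfolding row_upper_def by (metis length_hom_upper list.size(3) nat.distinct(1))
  ultimately show ?thesis by (simp add: axp_eq_hom hd_conv_nth)
qed

section \<open>The tail recursion in integer arithmetic\<close>

definition exp_step :: "int \<Rightarrow> int \<Rightarrow> int \<Rightarrow> int \<Rightarrow> int" where
  "exp_step l r j e = e * l div (j * 1099511627776) + r"

fun exp_terms :: "nat \<Rightarrow> int \<Rightarrow> int \<Rightarrow> int \<Rightarrow> int \<Rightarrow> int list" where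
  "exp_terms 0 l r j e = []"
| "exp_terms (Suc n) l r j e = e # exp_terms n l r (j + 1) (exp_step l r (j + 1) e)"

lemma length_exp_terms [simp]: "length (exp_terms n l r j e) = n"
  by (induction n arbitrary: j e) auto

lemma scaled_mult_div:
  "(2 ^ 40 * a) * (2 ^ 40 * b) / real_of_int ((int m + 1) * 1099511627776) = 2 ^ 40 * (a * b / (real m + 1))"
proof -
  have "(2 ^ 40 * a) * (2 ^ 40 * b) = 2 ^ 40 * (2 ^ 40 * (a * b))"
    and "real_of_int ((int m + 1) * 1099511627776) = 2 ^ 40 * (real m + 1)" by simp_all
  moreover have "2 ^ 40 * (2 ^ 40 * (a * b)) / (2 ^ 40 * (real m + 1)) = 2 ^ 40 * (a * b) / (real m + 1)"
    by (rule mult_divide_mult_cancel_left) simp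
  ultimately show ?thesis by (simp only: times_divide_eq_right)
qed

lemma exp_terms_lower:
  assumes "0 \<le> l" "real_of_int l \<le> 2 ^ 40 * x" "0 \<le> e" "real_of_int e \<le> 2 ^ 40 * (x ^ m / fact m)" "i < n"
  shows "0 \<le> exp_terms n l 0 (int m) e ! i \<and>
    real_of_int (exp_terms n l 0 (int m) e ! i) \<le> 2 ^ 40 * (x ^ (m + i) / fact (m + i))"
  using assms(3-5)
proof (induction n arbitrary: m e i)
  case (Suc n)
  show ?case
  proof (cases i)
    case (Suc j)
    have x0: "0 \<le> 2 ^ 40 * x" using assms(1,2) by linarith
    have "real_of_int (exp_step l 0 (int m + 1) e) \<le> real_of_int (e * l) / real_of_int ((int m + 1) * 1099511627776)"
      unfolding exp_step_def using div_bounds(1) [of "(int m + 1) * 1099511627776" "e * l"] by simp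
    also have "\<dots> \<le> (2 ^ 40 * (x ^ m / fact m)) * (2 ^ 40 * x) / real_of_int ((int m + 1) * 1099511627776)"
      unfolding of_int_mult [of e] using Suc.prems assms(1,2) x0 by (intro divide_right_mono mult_mono) auto
    also have "\<dots> = 2 ^ 40 * (x ^ m / fact m * x / (real m + 1))"
      by (rule scaled_mult_div)
    also have "x ^ m / fact m * x / (real m + 1) = x ^ Suc m / fact (Suc m)"
      by (simp add: field_simps)
    finally have 1: "real_of_int (exp_step l 0 (int m + 1) e) \<le> 2 ^ 40 * (x ^ Suc m / fact (Suc m))" .
    have 0: "0 \<le> exp_step l 0 (int m + 1) e"
      using Suc.prems assms(1) by (simp add: exp_step_def pos_imp_zdiv_nonneg_iff)
    show ?thesis
      using Suc.IH [OF 0 1, of j] Suc.prems Suc by (simp add: add_ac)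
  qed (use Suc.prems in simp)
qed simp

lemma exp_terms_upper:
  assumes "0 \<le> x" "2 ^ 40 * x \<le> real_of_int l" "2 ^ 40 * (x ^ m / fact m) \<le> real_of_int e" "i < n"
  shows "2 ^ 40 * (x ^ (m + i) / fact (m + i)) \<le> real_of_int (exp_terms n l 1 (int m) e ! i)"
  using assms(3-4)
proof (induction n arbitrary: m e i)
  case (Suc n)
  show ?case
  proof (cases i)
    case (Suc j)
    have l0: "0 \<le> real_of_int l" using assms(1,2) by (smt (verit) mult_nonneg_nonneg zero_le_power)
    have e0: "0 \<le> 2 ^ 40 * (x ^ m / fact m)" using assms(1) by simp
    then have e1: "0 \<le> real_of_int e" using Suc.prems(1) by linarith
    have "x ^ Suc m / fact (Suc m) = x ^ m / fact m * x / (real m + 1)"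
      by (simp add: field_simps)
    then have "2 ^ 40 * (x ^ Suc m / fact (Suc m))
        = (2 ^ 40 * (x ^ m / fact m)) * (2 ^ 40 * x) / real_of_int ((int m + 1) * 1099511627776)"
      unfolding scaled_mult_div by (simp only:)
    also have "\<dots> \<le> real_of_int (e * l) / real_of_int ((int m + 1) * 1099511627776)"
      unfolding of_int_mult [of e] using Suc.prems assms(1,2) l0 e0 e1 by (intro divide_right_mono mult_mono) auto
    also have "\<dots> \<le> real_of_int (exp_step l 1 (int m + 1) e)"
      unfolding exp_step_def using div_bounds(2) [of "(int m + 1) * 1099511627776" "e * l"] by simp
    finally have 1: "2 ^ 40 * (x ^ Suc m / fact (Suc m)) \<le> real_of_int (exp_step l 1 (int m + 1) e)" .
    show ?thesis
      using Suc.IH [OF 1, of j] Suc.prems Suc by (simp add: add_ac)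
  qed (use Suc.prems in simp)
qed simp

text \<open>\<open>4 / 65536\<close> is \<open>2 * octave_t 16\<close>. The allowance
  \<open>r\<close> is \<open>0\<close> for lower bounds and \<open>2\<close> for upper bounds, one
  unit for each of the two divisions.\<close>

definition tail_step :: "int list \<Rightarrow> int \<Rightarrow> int \<Rightarrow> int list \<Rightarrow> int list" where
  "tail_step es r q ts = (4 * q div 65536 + dot es ts div 1099511627776 + r) # ts"

fun tail_terms :: "int list \<Rightarrow> int \<Rightarrow> int list \<Rightarrow> int list" where
  "tail_terms es r [] = []"
| "tail_terms es r (q # qs) = tail_step es r q (tail_terms es r qs)"

lemma length_tail_terms [simp]: "length (tail_terms es r qs) = length qs"
  by (induction qs) (auto simp: tail_step_def)

lemma sum_rec_shift: "(\<Sum>j=1..k. c j * V (k - j)) = (\<Sum>i<k. c (Suc i) * V (k - 1 - i))"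
  for c V :: "nat \<Rightarrow> real"
  by (rule sum.reindex_bij_witness [of _ Suc "\<lambda>j. j - 1"]) auto

lemma tail_terms_lower:
  assumes rec: "\<And>k. 4 / 65536 * Q k + (\<Sum>j=1..k. c j * V (k - j)) \<le> V k"
    and es: "\<And>i. i < length es \<Longrightarrow> 0 \<le> es ! i \<and> real_of_int (es ! i) \<le> 2 ^ 40 * c (Suc i)"
    and c: "\<And>i. 0 \<le> c i" and V: "\<And>k. 0 \<le> V k"
    and qs: "\<And>i. i < length qs \<Longrightarrow> 0 \<le> qs ! i \<and> real_of_int (qs ! i) \<le> 2 ^ 40 * Q (length qs - 1 - i)"
    and "i < length qs"
  shows "0 \<le> tail_terms es 0 qs ! i \<and> real_of_int (tail_terms es 0 qs ! i) \<le> 2 ^ 40 * V (length qs - 1 - i)"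
  using qs \<open>i < length qs\<close>
proof (induction qs arbitrary: i)
  case (Cons q qs)
  have qs: "0 \<le> qs ! i \<and> real_of_int (qs ! i) \<le> 2 ^ 40 * Q (length qs - 1 - i)" if "i < length qs" for i
    using Cons.prems(1) [of "Suc i"] that by (simp add: diff_diff_left)
  note IH = Cons.IH [OF qs]
  show ?case
  proof (cases i)
    case 0
    define k where "k = length qs"
    define D where "D = dot es (tail_terms es 0 qs)"
    have D: "0 \<le> D \<and> real_of_int D \<le> 2 ^ 80 * (\<Sum>i<length (tail_terms es 0 qs). c (Suc i) * V (k - 1 - i))"
      unfolding D_def using es IH c V by (intro dot_le) (auto simp: k_def)
    have q: "0 \<le> q" "real_of_int q \<le> 2 ^ 40 * Q k" using Cons.prems(1) [of 0] by (simp_all add: k_def)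
    have "real_of_int (4 * q div 65536) \<le> 2 ^ 40 * (4 / 65536 * Q k)"
      using div_bounds(1) [of 65536 "4 * q"] q by simp
    moreover have "real_of_int (D div 1099511627776) \<le> 2 ^ 40 * (\<Sum>j=1..k. c j * V (k - j))"
      using div_bounds(1) [of 1099511627776 D] D unfolding sum_rec_shift by (simp add: k_def)
    moreover have "2 ^ 40 * (4 / 65536 * Q k + (\<Sum>j=1..k. c j * V (k - j))) \<le> 2 ^ 40 * V k"
      using rec [of k] by (intro mult_left_mono) auto
    ultimately have "real_of_int (4 * q div 65536 + D div 1099511627776) \<le> 2 ^ 40 * V k"
      unfolding distrib_left of_int_add by linarith
    then show ?thesis
      using 0 q D by (simp add: tail_step_def D_def k_def pos_imp_zdiv_nonneg_iff)
  next
    case (Suc j)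
    then show ?thesis using IH [of j] Cons.prems by (simp add: tail_step_def diff_diff_left)
  qed
qed simp

text \<open>The computed list itself defines the majorant \<open>V\<close>, and the conclusion is
  the inequality that \<open>axtail_upper\<close> demands of it. \<open>rev\<close> converts the
  newest-first order into indexing by \<open>k\<close>.\<close>

lemma tail_terms_upper:
  assumes es: "\<And>i. i < length es \<Longrightarrow> 2 ^ 40 * c (Suc i) \<le> real_of_int (es ! i)"
    and c: "\<And>i. 0 \<le> c i"
    and qs: "\<And>k. k < length qs \<Longrightarrow> 0 \<le> Q k \<and> 2 ^ 40 * Q k \<le> real_of_int (rev qs ! k)"
    and "length qs \<le> Suc (length es)"
  defines "V \<equiv> \<lambda>k. real_of_int (rev (tail_terms es 2 qs) ! k) / 2 ^ 40"
  assumes k: "k < length qs"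
  shows "0 \<le> V k" "4 / 65536 * Q k + (\<Sum>j=1..k. c j * V (k - j)) \<le> V k"
proof -
  have "\<forall>k<length qs. 0 \<le> real_of_int (rev (tail_terms es 2 qs) ! k) / 2 ^ 40 \<and>
    4 / 65536 * Q k + (\<Sum>j=1..k. c j * (real_of_int (rev (tail_terms es 2 qs) ! (k - j)) / 2 ^ 40))
      \<le> real_of_int (rev (tail_terms es 2 qs) ! k) / 2 ^ 40"
    using qs \<open>length qs \<le> Suc (length es)\<close>
  proof (induction qs)
    case (Cons q qs)
    define n where "n = length qs"
    define ts where "ts = tail_terms es 2 qs"
    define v where "v = 4 * q div 65536 + dot es ts div 1099511627776 + 2"
    define V where "V k = real_of_int (rev ts ! k) / 2 ^ 40" for k
    define V' where "V' k = real_of_int (rev (tail_terms es 2 (q # qs)) ! k) / 2 ^ 40" for k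
    have len: "length ts = n" by (simp add: ts_def n_def)
    have V': "V' k = (if k < n then V k else v / 2 ^ 40)" if "k \<le> n" for k
      using that len by (auto simp: V'_def V_def tail_step_def ts_def v_def nth_append)
    have qs: "0 \<le> Q k \<and> 2 ^ 40 * Q k \<le> real_of_int (rev qs ! k)" if "k < length qs" for k
      using Cons.prems(1) [of k] that by (simp add: nth_append)
    have IH: "0 \<le> V k" "4 / 65536 * Q k + (\<Sum>j=1..k. c j * V (k - j)) \<le> V k" if "k < n" for k
      using Cons.IH [OF qs] Cons.prems(2) that by (auto simp: V_def ts_def n_def)
    have q: "0 \<le> Q n" "2 ^ 40 * Q n \<le> real_of_int q"
      using Cons.prems(1) [of n] by (simp_all add: n_def nth_append)
    have "2 ^ 80 * (\<Sum>i<length ts. c (Suc i) * (if i < n then V (n - 1 - i) else 0)) \<le> real_of_int (dot es ts)"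
    proof (rule dot_ge)
      fix i assume i: "i < length ts"
      then have "ts ! i = rev ts ! (n - 1 - i)" using len by (simp add: rev_nth)
      then show "2 ^ 40 * (if i < n then V (n - 1 - i) else 0) \<le> real_of_int (ts ! i)"
        using i len by (simp add: V_def)
    qed (use es c IH Cons.prems(2) len n_def in auto)
    also have "(\<Sum>i<length ts. c (Suc i) * (if i < n then V (n - 1 - i) else 0)) = (\<Sum>j=1..n. c j * V (n - j))"
      unfolding sum_rec_shift using len by (intro sum.cong) auto
    finally have "2 ^ 40 * (\<Sum>j=1..n. c j * V (n - j)) \<le> real_of_int (dot es ts) / real_of_int 1099511627776" by simp
    also have "\<dots> \<le> real_of_int (dot es ts div 1099511627776 + 1)" by (rule div_bounds) simp
    finally have 1: "2 ^ 40 * (\<Sum>j=1..n. c j * V (n - j)) \<le> real_of_int (dot es ts div 1099511627776 + 1)" .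
    have "2 ^ 40 * (4 / 65536 * Q n) \<le> real_of_int (4 * q) / real_of_int 65536"
      using q by simp
    also have "\<dots> \<le> real_of_int (4 * q div 65536 + 1)" by (rule div_bounds) simp
    finally have "2 ^ 40 * (4 / 65536 * Q n + (\<Sum>j=1..n. c j * V (n - j))) \<le> real_of_int v"
      using 1 unfolding v_def distrib_left by simp
    then have new: "4 / 65536 * Q n + (\<Sum>j=1..n. c j * V (n - j)) \<le> V' n" by (simp add: V')
    have "0 \<le> (\<Sum>j=1..n. c j * V (n - j))"
      using c IH by (intro sum_nonneg mult_nonneg_nonneg) auto
    then have new0: "0 \<le> V' n" using new q by simp
    have "0 \<le> V' k \<and> 4 / 65536 * Q k + (\<Sum>j=1..k. c j * V' (k - j)) \<le> V' k" if "k < length (q # qs)" for k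
    proof -
      have k: "k \<le> n" using that by (simp add: n_def)
      have "(\<Sum>j=1..k. c j * V' (k - j)) = (\<Sum>j=1..k. c j * V (k - j))"
        using k by (intro sum.cong refl) (auto simp: V')
      then show ?thesis
        using new new0 IH [of k] k V' [OF k] by (cases "k = n") auto
    qed
    then show ?case by (simp add: V'_def)
  qed simp
  then show "0 \<le> V k" "4 / 65536 * Q k + (\<Sum>j=1..k. c j * V (k - j)) \<le> V k"
    using k by (simp_all add: V_def)
qed

fun row_acc_lower :: "row list \<Rightarrow> int list \<Rightarrow> int list" where
  "row_acc_lower [] s = s"
| "row_acc_lower (r # rs) s = map2 (\<lambda>q x. 2 * q div fst r + x) (row_lower r) (row_acc_lower rs s)"

fun row_acc_upper :: "row list \<Rightarrow> int \<Rightarrow> int" where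
  "row_acc_upper [] s = s"
| "row_acc_upper (r # rs) s = 2 * hd (row_upper r) div fst r + 1 + row_acc_upper rs s"

lemma row_acc_lower_le:
  assumes "\<And>i. i < length rs \<Longrightarrow> row_ok (m + i) (rs ! i)" "length s = 26"
    and "\<And>j. j \<le> 25 \<Longrightarrow> real_of_int (s ! j) \<le> 2 ^ 40 * X (25 - j)" "j \<le> 25"
  shows "length (row_acc_lower rs s) = 26 \<and> real_of_int (row_acc_lower rs s ! j) \<le>
     2 ^ 40 * ((\<Sum>i<length rs. octave_t (m + i) * axp (25 - j) (m + i)) + X (25 - j))"
  using assms(1)
proof (induction rs arbitrary: m)
  case (Cons r rs)
  have IH: "length (row_acc_lower rs s) = 26 \<and> real_of_int (row_acc_lower rs s ! j) \<le>
     2 ^ 40 * ((\<Sum>i<length rs. octave_t (Suc m + i) * axp (25 - j) (Suc m + i)) + X (25 - j))"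
    using Cons.prems [of "Suc i" for i] by (intro Cons.IH) auto
  have r: "row_ok m r" using Cons.prems [of 0] by simp
  have d: "fst r = 2 ^ m" using r by (cases r) auto
  have "real_of_int (2 * row_lower r ! j div fst r) \<le> real_of_int (2 * row_lower r ! j) / real_of_int (fst r)"
    unfolding d by (rule div_bounds) simp
  also have "\<dots> \<le> 2 * (2 ^ 40 * axp (25 - j) m) / real_of_int (fst r)"
    using row_lower_le [OF r assms(4)] d by (intro divide_right_mono) auto
  also have "\<dots> = 2 ^ 40 * (octave_t m * axp (25 - j) m)"
    by (simp add: d octave_t_def)
  finally have 1: "real_of_int (2 * row_lower r ! j div fst r) \<le> 2 ^ 40 * (octave_t m * axp (25 - j) m)" .
  have len: "length (row_lower r) = 26" by (simp add: row_lower_def)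
  have 2: "(\<Sum>i<length (r # rs). octave_t (m + i) * axp (25 - j) (m + i))
     = octave_t m * axp (25 - j) m + (\<Sum>i<length rs. octave_t (Suc m + i) * axp (25 - j) (Suc m + i))"
    by (simp add: sum.lessThan_Suc_shift del: sum.lessThan_Suc)
  show ?case
    unfolding 2 using IH 1 len assms(4) by (simp add: algebra_simps)
qed (use assms in simp)

lemma row_acc_upper_ge:
  assumes "\<And>i. i < length rs \<Longrightarrow> row_ok (m + i) (rs ! i)"
  shows "2 ^ 40 * (\<Sum>i<length rs. octave_t (m + i) * axp 6 (m + i)) + real_of_int s \<le> real_of_int (row_acc_upper rs s)"
  using assms
proof (induction rs arbitrary: m)
  case (Cons r rs)
  have IH: "2 ^ 40 * (\<Sum>i<length rs. octave_t (Suc m + i) * axp 6 (Suc m + i)) + real_of_int s \<le> real_of_int (row_acc_upper rs s)"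
    using Cons.prems [of "Suc i" for i] by (intro Cons.IH) auto
  have r: "row_ok m r" using Cons.prems [of 0] by simp
  have d: "fst r = 2 ^ m" using r by (cases r) auto
  have "2 ^ 40 * (octave_t m * axp 6 m) = 2 * (2 ^ 40 * axp 6 m) / real_of_int (fst r)"
    by (simp add: d octave_t_def)
  also have "\<dots> \<le> real_of_int (2 * hd (row_upper r)) / real_of_int (fst r)"
    using row_upper_ge [OF r] d by (intro divide_right_mono) auto
  also have "\<dots> \<le> real_of_int (2 * hd (row_upper r) div fst r + 1)"
    unfolding d by (rule div_bounds) simp
  finally have 1: "2 ^ 40 * (octave_t m * axp 6 m) \<le> real_of_int (2 * hd (row_upper r) div fst r + 1)" .
  have 2: "(\<Sum>i<length (r # rs). octave_t (m + i) * axp 6 (m + i))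
     = octave_t m * axp 6 m + (\<Sum>i<length rs. octave_t (Suc m + i) * axp 6 (Suc m + i))"
    by (simp add: sum.lessThan_Suc_shift del: sum.lessThan_Suc)
  show ?case
    unfolding 2 using IH 1 by (simp add: algebra_simps)
qed simp

text \<open>Lower bounds for \<open>2^40 * axtail 4 k\<close>, beginning with \<open>k = 25\<close>;
  \<open>full_table\<close> contains those for \<open>axtail 0 k\<close>.\<close>

definition tail_table :: "int list" where
  "tail_table =
    [1583658522589, 1583797474892, 1583935941124, 1584073460783, 1584209175001, 1584341507208, 1584467609361, 1584582417787, 1584677068806, 1584736276119, 1584734031319, 1584626579340, 1584340897240, 1583755580088, 1582668471822, 1580740401135, 1577393336938, 1571609643725, 1561481312946, 1543129382805, 1508351062447, 1440475184218, 1309136973779, 1071676241950, 703144908528, 274877906944]"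

definition full_table :: "int list" where
  "full_table =
    [1583658522769, 1583797475419, 1583935942662, 1584073465223, 1584209187727, 1584341543391, 1584467711346, 1584582702512, 1584677855571, 1584738427452, 1584739855207, 1584642195335, 1584382346089, 1583864295668, 1582949486891, 1581454059863, 1579170536752, 1575955945346, 1571985037196, 1568400880346, 1568610976016, 1582027825118, 1635004564208, 1810930980022, 2421055860680, 4398046511104]"

text \<open>At \<open>t = 0\<close> these bound the limits \<open>pzeta j\<close> for
  \<open>j \<ge> 2\<close>. The dummy entry at the pole is replaced in \<open>upper_row\<close> by
  the value from row \<open>16\<close>.\<close>

definition limit_row :: "int list" where
  "limit_row = map snd (bpz 0 1 0 bone bone bone bone)"

definition upper_row :: "int list" where
  "upper_row = hom_upper (snd (row_bounds (rows ! 16) ! 0) # tl limit_row) 6"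

lemma tail_table_eq:
  "row_acc_lower (take 12 (drop 4 rows)) (tail_terms (exp_terms 25 762056275921 0 1 762056275921) 0 (row_lower (rows ! 16)))
     = tail_table"
  by code_simp

lemma full_table_eq: "row_acc_lower (take 4 rows) tail_table = full_table"
  by code_simp

lemma upper_eq:
  "row_acc_upper (take 16 rows) (hd (tail_terms (exp_terms 6 762123384787 1 1 762123384787) 2 upper_row)) = 1568438139057"
  by code_simp

text \<open>The first comparison is closest at \<open>k = 5\<close>. The second one starts the
  induction for large indices; \<open>137 / 10000\<close> lies just below the smallest excess, which
  occurs at \<open>k = 25\<close>.\<close>

lemma tables_ok:
  "list_all (\<lambda>k. k = 6 \<or> 1568438139057 * 1442756 < full_table ! (25 - k) * 1442640) [1..<26]"
  "list_all (\<lambda>k. 1568438139057 * 1442756 * 10000 + 137 * 1099511627776 * 1442640 \<le> tail_table ! (25 - k) * 14426400000) [20..<26]"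
  by code_simp+

lemma length_rows: "length rows = 17"
  by (simp add: rows_def)

lemma axtail_16_lower:
  assumes "k \<le> 25"
  shows "real_of_int (tail_terms (exp_terms 25 762056275921 0 1 762056275921) 0 (row_lower (rows ! 16)) ! (25 - k))
     \<le> 2 ^ 40 * axtail 16 k"
proof -
  \<comment> \<open>The integer is the lower bound \<open>762123384785\<close> for
    \<open>2^40 * ln 2\<close> minus \<open>2^40 * 2 * octave_t 16 = 2^26\<close>.\<close>
  define l :: real where "l = 762056275921 / 2 ^ 40"
  have l: "0 \<le> l" "l \<le> ln 2 - 2 * octave_t 16"
    using ln2_bounds by (simp_all add: l_def octave_t_def)
  have len: "length (row_lower (rows ! 16)) = 26" by (simp add: row_lower_def)
  have es: "0 \<le> exp_terms 25 762056275921 0 1 762056275921 ! i \<and>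
      real_of_int (exp_terms 25 762056275921 0 1 762056275921 ! i) \<le> 2 ^ 40 * (l ^ Suc i / fact (Suc i))" if "i < 25" for i
    using exp_terms_lower [of 762056275921 l 762056275921 1 i 25] that by (simp add: l_def)
  have "0 \<le> tail_terms (exp_terms 25 762056275921 0 1 762056275921) 0 (row_lower (rows ! 16)) ! (25 - k) \<and>
    real_of_int (tail_terms (exp_terms 25 762056275921 0 1 762056275921) 0 (row_lower (rows ! 16)) ! (25 - k))
     \<le> 2 ^ 40 * axtail 16 (length (row_lower (rows ! 16)) - 1 - (25 - k))"
  proof (rule tail_terms_lower [where c = "\<lambda>j. l ^ j / fact j" and Q = "\<lambda>k. axp k 16"])
    show "4 / 65536 * axp k 16 + (\<Sum>j=1..k. l ^ j / fact j * axtail 16 (k - j)) \<le> axtail 16 k" for k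
      using axtail_rec_lower [OF _ l, of k] by (simp add: octave_t_def)
    show "0 \<le> row_lower (rows ! 16) ! i \<and> real_of_int (row_lower (rows ! 16) ! i)
        \<le> 2 ^ 40 * axp (length (row_lower (rows ! 16)) - 1 - i) 16" if "i < length (row_lower (rows ! 16))" for i
      using row_lower_le [OF row_ok_rows, of 16 i] that len by simp
  qed (use es l axtail_nonneg len assms in auto)
  then show ?thesis using len assms by simp
qed

lemma axtail_add: "axtail m k = (\<Sum>i<n. octave_t (m + i) * axp k (m + i)) + axtail (m + n) k"
proof (induction n)
  case (Suc n)
  then show ?case using axtail_split [of "m + n" k] by simp
qed simp

lemma tail_table_le:
  assumes "k \<le> 25"
  shows "real_of_int (tail_table ! (25 - k)) \<le> 2 ^ 40 * axtail 4 k"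
proof -
  have len: "length (take 12 (drop 4 rows)) = 12" by (simp add: length_rows)
  have "real_of_int (tail_table ! (25 - k)) \<le> 2 ^ 40 * ((\<Sum>i<length (take 12 (drop 4 rows)). octave_t (4 + i) * axp (25 - (25 - k)) (4 + i))
      + axtail 16 (25 - (25 - k)))"
    unfolding tail_table_eq [symmetric]
  proof (rule row_acc_lower_le [THEN conjunct2])
    show "row_ok (4 + i) (take 12 (drop 4 rows) ! i)" if "i < length (take 12 (drop 4 rows))" for i
      using that len row_ok_rows [of "4 + i"] by (simp add: length_rows)
    show "real_of_int (tail_terms (exp_terms 25 762056275921 0 1 762056275921) 0 (row_lower (rows ! 16)) ! j)
        \<le> 2 ^ 40 * axtail 16 (25 - j)" if "j \<le> 25" for j
      using axtail_16_lower [of "25 - j"] that by simp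
  qed (simp_all add: row_lower_def)
  then show ?thesis using assms axtail_add [of 4 k 12] len by simp
qed

lemma full_table_le:
  assumes "k \<le> 25"
  shows "real_of_int (full_table ! (25 - k)) \<le> 2 ^ 40 * axtail 0 k"
proof -
  have len: "length (take 4 rows) = 4" by (simp add: length_rows)
  have "real_of_int (full_table ! (25 - k)) \<le> 2 ^ 40 * ((\<Sum>i<length (take 4 rows). octave_t (0 + i) * axp (25 - (25 - k)) (0 + i))
      + axtail 4 (25 - (25 - k)))"
    unfolding full_table_eq [symmetric]
  proof (rule row_acc_lower_le [THEN conjunct2])
    show "row_ok (0 + i) (take 4 rows ! i)" if "i < length (take 4 rows)" for i
      using that len row_ok_rows [of i] by simp
    show "real_of_int (tail_table ! j) \<le> 2 ^ 40 * axtail 4 (25 - j)" if "j \<le> 25" for j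
      using tail_table_le [of "25 - j"] that by simp
  qed (simp_all add: tail_table_def)
  then show ?thesis using assms axtail_add [of 0 k 4] len by simp
qed

text \<open>The nodes \<open>i < 16\<close> are evaluated row by row. The infinite rest is majorised
  by \<open>axtail_upper\<close>, starting from the enclosure of
  \<open>pzeta (1 + octave_t 16)\<close>.\<close>

lemma sum_axp_6_le: "(\<Sum>i<M. octave_t i * axp 6 i) \<le> 1568438139057 / 2 ^ 40"
proof -
  define es where "es = exp_terms 6 762123384787 1 1 762123384787"
  define P where "P = real_of_int (snd (row_bounds (rows ! 16) ! 0)) / 2 ^ 40"
  define p where "p j = (if j = 1 then P else pzeta (real j))" for j :: nat
  have P: "pzeta (1 + octave_t 16) \<le> P"
    using encl_row_bounds [OF row_ok_rows, of 16 0] by (simp add: encl_def P_def)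
  have P0: "0 \<le> P" using P pzeta_nonneg [of "1 + octave_t 16"] by linarith
  have lim: "2 ^ 40 * pzeta (real (Suc i)) \<le> real_of_int (limit_row ! i)" if "1 \<le> i" "i < 8" for i
    using encl_bpz [of 0 0 1 bone bone bone bone i 0] that encl_one by (simp add: limit_row_def encl_def)
  have len_lim: "length limit_row = 8" by (simp add: limit_row_def)
  define U where "U = snd (row_bounds (rows ! 16) ! 0) # tl limit_row"
  have lenU: "length U = 8" using len_lim by (simp add: U_def)
  have U: "2 ^ 40 * p (Suc i) \<le> real_of_int (U ! i)" if "i < length U" for i
  proof (cases i)
    case (Suc m)
    then show ?thesis using lim [of i] that lenU len_lim by (simp add: U_def p_def nth_tl)
  qed (simp add: U_def p_def P_def)
  have ur: "upper_row = hom_upper U 6" by (simp add: upper_row_def U_def)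
  have len: "length upper_row = 7" by (simp add: ur)
  have hom: "0 \<le> hom p k \<and> 2 ^ 40 * hom p k \<le> real_of_int (rev upper_row ! k)" if "k < length upper_row" for k
  proof -
    have p0: "0 \<le> p j" if "1 \<le> j" for j using P0 pzeta_nonneg by (simp add: p_def)
    have "2 ^ 40 * hom p (6 - (6 - k)) \<le> real_of_int (hom_upper U 6 ! (6 - k))"
      using lenU by (intro hom_upper_ge U p0) auto
    then show ?thesis using hom_nonneg [of p k] p0 that len by (simp add: rev_nth ur)
  qed
  have es: "2 ^ 40 * (ln 2 ^ Suc i / fact (Suc i)) \<le> real_of_int (es ! i)" if "i < length es" for i
    using exp_terms_upper [of "ln 2" 762123384787 1 762123384787 i 6] ln2_bounds that by (simp add: es_def)
  define V where "V = (\<lambda>k. real_of_int (rev (tail_terms es 2 upper_row) ! k) / 2 ^ 40)"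
  have rec: "4 / 65536 * hom p k + (\<Sum>j=1..k. ln 2 ^ j / fact j * V (k - j)) \<le> V k" if "k \<le> 6" for k
    unfolding V_def using es hom that len
    by (intro tail_terms_upper(2) [where c = "\<lambda>j. ln 2 ^ j / fact j"]) (auto simp: es_def)
  have tail: "(\<Sum>i<N. octave_t (i + 16) * axp 6 (i + 16)) \<le> V 6" for N
  proof (rule axtail_upper [OF _ P, where K = 6])
    show "2 * octave_t 16 * hom (\<lambda>j. if j = 1 then P else pzeta (real j)) k
       + (\<Sum>j=1..k. ln 2 ^ j / fact j * V (k - j)) \<le> V k" if "k \<le> 6" for k
      using rec [OF that] by (simp add: octave_t_def p_def [abs_def])
  qed auto
  have V6: "2 ^ 40 * V 6 = real_of_int (hd (tail_terms es 2 upper_row))"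
    using len by (simp add: V_def rev_nth hd_conv_nth length_0_conv [symmetric] del: length_0_conv)
  have lenr: "length (take 16 rows) = 16" by (simp add: length_rows)
  have "2 ^ 40 * (\<Sum>i<length (take 16 rows). octave_t (0 + i) * axp 6 (0 + i)) + real_of_int (hd (tail_terms es 2 upper_row))
      \<le> real_of_int (row_acc_upper (take 16 rows) (hd (tail_terms es 2 upper_row)))"
    using row_ok_rows lenr by (intro row_acc_upper_ge) auto
  also have "row_acc_upper (take 16 rows) (hd (tail_terms es 2 upper_row)) = 1568438139057"
    unfolding es_def by (rule upper_eq)
  finally have main: "2 ^ 40 * ((\<Sum>i<16. octave_t i * axp 6 i) + V 6) \<le> 1568438139057"
    using V6 lenr by (simp add: algebra_simps)
  have "(\<Sum>i<M. octave_t i * axp 6 i) \<le> (\<Sum>i<16 + M. octave_t i * axp 6 i)"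
    using octave_t_pos axp_nonneg by (intro sum_mono2) (auto simp: less_imp_le)
  also have "\<dots> = (\<Sum>i<16. octave_t i * axp 6 i) + (\<Sum>i<M. octave_t (i + 16) * axp 6 (i + 16))"
  proof (induction M)
    case (Suc M)
    then show ?case unfolding add_Suc_right sum.lessThan_Suc by (simp add: add_ac)
  qed simp
  also have "\<dots> \<le> (\<Sum>i<16. octave_t i * axp 6 i) + V 6" using tail [of M] by simp
  finally show ?thesis using main by simp
qed

lemma axtail_le_erdos_sum:
  assumes "1 \<le> k"
  shows "axtail 0 k \<le> 1442756 / 1000000 * erdos_sum (almost_primes k)"
    and "axtail 4 k \<le> 1442756 / 1000000 * erdos_sum (almost_primes k)"
proof -
  have "(\<lambda>M. \<Sum>i<M. octave_t i * axp k i) \<longlonglongrightarrow> axtail 0 k"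
    using summable_LIMSEQ [OF summable_axtail [of 0 k]] by (simp add: axtail_def)
  then show 1: "axtail 0 k \<le> 1442756 / 1000000 * erdos_sum (almost_primes k)"
    by (rule LIMSEQ_le_const2) (use erdos_sum_ge [OF assms] in auto)
  have "axtail 4 k \<le> axtail 0 k"
    using axtail_add [of 0 k 4] octave_t_pos axp_nonneg by (simp add: sum_nonneg less_imp_le)
  with 1 show "axtail 4 k \<le> 1442756 / 1000000 * erdos_sum (almost_primes k)" by linarith
qed

text \<open>The factor \<open>1442756 / 1442640\<close> is the price for the octave sum not being
  exactly constant.\<close>

lemma erdos_sum_6_less:
  assumes "1 \<le> k" "(1568438139057 / 2 ^ 40) * (1442756 / 1442640) < axtail 0 k \<or> (1568438139057 / 2 ^ 40) * (1442756 / 1442640) < axtail 4 k"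
  shows "erdos_sum (almost_primes 6) < erdos_sum (almost_primes k)"
proof -
  have "erdos_sum (almost_primes 6) \<le> (1568438139057 / 2 ^ 40) / (144264 / 100000)"
    using erdos_sum_6_le [OF sum_axp_6_le] by simp
  also have "\<dots> = (1568438139057 / 2 ^ 40) * (1442756 / 1442640) / (1442756 / 1000000)" by simp
  also have "\<dots> < erdos_sum (almost_primes k)"
    using assms(2) axtail_le_erdos_sum [OF assms(1)] by auto
  finally show ?thesis .
qed

lemma erdos_sum_6_less_small:
  assumes "1 \<le> k" "k \<le> 25" "k \<noteq> 6"
  shows "erdos_sum (almost_primes 6) < erdos_sum (almost_primes k)"
proof (rule erdos_sum_6_less [OF assms(1)])
  have "1568438139057 * 1442756 < full_table ! (25 - k) * 1442640"
    using tables_ok(1) assms unfolding list_all_iff set_upt by auto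
  then have "real_of_int (1568438139057 * 1442756) < real_of_int (full_table ! (25 - k) * 1442640)"
    by (simp only: of_int_less_iff)
  then show "(1568438139057 / 2 ^ 40) * (1442756 / 1442640) < axtail 0 k \<or> (1568438139057 / 2 ^ 40) * (1442756 / 1442640) < axtail 4 k"
    using full_table_le [OF assms(2)] by simp
qed

section \<open>The renewal inequality for large indices\<close>

lemma sum_power_over_le_ln:
  fixes y :: real
  assumes "0 \<le> y" "y < 1"
  shows "(\<Sum>j=2..k. y ^ j / real j) \<le> - ln (1 - y) - y"
proof -
  have "(\<lambda>n. - ((- (- y)) ^ n) / real n) sums ln (1 + (- y))"
    using ln_series' [of "- y"] assms by simp
  from sums_minus [OF this] have s: "(\<lambda>n. y ^ n / real n) sums (- ln (1 - y))" by simp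
  have "(\<Sum>n\<in>insert 1 {2..k}. y ^ n / real n) \<le> (\<Sum>n. y ^ n / real n)"
    using s assms by (intro sum_le_suminf) (auto simp: sums_iff)
  also have "\<dots> = - ln (1 - y)" using s by (simp add: sums_iff)
  finally show ?thesis by simp
qed

lemma pzeta_2_le: "pzeta 2 \<le> 511 / 1000"
proof -
  have "pzeta 2 \<le> ln (zeta 2)"
    using sums_le [OF _ sums_zero pzeta_le_ln_zeta_sums [of 2]] pzeta_nonneg by simp
  also have "zeta 2 \<le> 5 / 3"
    using zeta_em(1) [of 2 1] by (simp add: em_main_def)
  then have "ln (zeta 2) \<le> ln (5 / 3)" using zeta_ge_1 [of 2] by simp
  also have "\<dots> \<le> 511 / 1000"
    using ln_approx_bounds [of "5 / 3" 4] by (simp add: eval_nat_numeral)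
  finally show ?thesis .
qed

text \<open>The prime \<open>2\<close> is treated exactly. The others contribute at most
  \<open>0.511 - 1 / 4 = 0.261\<close> at exponent \<open>2\<close> and decay at least like
  \<open>(1 / 3) ^ j\<close> from there.\<close>

lemma pzeta_nat_le:
  assumes "2 \<le> j"
  shows "pzeta (real j) \<le> (1 / 2) ^ j + 261 / 1000 * 9 * (1 / 3) ^ j"
proof -
  have split: "{p::nat. prime p} = {2} \<union> {p. prime p \<and> 2 < p}"
    using prime_ge_2_nat by (auto simp: le_less)
  define R where "R s = (\<Sum>\<^sub>\<infinity>p\<in>{p::nat. prime p \<and> 2 < p}. real p powr - s)" for s
  have R: "((\<lambda>p. real p powr - s) has_sum R s) {p. prime p \<and> 2 < p}" if "1 < s" for s
    unfolding R_def using that by (intro has_sum_infsum powr_summable_on)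
  have eq: "pzeta s = 2 powr - s + R s" if "1 < s" for s
  proof -
    have "((\<lambda>p. real p powr - s) has_sum 2 powr - s + R s) ({2} \<union> {p. prime p \<and> 2 < p})"
      using that by (intro has_sum_Un_disjoint R has_sum_finiteI) auto
    then show ?thesis
      using pzeta_has_sum [OF that] unfolding split [symmetric] by (auto dest: has_sum_unique)
  qed
  have "R (real j) \<le> (1 / 3) ^ (j - 2) * R 2"
  proof (rule has_sum_mono [OF R has_sum_cmult_right [OF R]])
    fix p :: nat assume "p \<in> {p. prime p \<and> 2 < p}"
    then have p: "3 \<le> real p" by auto
    have "real p powr - real j = (1 / real p) ^ j" "real p powr - 2 = (1 / real p) ^ 2"
      using p by (simp_all add: powr_minus_divide powr_realpow power_one_over)
    moreover have "(1 / real p) ^ j = (1 / real p) ^ (j - 2) * (1 / real p) ^ 2"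
    proof -
      have "j = (j - 2) + 2" using assms by simp
      then have "(1 / real p) ^ j = (1 / real p) ^ ((j - 2) + 2)" by (rule arg_cong)
      also have "\<dots> = (1 / real p) ^ (j - 2) * (1 / real p) ^ 2" by (rule power_add)
      finally show ?thesis .
    qed
    moreover have "(1 / real p) ^ (j - 2) * (1 / real p) ^ 2 \<le> (1 / 3) ^ (j - 2) * (1 / real p) ^ 2"
      using p by (intro mult_right_mono power_mono) (auto simp: field_simps)
    ultimately show "real p powr - real j \<le> (1 / 3) ^ (j - 2) * real p powr - 2" by simp
  qed (use assms in auto)
  also have "R 2 \<le> 261 / 1000"
    using eq [of 2] pzeta_2_le by (simp add: powr_neg_numeral)
  finally have "R (real j) \<le> (1 / 3) ^ (j - 2) * (261 / 1000)" by simp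
  moreover have "(1 / 3 :: real) ^ (j - 2) = 9 * (1 / 3) ^ j"
    using assms by (simp add: power_diff power2_eq_square)
  moreover have "(2 :: real) powr - real j = (1 / 2) ^ j"
    by (simp add: powr_minus_divide powr_realpow power_one_over)
  ultimately show ?thesis using eq [of "real j"] assms by simp
qed

lemma sum_pzeta_le: "(\<Sum>j=2..k. pzeta (real j) * (3 / 2) ^ j / real j) \<le> 109 / 100"
proof -
  have "(\<Sum>j=2..k. pzeta (real j) * (3 / 2) ^ j / real j)
      \<le> (\<Sum>j=2..k. (3 / 4) ^ j / real j + 2349 / 1000 * ((1 / 2) ^ j / real j))"
  proof (intro sum_mono)
    fix j assume "j \<in> {2..k}"
    then have "pzeta (real j) * (3 / 2) ^ j / real j \<le> ((1 / 2) ^ j + 261 / 1000 * 9 * (1 / 3) ^ j) * (3 / 2) ^ j / real j"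
      by (intro divide_right_mono mult_right_mono pzeta_nat_le) auto
    also have "((1 / 2) ^ j + 261 / 1000 * 9 * (1 / 3) ^ j) * (3 / 2) ^ j = (3 / 4 :: real) ^ j + 2349 / 1000 * (1 / 2) ^ j"
      by (simp add: distrib_right power_mult_distrib [symmetric])
    also have "((3 / 4 :: real) ^ j + 2349 / 1000 * (1 / 2) ^ j) / real j = (3 / 4) ^ j / real j + 2349 / 1000 * ((1 / 2) ^ j / real j)"
      by (simp add: add_divide_distrib)
    finally show "pzeta (real j) * (3 / 2) ^ j / real j \<le> (3 / 4) ^ j / real j + 2349 / 1000 * ((1 / 2) ^ j / real j)" .
  qed
  also have "\<dots> = (\<Sum>j=2..k. (3 / 4) ^ j / real j) + 2349 / 1000 * (\<Sum>j=2..k. (1 / 2) ^ j / real j)"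
    by (simp add: sum.distrib sum_distrib_left)
  also have "\<dots> \<le> (- ln (1 - 3 / 4) - 3 / 4) + 2349 / 1000 * (- ln (1 - 1 / 2) - 1 / 2)"
    by (intro add_mono mult_left_mono sum_power_over_le_ln) auto
  also have "\<dots> \<le> 109 / 100"
  proof -
    have l: "ln (1 - 3 / 4 :: real) = - (2 * ln 2)" "ln (1 - 1 / 2 :: real) = - ln 2"
      using ln_realpow [of 2 2] by (simp_all add: ln_div)
    show ?thesis unfolding l using ln2_bounds by (simp add: field_simps)
  qed
  finally show ?thesis .
qed

text \<open>Rankin's trick with the base \<open>3 / 2\<close>.\<close>

lemma axp_rankin:
  assumes "4 \<le> i"
  shows "octave_t i ^ 2 * axp k i \<le> 342 / 100 * (2 / 3) ^ k * sqrt (octave_t i)"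
proof -
  define t where "t = octave_t i"
  have t: "0 < t" "t \<le> 1 / 8" using octave_t_pos octave_t_small [OF assms] by (simp_all add: t_def)
  define E where "E = (\<Sum>j=1..k. pzeta (real j * (1 + t)) * (3 / 2) ^ j / real j)"
  have "E \<le> (\<Sum>j\<in>insert 1 {2..k}. pzeta (real j * (1 + t)) * (3 / 2) ^ j / real j)"
    unfolding E_def by (intro sum_mono2) (auto intro!: mult_nonneg_nonneg divide_nonneg_nonneg pzeta_nonneg)
  also have "\<dots> = 3 / 2 * pzeta (1 + t) + (\<Sum>j=2..k. pzeta (real j * (1 + t)) * (3 / 2) ^ j / real j)"
    by simp
  also have "\<dots> \<le> 3 / 2 * (ln (1 / t) + 3 / 40) + (\<Sum>j=2..k. pzeta (real j) * (3 / 2) ^ j / real j)"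
  proof (intro add_mono mult_left_mono pzeta_le_ln t sum_mono divide_right_mono mult_right_mono)
    fix j assume "j \<in> {2..k}"
    moreover have "real j * 1 \<le> real j * (1 + t)" using t by (intro mult_left_mono) auto
    ultimately show "pzeta (real j * (1 + t)) \<le> pzeta (real j)" by (intro pzeta_antimono) auto
  qed auto
  also have "\<dots> \<le> 3 / 2 * (ln (1 / t) + 3 / 40) + 109 / 100" using sum_pzeta_le [of k] by simp
  also have "\<dots> \<le> - ln t - ln (sqrt t) + 1 + 21 / 100"
    using t by (simp add: ln_div ln_sqrt algebra_simps)
  finally have "exp E \<le> exp (- ln t - ln (sqrt t) + 1 + 21 / 100)" by simp
  also have "\<dots> = 1 / (t * sqrt t) * (exp 1 * exp (21 / 100))"
  proof -
    have eq: "- ln t - ln (sqrt t) + 1 + 21 / 100 = (- ln t) + ((- ln (sqrt t)) + (1 + 21 / 100))"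
      by linarith
    have "exp (- ln y) = 1 / y" if "0 < y" for y :: real
      using that by (simp only: exp_minus exp_ln inverse_eq_divide)
    from this [of t] this [of "sqrt t"] have "exp (- ln t) = 1 / t" "exp (- ln (sqrt t)) = 1 / sqrt t"
      using t by auto
    then show ?thesis unfolding eq exp_add by (simp only:) simp
  qed
  also have "\<dots> \<le> 1 / (t * sqrt t) * (272 / 100 * (1 + 21 / 100 + (21 / 100)\<^sup>2))"
    using t e_less_272 exp_bound [of "21 / 100"] by (intro mult_left_mono mult_mono) auto
  also have "\<dots> \<le> 1 / (t * sqrt t) * (342 / 100)"
    using t by (intro mult_left_mono) (auto simp: power2_eq_square)
  finally have e: "exp E \<le> 1 / (t * sqrt t) * (342 / 100)" .
  have "axp k i \<le> exp E / (3 / 2) ^ k"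
    unfolding axp_eq_hom E_def t_def by (rule hom_le_exp) (auto simp: pzeta_nonneg)
  also have "\<dots> \<le> 1 / (t * sqrt t) * (342 / 100) / (3 / 2) ^ k"
    using e by (intro divide_right_mono) auto
  finally have "t ^ 2 * axp k i \<le> t ^ 2 * (1 / (t * sqrt t) * (342 / 100) / (3 / 2) ^ k)"
    using t by (intro mult_left_mono) auto
  also have "\<dots> = 342 / 100 * (2 / 3) ^ k * (t / sqrt t)"
    using t by (simp add: power2_eq_square power_divide field_simps)
  also have "t / sqrt t = sqrt t" using t by (simp add: real_div_sqrt)
  finally show ?thesis by (simp add: t_def)
qed

text \<open>Replacing \<open>ln 2 - 2 t\<close> by \<open>ln 2\<close> causes an error linear in
  \<open>t\<close>, hence tail sums with the weight \<open>t^2\<close>. The base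
  \<open>3 / 2\<close> used to bound them exceeds \<open>1\<close>, for decay in \<open>k\<close>,
  and stays below \<open>2\<close>, for convergence over the nodes and in the powers of the prime
  \<open>2\<close>.\<close>

definition axtail_sq :: "nat \<Rightarrow> real" where
  "axtail_sq k = (\<Sum>i. octave_t (i + 4) ^ 2 * axp k (i + 4))"

lemma axtail_sq_bound:
  "summable (\<lambda>i. octave_t (i + 4) ^ 2 * axp k (i + 4))" "axtail_sq k \<le> 414 / 100 * (2 / 3) ^ k"
proof -
  define c where "c = 342 / 100 * (2 / 3 :: real) ^ k"
  have sq: "sqrt (octave_t (i + 4)) = sqrt (1 / 8) * (1 / sqrt 2) ^ i" for i
  proof -
    have e: "octave_t (i + 4) = 1 / 8 * (1 / 2) ^ i" by (simp add: octave_t_def power_add power_one_over)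
    show ?thesis unfolding e by (simp only: real_sqrt_mult real_sqrt_power real_sqrt_divide real_sqrt_one)
  qed
  have r2: "1414 / 1000 \<le> sqrt 2" by (rule real_le_rsqrt) (simp add: power2_eq_square)
  have inv2: "1 / sqrt 2 \<le> 1000 / 1414" using r2 by (simp add: field_simps)
  have g: "(\<lambda>i. c * (sqrt (1 / 8) * (1 / sqrt 2) ^ i)) sums (c * (sqrt (1 / 8) * (1 / (1 - 1 / sqrt 2))))"
    by (intro sums_mult geometric_sums) simp
  have le: "octave_t (i + 4) ^ 2 * axp k (i + 4) \<le> c * (sqrt (1 / 8) * (1 / sqrt 2) ^ i)" for i
    using axp_rankin [of "i + 4" k] by (simp add: sq c_def)
  show s: "summable (\<lambda>i. octave_t (i + 4) ^ 2 * axp k (i + 4))"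
    by (rule summable_comparison_test' [OF sums_summable [OF g], where N = 0]) (use le axp_nonneg in auto)
  have "axtail_sq k \<le> c * (sqrt (1 / 8) * (1 / (1 - 1 / sqrt 2)))"
    unfolding axtail_sq_def by (rule sums_le [OF le summable_sums [OF s] g])
  also have "sqrt (1 / 8) * (1 / (1 - 1 / sqrt 2)) \<le> 3536 / 10000 * (1 / (1 - 1000 / 1414))"
  proof (intro mult_mono divide_left_mono)
    show "sqrt (1 / 8) \<le> 3536 / 10000" by (rule real_le_lsqrt) (simp_all add: power2_eq_square)
  qed (use inv2 r2 in auto)
  then have "c * (sqrt (1 / 8) * (1 / (1 - 1 / sqrt 2))) \<le> c * (121 / 100)"
    by (intro mult_left_mono) (auto simp: c_def)
  also have "\<dots> \<le> 414 / 100 * (2 / 3) ^ k" by (simp add: c_def)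
  finally show "axtail_sq k \<le> 414 / 100 * (2 / 3) ^ k" .
qed

lemma power_diff_lower:
  fixes a b :: real
  assumes "0 \<le> b" "b \<le> a"
  shows "a ^ Suc j - real (Suc j) * b * a ^ j \<le> (a - b) ^ Suc j"
proof (induction j)
  case (Suc j)
  have "a ^ Suc (Suc j) - real (Suc (Suc j)) * b * a ^ Suc j
     \<le> (a - b) * (a ^ Suc j - real (Suc j) * b * a ^ j)"
    using assms by (simp add: algebra_simps)
  also have "\<dots> \<le> (a - b) * (a - b) ^ Suc j" using Suc assms by (intro mult_left_mono) auto
  finally show ?case by simp
qed simp

text \<open>Unlike in \<open>axtail_rec_lower\<close>, the weights are exact, so that for
  \<open>j \<ge> 1\<close> they form a probability distribution. The error is a convolution of the
  weights with \<open>axtail_sq\<close>; the weights times \<open>(3 / 2) ^ j\<close> sum to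
  \<open>2 powr (3 / 2) < 2.8285\<close>, and \<open>12.42 * 2.8285 < 35.14\<close>.\<close>

lemma axtail_renewal:
  "(\<Sum>j=1..k. ln 2 ^ j / fact j * axtail 4 (k - j)) - 3514 / 100 * (2 / 3) ^ k \<le> axtail 4 k"
proof -
  define c :: "nat \<Rightarrow> real" where "c j = ln 2 ^ j / fact j" for j
  \<comment> \<open>Up to sign, \<open>d j\<close> is the coefficient of \<open>t\<close> in
    \<open>(ln 2 - 2 t) ^ j / fact j\<close>; Bernoulli's inequality discards the higher
    orders.\<close>
  define d :: "nat \<Rightarrow> real" where "d j = (if j = 0 then 0 else 2 * c (j - 1))" for j
  have ln2: "3 / 5 \<le> ln (2::real)" using ln2_bounds by simp
  have step: "(\<Sum>j\<le>k. (c j - d j * octave_t (i + 4)) * axp (k - j) (i + 4)) \<le> axp k (Suc (i + 4))" for i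
  proof -
    define t where "t = octave_t (i + 4)"
    have t: "0 < t" "t \<le> 1 / 8" using octave_t_pos octave_t_small [of "i + 4"] by (simp_all add: t_def)
    have "(\<Sum>j\<le>k. (c j - d j * t) * axp (k - j) (i + 4)) \<le> (\<Sum>j\<le>k. (ln 2 - 2 * t) ^ j / fact j * axp (k - j) (i + 4))"
    proof (intro sum_mono mult_right_mono axp_nonneg)
      fix j
      show "c j - d j * t \<le> (ln 2 - 2 * t) ^ j / fact j"
      proof (cases j)
        case (Suc m)
        have "(ln 2 ^ Suc m - real (Suc m) * (2 * t) * ln 2 ^ m) / fact (Suc m) \<le> (ln 2 - 2 * t) ^ Suc m / fact (Suc m)"
          using t ln2 by (intro divide_right_mono power_diff_lower) auto
        moreover have "(ln 2 ^ Suc m - real (Suc m) * (2 * t) * ln 2 ^ m) / fact (Suc m) = c j - d j * t"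
          by (simp add: c_def d_def Suc diff_divide_distrib)
        ultimately show ?thesis by (simp only: Suc)
      qed (simp add: c_def d_def)
    qed
    also have "\<dots> \<le> axp k (Suc (i + 4))"
      using t ln2 by (intro axp_Suc_ge) (auto simp: t_def)
    finally show ?thesis by (simp add: t_def)
  qed
  have s: "(\<lambda>i. \<Sum>j\<le>k. c j / 2 * (octave_t (i + 4) * axp (k - j) (i + 4)) - d j / 2 * (octave_t (i + 4) ^ 2 * axp (k - j) (i + 4)))
     sums (\<Sum>j\<le>k. c j / 2 * axtail 4 (k - j) - d j / 2 * axtail_sq (k - j))"
    unfolding axtail_def axtail_sq_def
    by (intro sums_sum sums_diff sums_mult summable_sums summable_axtail axtail_sq_bound(1))
  have "(\<lambda>i. octave_t (i + Suc 4) * axp k (i + Suc 4)) sums axtail (Suc 4) k"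
    unfolding axtail_def by (intro summable_sums summable_axtail)
  with s have "(\<Sum>j\<le>k. c j / 2 * axtail 4 (k - j) - d j / 2 * axtail_sq (k - j)) \<le> axtail (Suc 4) k"
  proof (rule sums_le [rotated])
    fix i
    have "(\<Sum>j\<le>k. c j / 2 * (octave_t (i + 4) * axp (k - j) (i + 4)) - d j / 2 * (octave_t (i + 4) ^ 2 * axp (k - j) (i + 4)))
      = octave_t (i + 4) / 2 * (\<Sum>j\<le>k. (c j - d j * octave_t (i + 4)) * axp (k - j) (i + 4))"
      unfolding sum_distrib_left by (intro sum.cong refl) (simp add: field_simps power2_eq_square)
    also have "\<dots> \<le> octave_t (i + 4) / 2 * axp k (Suc (i + 4))"
      using octave_t_pos [of "i + 4"] by (intro mult_left_mono step) auto
    also have "\<dots> = octave_t (i + Suc 4) * axp k (i + Suc 4)"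
      by (simp only: add_Suc_right octave_t_Suc)
    finally show "(\<Sum>j\<le>k. c j / 2 * (octave_t (i + 4) * axp (k - j) (i + 4)) - d j / 2 * (octave_t (i + 4) ^ 2 * axp (k - j) (i + 4)))
        \<le> octave_t (i + Suc 4) * axp k (i + Suc 4)" .
  qed
  also have "axtail (Suc 4) k \<le> axtail 4 k"
    using axtail_split [of 4 k] octave_t_pos [of 4] axp_nonneg [of k 4] by simp
  finally have m: "(\<Sum>j\<le>k. c j / 2 * axtail 4 (k - j)) - (\<Sum>j\<le>k. d j / 2 * axtail_sq (k - j)) \<le> axtail 4 k"
    by (simp add: sum_subtractf)
  have ins: "{..k} = insert 0 {1..k}" by auto
  have "(\<Sum>j=1..k. d j * axtail_sq (k - j)) \<le> (\<Sum>j=1..k. 2 * c (j - 1) * (414 / 100 * ((2 / 3) ^ k * (3 / 2 * (3 / 2) ^ (j - 1)))))"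
  proof (intro sum_mono)
    fix j assume j: "j \<in> {1..k}"
    have "(3 / 2 :: real) * (3 / 2) ^ (j - 1) = (3 / 2) ^ j" using j by (cases j) auto
    moreover have "(2 / 3 :: real) ^ k * (3 / 2) ^ j = (2 / 3) ^ (k - j)"
    proof -
      have "(2 / 3 :: real) ^ k = (2 / 3) ^ (k - j) * (2 / 3) ^ j"
        using j by (simp add: power_add [symmetric])
      then show ?thesis by (simp add: mult.assoc power_mult_distrib [symmetric])
    qed
    moreover have "0 \<le> 2 * c (j - 1)" using ln2 by (simp add: c_def)
    moreover have "d j = 2 * c (j - 1)" using j by (simp add: d_def)
    ultimately show "d j * axtail_sq (k - j) \<le> 2 * c (j - 1) * (414 / 100 * ((2 / 3) ^ k * (3 / 2 * (3 / 2) ^ (j - 1))))"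
      using axtail_sq_bound(2) [of "k - j"] by (simp only: mult_left_mono)
  qed
  also have "\<dots> = 1242 / 100 * (2 / 3) ^ k * (\<Sum>j=1..k. c (j - 1) * (3 / 2) ^ (j - 1))"
    unfolding sum_distrib_left by (intro sum.cong) auto
  also have "(\<Sum>j=1..k. c (j - 1) * (3 / 2) ^ (j - 1)) = (\<Sum>m<k. c m * (3 / 2) ^ m)"
    by (rule sum.reindex_bij_witness [of _ Suc "\<lambda>j. j - 1"]) auto
  also have "\<dots> = (\<Sum>m<k. (ln 2 * (3 / 2)) ^ m / fact m)"
    unfolding c_def power_mult_distrib by simp
  also have "1242 / 100 * (2 / 3) ^ k * (\<Sum>m<k. (ln 2 * (3 / 2)) ^ m / fact m) \<le> (1242 :: real) / 100 * (2 / 3) ^ k * (28285 / 10000)"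
  proof (rule mult_left_mono)
    define x :: real where "x = ln 2 * (3 / 2)"
    have "(\<lambda>m. x ^ m / fact m) sums exp x"
      using exp_converges [of x] by (simp add: divide_inverse mult.commute)
    then have "(\<Sum>m<k. x ^ m / fact m) \<le> exp x"
      using ln2 by (subst sums_unique) (auto intro!: sum_le_suminf simp: sums_iff x_def)
    also have "exp x = 2 powr (3 / 2)" by (simp add: x_def powr_def mult.commute)
    also have "2 powr (3 / 2) = 2 * sqrt (2 :: real)"
      using powr_add [of "2 :: real" 1 "1 / 2"] by (simp add: powr_half_sqrt)
    also have "sqrt 2 \<le> (14142 / 10000 + 1 / 40000 :: real)" by (rule real_le_lsqrt) (simp_all add: power2_eq_square)
    finally show "(\<Sum>m<k. (ln 2 * (3 / 2)) ^ m / fact m) \<le> (28285 / 10000 :: real)" by (simp add: x_def)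
  qed simp
  also have "\<dots> \<le> 3514 / 100 * (2 / 3) ^ k" by simp
  finally have g: "(\<Sum>j=1..k. d j * axtail_sq (k - j)) \<le> 3514 / 100 * (2 / 3) ^ k" .
  have "axtail 4 k / 2 + (\<Sum>j=1..k. c j * axtail 4 (k - j)) / 2 - (\<Sum>j=1..k. d j * axtail_sq (k - j)) / 2 \<le> axtail 4 k"
    using m unfolding ins by (simp add: c_def d_def sum_divide_distrib)
  then show ?thesis using g by (simp add: c_def)
qed

text \<open>The full sum is \<open>exp (ln 2) - 1 = 1\<close>. As \<open>ln 2 \<le> 7 / 10\<close>
  and \<open>fact j \<ge> 5040\<close> for \<open>j \<ge> 7\<close>, the missing part is dominated
  by a geometric series, with \<open>1512 = 5040 * 3 / 10\<close>.\<close>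

lemma ln2_exp_tail: "1 - (7 / 10) ^ Suc n / 1512 \<le> (\<Sum>j=1..n. ln 2 ^ j / fact j :: real)" if "6 \<le> n"
proof -
  have ln2: "0 \<le> ln (2::real)" "ln (2::real) \<le> 7 / 10" using ln2_bounds by simp_all
  have s: "(\<lambda>j. ln 2 ^ j / fact j) sums (2 :: real)"
    using exp_converges [of "ln 2 :: real"] by (simp add: divide_inverse mult.commute)
  have "(\<lambda>j. ln 2 ^ (j + Suc n) / fact (j + Suc n)) sums (2 - (\<Sum>j<Suc n. ln 2 ^ j / fact j :: real))"
    by (rule sums_split_initial_segment [OF s])
  moreover have "(\<lambda>j. (7 / 10) ^ Suc n / 5040 * (7 / 10) ^ j) sums ((7 / 10) ^ Suc n / 5040 * (1 / (1 - 7 / 10)) :: real)"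
    by (intro sums_mult geometric_sums) simp
  ultimately have "2 - (\<Sum>j<Suc n. ln 2 ^ j / fact j :: real) \<le> (7 / 10) ^ Suc n / 5040 * (1 / (1 - 7 / 10))"
  proof (rule sums_le [rotated])
    fix j
    have "fact 7 \<le> (fact (j + Suc n) :: real)" using that by (intro fact_mono) auto
    then have "5040 \<le> (fact (j + Suc n) :: real)" by (simp add: fact_numeral)
    then have "ln 2 ^ (j + Suc n) / fact (j + Suc n) \<le> (7 / 10 :: real) ^ (j + Suc n) / 5040"
      using ln2 by (intro frac_le power_mono) auto
    then show "ln 2 ^ (j + Suc n) / fact (j + Suc n) \<le> (7 / 10) ^ Suc n / 5040 * (7 / 10 :: real) ^ j"
      by (simp add: power_add mult_ac)
  qed
  moreover have "(\<Sum>j<Suc n. ln 2 ^ j / fact j :: real) = 1 + (\<Sum>j=1..n. ln 2 ^ j / fact j)"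
  proof -
    have "{..<Suc n} = insert 0 {1..n}" by auto
    then show ?thesis by simp
  qed
  ultimately show ?thesis by simp
qed

text \<open>The full series is \<open>2 powr (5 / 4) - 1 = 1.378...\<close>, and six terms already
  come close. The excess over \<open>1\<close> is what absorbs the errors in the induction.\<close>

lemma renewal_gain: "1377 / 1000 \<le> (\<Sum>j=1..n. ln 2 ^ j / fact j * (5 / 4) ^ j :: real)" if "6 \<le> n"
proof -
  have ln2: "8663 / 10000 \<le> ln (2::real) * (5 / 4)" using ln2_bounds by simp
  have "1377 / 1000 \<le> (\<Sum>j=1..6. (8663 / 10000) ^ j / fact j :: real)"
    by (simp add: eval_nat_numeral)
  also have "\<dots> \<le> (\<Sum>j=1..6. ln 2 ^ j / fact j * (5 / 4) ^ j)"
  proof (rule sum_mono)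
    fix j
    have "(8663 / 10000 :: real) ^ j \<le> (ln 2 * (5 / 4)) ^ j" using ln2 by (intro power_mono) auto
    also have "\<dots> = ln 2 ^ j * (5 / 4) ^ j" by (rule power_mult_distrib)
    finally have "(8663 / 10000 :: real) ^ j / fact j \<le> ln 2 ^ j * (5 / 4) ^ j / fact j"
      by (intro divide_right_mono) auto
    then show "(8663 / 10000 :: real) ^ j / fact j \<le> ln 2 ^ j / fact j * (5 / 4) ^ j" by simp
  qed
  also have "\<dots> \<le> (\<Sum>j=1..n. ln 2 ^ j / fact j * (5 / 4) ^ j)"
    using that by (intro sum_mono2) auto
  finally show ?thesis .
qed

text \<open>The weights \<open>ln 2 ^ j / fact j\<close> with \<open>j \<ge> 1\<close> add up to \<open>1\<close>, so the renewal inequality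
  propagates lower bounds; the geometric term grows under averaging and absorbs the error terms.\<close>

lemma axtail_large:
  assumes "20 \<le> k"
  shows "1568438139057 / 2 ^ 40 * (1442756 / 1442640) + 137 / 10000 * (4 / 5) ^ (k - 20) \<le> axtail 4 k"
  using assms
proof (induction k rule: less_induct)
  case (less k)
  define \<mu> :: real where "\<mu> = 1568438139057 / 2 ^ 40 * (1442756 / 1442640)"
  have \<mu>: "0 \<le> \<mu>" "\<mu> \<le> 3 / 2" by (simp_all add: \<mu>_def)
  show ?case
  proof (cases "k \<le> 25")
    case True
    have "1568438139057 * 1442756 * 10000 + 137 * 1099511627776 * 1442640 \<le> tail_table ! (25 - k) * 14426400000"
      using tables_ok(2) less.prems True unfolding list_all_iff set_upt by auto
    then have "real_of_int (1568438139057 * 1442756 * 10000 + 137 * 1099511627776 * 1442640) \<le> real_of_int (tail_table ! (25 - k) * 14426400000)"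
      by (simp only: of_int_le_iff)
    then have "\<mu> + 137 / 10000 \<le> axtail 4 k"
      using tail_table_le [OF True] by (simp add: \<mu>_def)
    moreover have "(4 / 5 :: real) ^ (k - 20) \<le> 1" by (intro power_le_one) auto
    ultimately show ?thesis unfolding \<mu>_def [symmetric] by linarith
  next
    case False
    define n where "n = k - 20"
    have n: "6 \<le> n" "k = n + 20" using False by (auto simp: n_def)
    define c :: "nat \<Rightarrow> real" where "c j = ln 2 ^ j / fact j" for j
    have c0: "0 \<le> c j" for j using ln2_bounds by (simp add: c_def)
    have "(1 - (7 / 10) ^ Suc n / 1512) * \<mu> + 137 / 10000 * (4 / 5) ^ n * (1377 / 1000)
       \<le> (\<Sum>j=1..n. c j) * \<mu> + 137 / 10000 * (4 / 5) ^ n * (\<Sum>j=1..n. c j * (5 / 4) ^ j)"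
      unfolding c_def using \<mu> n by (intro add_mono mult_right_mono mult_left_mono ln2_exp_tail renewal_gain) auto
    also have "\<dots> = (\<Sum>j=1..n. c j * (\<mu> + 137 / 10000 * (4 / 5) ^ (n - j)))"
      unfolding sum_distrib_left sum_distrib_right sum.distrib [symmetric]
    proof (intro sum.cong refl)
      fix j assume "j \<in> {1..n}"
      then have "(4 / 5 :: real) ^ n = (4 / 5) ^ (n - j) * (4 / 5) ^ j" by (simp add: power_add [symmetric])
      then have "(4 / 5 :: real) ^ n * (5 / 4) ^ j = (4 / 5) ^ (n - j)"
        by (simp add: mult.assoc power_mult_distrib [symmetric])
      then show "c j * \<mu> + 137 / 10000 * (4 / 5) ^ n * (c j * (5 / 4) ^ j) = c j * (\<mu> + 137 / 10000 * (4 / 5) ^ (n - j))"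
        by (simp add: algebra_simps)
    qed
    also have "\<dots> \<le> (\<Sum>j=1..n. c j * axtail 4 (k - j))"
    proof (intro sum_mono mult_left_mono c0)
      fix j assume j: "j \<in> {1..n}"
      then have "k - j - 20 = n - j" "k - j < k" "20 \<le> k - j" using n by auto
      then show "\<mu> + 137 / 10000 * (4 / 5) ^ (n - j) \<le> axtail 4 (k - j)"
        using less.IH [of "k - j"] by (simp add: \<mu>_def)
    qed
    also have "\<dots> \<le> (\<Sum>j=1..k. c j * axtail 4 (k - j))"
      using n c0 axtail_nonneg by (intro sum_mono2) auto
    also have "\<dots> \<le> axtail 4 k + 3514 / 100 * (2 / 3) ^ k"
      using axtail_renewal [of k] by (simp add: c_def)
    finally have main: "(1 - (7 / 10) ^ Suc n / 1512) * \<mu> + 137 / 10000 * (4 / 5) ^ n * (1377 / 1000)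
       \<le> axtail 4 k + 3514 / 100 * (2 / 3) ^ k" .
    \<comment> \<open>Both errors decay faster than \<open>(4 / 5) ^ n\<close>, so factoring out
      \<open>w\<close> reduces the comparison to its first case \<open>n = 6\<close>,
      \<open>k = 26\<close>.\<close>
    define m where "m = n - 6"
    have m: "n = m + 6" using n by (simp add: m_def)
    define w :: real where "w = (4 / 5) ^ m"
    have "(7 / 10) ^ Suc n / 1512 * \<mu> \<le> (7 / 10) ^ 7 * w / 1512 * (3 / 2)"
      unfolding m w_def using \<mu> by (intro mult_mono divide_right_mono) (auto simp: power_add intro!: power_mono)
    moreover have "(2 / 3 :: real) ^ k \<le> (2 / 3) ^ 26 * w"
      unfolding n m w_def by (auto simp: power_add intro!: power_mono)
    moreover have "(4 / 5 :: real) ^ n = (4 / 5) ^ 6 * w" by (simp add: m w_def power_add)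
    moreover have "0 \<le> w" by (simp add: w_def)
    moreover have "(7 / 10) ^ 7 / 1512 * (3 / 2) + 3514 / 100 * (2 / 3) ^ 26 \<le> 137 / 10000 * (4 / 5) ^ 6 * (377 / 1000 :: real)"
      by (simp add: power_divide)
    then have "((7 / 10) ^ 7 / 1512 * (3 / 2) + 3514 / 100 * (2 / 3) ^ 26) * w \<le> 137 / 10000 * (4 / 5) ^ 6 * (377 / 1000) * w"
      using \<open>0 \<le> w\<close> by (rule mult_right_mono)
    ultimately have "\<mu> + 137 / 10000 * (4 / 5) ^ n \<le> axtail 4 k"
      using main by (simp add: algebra_simps)
    then show ?thesis by (simp add: \<mu>_def n_def)
  qed
qed

theorem theorem2p1:
  fixes k :: nat
  assumes "k \<ge> 1" and "k \<noteq> 6"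
  shows "erdos_sum (almost_primes 6) < erdos_sum (almost_primes k)"
proof (cases "k \<le> 25")
  case True
  then show ?thesis using assms erdos_sum_6_less_small by simp
next
  case False
  have "0 < 137 / 10000 * (4 / 5 :: real) ^ (k - 20)" by simp
  then have "1568438139057 / 2 ^ 40 * (1442756 / 1442640) < axtail 4 k"
    using axtail_large [of k] False by linarith
  then show ?thesis using assms by (intro erdos_sum_6_less) auto
qed

end
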